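(* Let $u,v$ be solutions of $$\ddot u+Au+\gamma\dot u+f(u)=h+\eta,\qquad \ddot v+Av+\gamma\dot v+f(v)+P_N(f(u)-f(v))=h+\eta\qquad\text{in }\mathbb R,$$ driven by the same $h$ and $\eta$, and write $y^u=[u,\dot u]$, $y^v=[v,\dot v]$. Then the following hold. (1) There exist constants $\alpha>0$, $C>0$ such that $$|y^u(t)-y^v(t)|_{\mathcal H}^2\le |y^u(s)-y^v(s)|_{\mathcal H}^2\exp\Big(-\alpha(t-s)+C\int_s^t(\|u\|_1^2+\|v\|_1^2)\,dr\Big)$$ for any $t\ge s\ge0$ and $N\ge1$. (2) There exists $\alpha>0$ such that for any $\varepsilon>0$ one can find a time $T_0>0$ and an integer $N\ge1$ satisfying $$|y^u(t+T_0)-y^v(t+T_0)|_{\mathcal H}^2\le |y^u(s+T_0)-y^v(s+T_0)|_{\mathcal H}^2\exp\Big(-\alpha(t-s)+C_*\varepsilon\int_{s+T_0}^{t+T_0}\big(\|u\|_1^2+\|v\|_1^2+\|\psi u\|_1^2+\|\psi v\|_1^2\big)dr\Big)$$ for any $t\ge s\ge0$, where $C_*>0$ is a constant depending on $\alpha$.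
   Context: $H=L^2(\mathbb R)$ with norm $\|\cdot\|$; $\|\cdot\|_s$ is the norm of $H^s(\mathbb R)$; $\mathcal H=H^1(\mathbb R)\times L^2(\mathbb R)$. $Au=-u_{xx}+u$, $f(u)=|u|^{2m}u$ with $0<m<1$, $\gamma>0$. $\{e_i\}_{i\ge1}$ is an orthonormal basis of $L^2(\mathbb R)$ and $P_N$ is the orthogonal projection in $L^2(\mathbb R)$ onto $\mathrm{span}\{e_1,\dots,e_N\}$. $h=h(x)\in H$ and $\eta=\partial_t W$, $W(t)=\sum_i b_i\beta_i(t)e_i$, with independent standard Brownian motions $\beta_i$ and $\sum_i b_i^2<\infty$; solutions have trajectories $[u,\dot u],[v,\dot v]\in C([0,\infty);\mathcal H)$ (mild solutions). The norm $|\cdot|_{\mathcal H}$ is $|y|_{\mathcal H}^2=\|y_1\|_1^2+\|y_2+\alpha y_1\|^2$ for $y=(y_1,y_2)\in\mathcal H$, with the same (small) $\alpha>0$ as in the statement; it is equivalent to the usual norm of $\mathcal H$. The weight is $\psi(x,t)=\varphi(x)\big(1-\exp(-t/\varphi(x))\big)$ with $\varphi(x)=\ln(x^2+2)$. In the integrals, $u,v,\psi$ are evaluated at time $r$. The constants $\alpha,C,C_*,T_0,N$ do not depend on the particular solutions $u,v$. *)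

theory Defs
  imports "HOL-Probability.Probability"
begin

section \<open>The real Hilbert space \<open>L\<^sup>2\<close> of the line\<close>

definition sq_integrable :: "(real \<Rightarrow> real) \<Rightarrow> bool" where
  "sq_integrable f \<longleftrightarrow> f \<in> borel_measurable borel \<and> integrable lborel (\<lambda>x. (f x)\<^sup>2)"

lemma sq_integrable_mult:
  assumes "sq_integrable f" "sq_integrable g"
  shows "integrable lborel (\<lambda>x. f x * g x)"
proof (rule Bochner_Integration.integrable_bound)
  show "integrable lborel (\<lambda>x. (f x)\<^sup>2 + (g x)\<^sup>2)"
    using assms by (auto simp: sq_integrable_def)
  show "(\<lambda>x. f x * g x) \<in> borel_measurable lborel"
    using assms by (auto simp: sq_integrable_def)
  have "\<bar>a * b\<bar> \<le> a\<^sup>2 + b\<^sup>2" for a b :: real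
  proof -
    have "0 \<le> (\<bar>a\<bar> - \<bar>b\<bar>)\<^sup>2" by simp
    then have "2 * (\<bar>a\<bar> * \<bar>b\<bar>) \<le> a\<^sup>2 + b\<^sup>2" by (simp add: power2_diff)
    moreover have "0 \<le> \<bar>a\<bar> * \<bar>b\<bar>" by simp
    ultimately show ?thesis by (simp only: abs_mult)
  qed
  then show "AE x in lborel. norm (f x * g x) \<le> norm ((f x)\<^sup>2 + (g x)\<^sup>2)"
    by (auto simp: abs_of_nonneg)
qed

lemma sq_integrable_zero: "sq_integrable (\<lambda>x. 0)"
  by (simp add: sq_integrable_def)

lemma sq_integrable_scale: "sq_integrable f \<Longrightarrow> sq_integrable (\<lambda>x. c * f x)"
  by (auto simp: sq_integrable_def power_mult_distrib)

lemma sq_integrable_add: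
  assumes "sq_integrable f" "sq_integrable g"
  shows "sq_integrable (\<lambda>x. f x + g x)"
proof -
  have "integrable lborel (\<lambda>x. (f x)\<^sup>2 + (g x)\<^sup>2 + 2 * (f x * g x))"
    using assms sq_integrable_mult[OF assms] by (auto simp: sq_integrable_def)
  then show ?thesis
    using assms by (auto simp: sq_integrable_def power2_sum mult.assoc)
qed

definition l2_eq :: "(real \<Rightarrow> real) \<Rightarrow> (real \<Rightarrow> real) \<Rightarrow> bool" where
  "l2_eq f g \<longleftrightarrow> sq_integrable f \<and> sq_integrable g \<and> (AE x in lborel. f x = g x)"

text \<open>\<open>abs_l2 f\<close> is the class of a square integrable \<open>f\<close>; \<open>rep_l2 u\<close> is a representative.\<close>

quotient_type l2 = "real \<Rightarrow> real" / partial: l2_eq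
proof (rule part_equivpI)
  show "\<exists>f. l2_eq f f"
    using sq_integrable_zero by (auto simp: l2_eq_def)
  show "symp l2_eq" by (auto simp: symp_def l2_eq_def)
  show "transp l2_eq" by (auto simp: transp_def l2_eq_def)
qed

instantiation l2 :: real_vector
begin

lift_definition zero_l2 :: l2 is "\<lambda>x. 0"
  by (simp add: l2_eq_def sq_integrable_zero)

lift_definition plus_l2 :: "l2 \<Rightarrow> l2 \<Rightarrow> l2" is "\<lambda>f g x. f x + g x"
  by (auto simp: l2_eq_def sq_integrable_add)

lift_definition uminus_l2 :: "l2 \<Rightarrow> l2" is "\<lambda>f x. - f x"
  using sq_integrable_scale[of _ "-1"] by (auto simp: l2_eq_def)

lift_definition scaleR_l2 :: "real \<Rightarrow> l2 \<Rightarrow> l2" is "\<lambda>c f x. c * f x"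
  by (auto simp: l2_eq_def sq_integrable_scale)

definition minus_l2 :: "l2 \<Rightarrow> l2 \<Rightarrow> l2" where "minus_l2 u v = u + - v"

instance
proof
  fix x y z :: l2 and a b :: real
  show "x + y + z = x + (y + z)"
    by transfer (auto simp: l2_eq_def add.assoc intro!: sq_integrable_add)
  show "x + y = y + x"
    by transfer (auto simp: l2_eq_def add.commute intro!: sq_integrable_add)
  show "0 + x = x"
    by transfer (auto simp: l2_eq_def)
  show "- x + x = 0"
    by transfer (auto simp: l2_eq_def sq_integrable_zero)
  show "x - y = x + - y" by (simp add: minus_l2_def)
  show "a *\<^sub>R (x + y) = a *\<^sub>R x + a *\<^sub>R y"
    by transfer (auto simp: l2_eq_def distrib_left intro!: sq_integrable_add sq_integrable_scale
      sq_integrable_scale[OF sq_integrable_add, simplified distrib_left])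
  show "(a + b) *\<^sub>R x = a *\<^sub>R x + b *\<^sub>R x"
    by transfer (auto simp: l2_eq_def distrib_right intro!: sq_integrable_add sq_integrable_scale)
  show "a *\<^sub>R b *\<^sub>R x = (a * b) *\<^sub>R x"
    by transfer (auto simp: l2_eq_def mult.assoc intro!: sq_integrable_scale)
  show "1 *\<^sub>R x = x"
    by transfer (auto simp: l2_eq_def)
qed

end

instantiation l2 :: real_inner
begin

lift_definition inner_l2 :: "l2 \<Rightarrow> l2 \<Rightarrow> real" is "\<lambda>f g. LINT x|lborel. f x * g x"
  by (rule integral_cong_AE) (auto simp: l2_eq_def sq_integrable_def)

definition norm_l2 :: "l2 \<Rightarrow> real" where "norm_l2 u = sqrt (inner u u)"
definition sgn_l2 :: "l2 \<Rightarrow> l2" where "sgn_l2 u = u /\<^sub>R norm u"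
definition dist_l2 :: "l2 \<Rightarrow> l2 \<Rightarrow> real" where "dist_l2 u v = norm (u - v)"
definition uniformity_l2 :: "(l2 \<times> l2) filter" where
  "uniformity_l2 = (INF e\<in>{0<..}. principal {(x, y). dist x y < e})"
definition open_l2 :: "l2 set \<Rightarrow> bool" where
  "open_l2 U = (\<forall>x\<in>U. \<forall>\<^sub>F (x', y) in uniformity. x' = x \<longrightarrow> y \<in> U)"

instance
proof
  fix x y z :: l2 and a :: real
  show "sgn x = x /\<^sub>R norm x" by (simp add: sgn_l2_def)
  show "dist x y = norm (x - y)" by (simp add: dist_l2_def)
  show "uniformity = (INF e\<in>{0<..}. principal {(x::l2, y). dist x y < e})"
    by (simp add: uniformity_l2_def)
  show "open U = (\<forall>x\<in>U. \<forall>\<^sub>F (x', y) in uniformity. x' = x \<longrightarrow> y \<in> U)" for U :: "l2 set"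
    by (simp add: open_l2_def)
  show "inner x y = inner y x" by transfer (simp add: mult.commute)
  show "inner (x + y) z = inner x z + inner y z"
    by transfer (simp add: l2_eq_def distrib_right sq_integrable_mult)
  show "inner (a *\<^sub>R x) y = a * inner x y"
    by transfer (simp add: mult.assoc)
  show "0 \<le> inner x x" by transfer simp
  show "inner x x = 0 \<longleftrightarrow> x = 0"
  proof transfer
    fix f assume "l2_eq f f"
    then have f: "sq_integrable f" "integrable lborel (\<lambda>x. f x * f x)"
      by (auto simp: l2_eq_def sq_integrable_mult)
    have "(LINT x|lborel. f x * f x) = 0 \<longleftrightarrow> (AE x in lborel. f x * f x = 0)"
      by (rule integral_nonneg_eq_0_iff_AE[OF f(2)]) simp
    then show "(LINT x|lborel. f x * f x) = 0 \<longleftrightarrow> l2_eq f (\<lambda>x. 0)"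
      using f(1) by (simp add: l2_eq_def sq_integrable_zero)
  qed
  show "norm x = sqrt (inner x x)" by (simp add: norm_l2_def)
qed

end


section \<open>The Sobolev space \<open>H\<^sup>1\<close> of the line\<close>

text \<open>
  \<open>C\<^sub>c\<^sup>1\<close> test functions; the weak derivatives they define are the same as for \<open>C\<^sub>c\<^sup>\<infinity>\<close>
  (Brezis, Functional Analysis, Sobolev Spaces and PDE, Section 8.2).
\<close>

definition test_function :: "(real \<Rightarrow> real) \<Rightarrow> bool" where
  "test_function \<phi> \<longleftrightarrow> \<phi> C1_differentiable_on UNIV \<and> (\<exists>R. \<forall>x. R < \<bar>x\<bar> \<longrightarrow> \<phi> x = 0)"

lemma test_function_sq_integrable:
  assumes "test_function \<phi>"
  shows "sq_integrable \<phi>" "sq_integrable (deriv \<phi>)"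
proof -
  obtain D R where D: "\<And>x. (\<phi> has_vector_derivative D x) (at x)" "continuous_on UNIV D"
    and R: "\<And>x. R < \<bar>x\<bar> \<Longrightarrow> \<phi> x = 0"
    using assms by (auto simp: test_function_def C1_differentiable_on_def)
  have dD: "deriv \<phi> = D"
    using D(1) by (auto simp: fun_eq_iff has_real_derivative_iff_has_vector_derivative[symmetric]
        intro: DERIV_imp_deriv)
  have c\<phi>: "continuous_on UNIV \<phi>"
    using D(1) by (meson continuous_at_imp_continuous_on has_vector_derivative_continuous)
  have D0: "D x = 0" if "R < \<bar>x\<bar>" for x
  proof -
    have op: "open {y. R < \<bar>y\<bar>}"
      by (rule open_Collect_less) (intro continuous_intros)+
    have "((\<lambda>x. 0) has_vector_derivative D x) (at x)"
      by (rule has_vector_derivative_transform_within_open[OF D(1) op]) (use that R in auto)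
    then show ?thesis
      by (metis has_vector_derivative_const vector_derivative_unique_at)
  qed
  have sq: "sq_integrable f" if f: "continuous_on UNIV f" "\<And>x. R < \<bar>x\<bar> \<Longrightarrow> f x = 0"
    for f :: "real \<Rightarrow> real"
  proof -
    have "set_integrable lborel {-\<bar>R\<bar>..\<bar>R\<bar>} (\<lambda>x. (f x)\<^sup>2)"
      by (rule borel_integrable_atLeastAtMost') (intro continuous_intros continuous_on_subset[OF f(1)], simp)
    moreover have "(\<lambda>x. indicator {-\<bar>R\<bar>..\<bar>R\<bar>} x *\<^sub>R (f x)\<^sup>2) = (\<lambda>x. (f x)\<^sup>2)"
      using f(2) by (force simp: fun_eq_iff indicator_def)
    ultimately show ?thesis
      using f(1) by (simp add: set_integrable_def sq_integrable_def borel_measurable_continuous_onI)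
  qed
  show "sq_integrable \<phi>" "sq_integrable (deriv \<phi>)"
    using sq[OF c\<phi>] sq[OF D(2)] R D0 by (auto simp: dD)
qed

lift_definition weak_deriv :: "l2 \<Rightarrow> l2 \<Rightarrow> bool" is
  "\<lambda>u g. \<forall>\<phi>. test_function \<phi> \<longrightarrow>
     (LINT x|lborel. u x * deriv \<phi> x) = - (LINT x|lborel. g x * \<phi> x)"
proof -
  fix u v g k assume *: "l2_eq u v" "l2_eq g k"
  have eq: "(LINT x|lborel. f x * p x) = (LINT x|lborel. f' x * p x)"
    if "l2_eq f f'" "sq_integrable p" for f f' p
    using that by (intro integral_cong_AE) (auto simp: l2_eq_def sq_integrable_def)
  show "(\<forall>\<phi>. test_function \<phi> \<longrightarrow> (LINT x|lborel. u x * deriv \<phi> x) = - (LINT x|lborel. g x * \<phi> x)) =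
    (\<forall>\<phi>. test_function \<phi> \<longrightarrow> (LINT x|lborel. v x * deriv \<phi> x) = - (LINT x|lborel. k x * \<phi> x))"
    using eq[OF *(1)] eq[OF *(2)] test_function_sq_integrable by simp
qed

lemma weak_deriv_zero: "weak_deriv 0 0"
  by transfer simp

lemma weak_deriv_add: "weak_deriv u g \<Longrightarrow> weak_deriv v k \<Longrightarrow> weak_deriv (u + v) (g + k)"
  by transfer (auto simp: l2_eq_def distrib_right sq_integrable_mult test_function_sq_integrable)

lemma weak_deriv_scaleR: "weak_deriv u g \<Longrightarrow> weak_deriv (c *\<^sub>R u) (c *\<^sub>R g)"
  by transfer (simp add: mult.assoc)

text \<open>
  An element of \<open>H\<^sup>1\<close> is stored together with its weak derivative, which is unique; in this way
  the inner product of \<open>H\<^sup>1\<close> is inherited from the product space.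
\<close>

typedef h1 = "{p :: l2 \<times> l2. weak_deriv (fst p) (snd p)}"
  by (rule exI[of _ 0]) (simp add: weak_deriv_zero)

lifting_forget l2.lifting
setup_lifting type_definition_h1

lift_definition h1_emb :: "h1 \<Rightarrow> l2" is fst .

lift_definition h1_deriv :: "h1 \<Rightarrow> l2" is snd .

instantiation h1 :: real_vector
begin

lift_definition zero_h1 :: h1 is 0
  by (simp add: weak_deriv_zero)

lift_definition plus_h1 :: "h1 \<Rightarrow> h1 \<Rightarrow> h1" is "(+)"
  by (simp add: weak_deriv_add)

lift_definition scaleR_h1 :: "real \<Rightarrow> h1 \<Rightarrow> h1" is scaleR
  by (simp add: weak_deriv_scaleR)

definition uminus_h1 :: "h1 \<Rightarrow> h1" where "uminus_h1 u = (-1) *\<^sub>R u"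
definition minus_h1 :: "h1 \<Rightarrow> h1 \<Rightarrow> h1" where "minus_h1 u v = u + - v"

instance
proof
  fix x y z :: h1 and a b :: real
  show "x + y + z = x + (y + z)" by transfer (rule add.assoc)
  show "x + y = y + x" by transfer (rule add.commute)
  show "0 + x = x" by transfer simp
  show "- x + x = 0" unfolding uminus_h1_def by transfer simp
  show "x - y = x + - y" by (simp add: minus_h1_def)
  show "a *\<^sub>R (x + y) = a *\<^sub>R x + a *\<^sub>R y" by transfer (rule scaleR_add_right)
  show "(a + b) *\<^sub>R x = a *\<^sub>R x + b *\<^sub>R x" by transfer (rule scaleR_add_left)
  show "a *\<^sub>R b *\<^sub>R x = (a * b) *\<^sub>R x" by transfer simp
  show "1 *\<^sub>R x = x" by transfer simp
qed

end

instantiation h1 :: real_inner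
begin

lift_definition inner_h1 :: "h1 \<Rightarrow> h1 \<Rightarrow> real" is inner .

definition norm_h1 :: "h1 \<Rightarrow> real" where "norm_h1 u = sqrt (inner u u)"
definition sgn_h1 :: "h1 \<Rightarrow> h1" where "sgn_h1 u = u /\<^sub>R norm u"
definition dist_h1 :: "h1 \<Rightarrow> h1 \<Rightarrow> real" where "dist_h1 u v = norm (u - v)"
definition uniformity_h1 :: "(h1 \<times> h1) filter" where
  "uniformity_h1 = (INF e\<in>{0<..}. principal {(x, y). dist x y < e})"
definition open_h1 :: "h1 set \<Rightarrow> bool" where
  "open_h1 U = (\<forall>x\<in>U. \<forall>\<^sub>F (x', y) in uniformity. x' = x \<longrightarrow> y \<in> U)"

instance
proof
  fix x y z :: h1 and a :: real
  show "sgn x = x /\<^sub>R norm x" by (simp add: sgn_h1_def)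
  show "dist x y = norm (x - y)" by (simp add: dist_h1_def)
  show "uniformity = (INF e\<in>{0<..}. principal {(x::h1, y). dist x y < e})"
    by (simp add: uniformity_h1_def)
  show "open U = (\<forall>x\<in>U. \<forall>\<^sub>F (x', y) in uniformity. x' = x \<longrightarrow> y \<in> U)" for U :: "h1 set"
    by (simp add: open_h1_def)
  show "inner x y = inner y x" by transfer (rule inner_commute)
  show "inner (x + y) z = inner x z + inner y z" by transfer (rule inner_add_left)
  show "inner (a *\<^sub>R x) y = a * inner x y" by transfer (rule inner_scaleR_left)
  show "0 \<le> inner x x" by transfer (rule inner_ge_zero)
  show "inner x x = 0 \<longleftrightarrow> x = 0" by transfer (rule inner_eq_zero_iff)
  show "norm x = sqrt (inner x x)" by (simp add: norm_h1_def)
qed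

end

lemma norm_h1: "(norm u)\<^sup>2 = (norm (h1_emb u))\<^sup>2 + (norm (h1_deriv u))\<^sup>2"
  unfolding power2_norm_eq_inner by transfer (simp add: inner_prod_def)

text \<open>Inverse of the embedding \<open>h1_emb\<close>; meaningful only if the argument lies in \<open>H\<^sup>1\<close>.\<close>

definition h1_of :: "l2 \<Rightarrow> h1" where
  "h1_of u = (THE U. h1_emb U = u)"


section \<open>The nonlinearity, the weight and the energy norm\<close>

text \<open>
  \<open>nemytskii m u\<close> is \<open>f(u) = \<bar>u\<bar>\<^bsup>2m\<^esup> u\<close>, which is square integrable because \<open>H\<^sup>1 \<subseteq> L\<^sup>\<infinity>\<close>.
\<close>

definition nemytskii :: "real \<Rightarrow> h1 \<Rightarrow> l2" where
  "nemytskii m u =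
     abs_l2 (\<lambda>x. \<bar>rep_l2 (h1_emb u) x\<bar> powr (2 * m) * rep_l2 (h1_emb u) x)"

definition phi :: "real \<Rightarrow> real" where
  "phi x = ln (x\<^sup>2 + 2)"

definition psi :: "real \<Rightarrow> real \<Rightarrow> real" where
  "psi x t = phi x * (1 - exp (- t / phi x))"

text \<open>
  For fixed \<open>t \<ge> 0\<close> both \<open>psi x t\<close> and its \<open>x\<close>-derivative are bounded in \<open>x\<close>, so the product below
  always lies in \<open>H\<^sup>1\<close>.
\<close>

definition weight_mult :: "real \<Rightarrow> h1 \<Rightarrow> h1" where
  "weight_mult t u = h1_of (abs_l2 (\<lambda>x. psi x t * rep_l2 (h1_emb u) x))"

definition energy_norm :: "real \<Rightarrow> h1 \<times> l2 \<Rightarrow> real" where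
  "energy_norm \<alpha> y = sqrt ((norm (fst y))\<^sup>2 + (norm (snd y + \<alpha> *\<^sub>R h1_emb (fst y)))\<^sup>2)"

definition orthonormal_basis :: "(nat \<Rightarrow> l2) \<Rightarrow> bool" where
  "orthonormal_basis e \<longleftrightarrow>
     (\<forall>i\<ge>1. \<forall>j\<ge>1. inner (e i) (e j) = (if i = j then 1 else 0)) \<and>
     closure (span (e ` {1..})) = UNIV"

definition orth_proj :: "l2 set \<Rightarrow> l2 \<Rightarrow> l2" where
  "orth_proj V g = (THE p. p \<in> V \<and> (\<forall>z\<in>V. inner (g - p) z = 0))"

definition proj_N :: "(nat \<Rightarrow> l2) \<Rightarrow> nat \<Rightarrow> l2 \<Rightarrow> l2" where
  "proj_N e N = orth_proj (span (e ` {1..N}))"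


section \<open>The linear semigroup\<close>

text \<open>Unbounded operators are given by their graphs. \<open>op_A u w\<close>: \<open>u \<in> H\<^sup>2\<close> and \<open>w = - u\<^sub>x\<^sub>x + u\<close>.\<close>

definition op_A :: "h1 \<Rightarrow> l2 \<Rightarrow> bool" where
  "op_A u w \<longleftrightarrow> (\<exists>U. h1_emb U = h1_deriv u \<and> w = - h1_deriv U + h1_emb u)"

text \<open>The operator \<open>(u, p) \<mapsto> (p, - A u - \<gamma> p)\<close> with domain \<open>H\<^sup>2 \<times> H\<^sup>1\<close>.\<close>

definition wave_op :: "real \<Rightarrow> h1 \<times> l2 \<Rightarrow> h1 \<times> l2 \<Rightarrow> bool" where
  "wave_op \<gamma> y z \<longleftrightarrow>
     h1_emb (fst z) = snd y \<and> (\<exists>w. op_A (fst y) w \<and> snd z = - w - \<gamma> *\<^sub>R snd y)"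

definition c0_semigroup :: "(real \<Rightarrow> 'a \<Rightarrow> 'a::real_normed_vector) \<Rightarrow> bool" where
  "c0_semigroup S \<longleftrightarrow>
     (\<forall>t\<ge>0. bounded_linear (S t)) \<and> S 0 = id \<and>
     (\<forall>s\<ge>0. \<forall>t\<ge>0. S (s + t) = S s \<circ> S t) \<and>
     (\<forall>y. ((\<lambda>t. S t y) \<longlongrightarrow> y) (at_right 0))"

definition c0_generated_by ::
  "(real \<Rightarrow> 'a \<Rightarrow> 'a::real_normed_vector) \<Rightarrow> ('a \<Rightarrow> 'a \<Rightarrow> bool) \<Rightarrow> bool" where
  "c0_generated_by S L \<longleftrightarrow> c0_semigroup S \<and>
     (\<forall>y z. L y z \<longleftrightarrow> ((\<lambda>t. (S t y - y) /\<^sub>R t) \<longlongrightarrow> z) (at_right 0))"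


section \<open>The noise\<close>

definition brownian_motion :: "'w measure \<Rightarrow> (real \<Rightarrow> 'w \<Rightarrow> real) \<Rightarrow> bool" where
  "brownian_motion M B \<longleftrightarrow>
     (\<forall>t\<ge>0. B t \<in> borel_measurable M) \<and>
     (AE \<omega> in M. B 0 \<omega> = 0) \<and>
     (AE \<omega> in M. continuous_on {0..} (\<lambda>t. B t \<omega>)) \<and>
     (\<forall>s t. 0 \<le> s \<and> s < t \<longrightarrow>
        distributed M lborel (\<lambda>\<omega>. B t \<omega> - B s \<omega>) (normal_density 0 (sqrt (t - s)))) \<and>
     (\<forall>\<tau> n. 0 \<le> \<tau> 0 \<and> mono \<tau> \<longrightarrow>
        prob_space.indep_vars M (\<lambda>_. borel) (\<lambda>j \<omega>. B (\<tau> (Suc j)) \<omega> - B (\<tau> j) \<omega>) {..<n::nat})"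

text \<open>Independence of whole paths, regarded as random elements of \<open>\<real>\<^bsup>[0,\<infinity>)\<^esup>\<close>.\<close>

definition indep_processes :: "'w measure \<Rightarrow> (nat \<Rightarrow> real \<Rightarrow> 'w \<Rightarrow> real) \<Rightarrow> nat set \<Rightarrow> bool" where
  "indep_processes M B I \<longleftrightarrow>
     prob_space.indep_vars M (\<lambda>_. PiM {0..} (\<lambda>_. borel)) (\<lambda>i \<omega>. \<lambda>t\<in>{0..}. B i t \<omega>) I"

text \<open>
  Convergence in \<open>L\<^sup>2(\<Omega>; E)\<close>. Measurability of the norms, automatic for measurable \<open>X\<close> and \<open>Z\<close>
  when \<open>E\<close> is separable, is stated because separability is not part of the type class.
\<close>

definition L2_tendsto ::
  "'w measure \<Rightarrow> (nat \<Rightarrow> 'w \<Rightarrow> 'a::real_normed_vector) \<Rightarrow> ('w \<Rightarrow> 'a) \<Rightarrow> bool" where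
  "L2_tendsto M X Z \<longleftrightarrow>
     Z \<in> borel_measurable M \<and>
     (\<forall>n. (\<lambda>\<omega>. norm (X n \<omega> - Z \<omega>)) \<in> borel_measurable M) \<and>
     (\<lambda>n. \<integral>\<^sup>+ \<omega>. ennreal ((norm (X n \<omega> - Z \<omega>))\<^sup>2) \<partial>M) \<longlonglongrightarrow> 0"

text \<open>\<open>W(t) = \<Sum>\<^sub>i b\<^sub>i \<beta>\<^sub>i(t) e\<^sub>i\<close>, summed over \<open>i \<ge> 1\<close> in \<open>L\<^sup>2(\<Omega>; L\<^sup>2)\<close>.\<close>

definition noise_process ::
  "'w measure \<Rightarrow> (nat \<Rightarrow> real) \<Rightarrow> (nat \<Rightarrow> real \<Rightarrow> 'w \<Rightarrow> real) \<Rightarrow> (nat \<Rightarrow> l2) \<Rightarrow>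
   (real \<Rightarrow> 'w \<Rightarrow> l2) \<Rightarrow> bool" where
  "noise_process M b \<beta> e W \<longleftrightarrow>
     (\<forall>i\<ge>1. brownian_motion M (\<beta> i)) \<and> indep_processes M \<beta> {1..} \<and>
     summable (\<lambda>i. (b i)\<^sup>2) \<and>
     (\<forall>t\<ge>0. L2_tendsto M (\<lambda>n \<omega>. \<Sum>i=1..n. (b i * \<beta> i t \<omega>) *\<^sub>R e i) (W t))"

text \<open>
  \<open>Z\<close> is the stochastic convolution \<open>\<integral>\<^sub>0\<^sup>t S(t - r) (0, dW(r))\<close>. The integrand is deterministic and
  strongly continuous, so the integral is the limit of its left-endpoint sums.
\<close>

definition stoch_convolution ::
  "'w measure \<Rightarrow> (real \<Rightarrow> h1 \<times> l2 \<Rightarrow> h1 \<times> l2) \<Rightarrow> (real \<Rightarrow> 'w \<Rightarrow> l2) \<Rightarrow> real \<Rightarrow>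
   ('w \<Rightarrow> h1 \<times> l2) \<Rightarrow> bool" where
  "stoch_convolution M S W t Z \<longleftrightarrow>
     L2_tendsto M
       (\<lambda>n \<omega>. \<Sum>j<Suc n.
          S (t - t * real j / real (Suc n))
            (0, W (t * real (Suc j) / real (Suc n)) \<omega> - W (t * real j / real (Suc n)) \<omega>)) Z"


section \<open>Mild solutions\<close>

text \<open>
  Mild solutions of \<open>\<partial>\<^sub>t\<^sup>2 u + A u + \<gamma> \<partial>\<^sub>t u + G = h + \<partial>\<^sub>t W\<close>, written for the process
  \<open>y = [u, \<partial>\<^sub>t u]\<close>. The damping is part of the generator of \<open>S\<close>.
\<close>

definition mild_solution ::
  "'w measure \<Rightarrow> (real \<Rightarrow> h1 \<times> l2 \<Rightarrow> h1 \<times> l2) \<Rightarrow> l2 \<Rightarrow> (real \<Rightarrow> 'w \<Rightarrow> l2) \<Rightarrow>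
   ('w \<Rightarrow> real \<Rightarrow> l2) \<Rightarrow> ('w \<Rightarrow> real \<Rightarrow> h1 \<times> l2) \<Rightarrow> bool" where
  "mild_solution M S h W G y \<longleftrightarrow>
     (\<forall>t\<ge>0. (\<lambda>\<omega>. y \<omega> t) \<in> borel_measurable M) \<and>
     (AE \<omega> in M. continuous_on {0..} (y \<omega>)) \<and>
     (AE \<omega> in M. \<forall>t\<ge>0.
        ((\<lambda>r. h1_emb (fst (y \<omega> r))) has_vector_derivative snd (y \<omega> t)) (at t within {0..})) \<and>
     (\<forall>t\<ge>0. \<exists>Z. stoch_convolution M S W t Z \<and>
        (AE \<omega> in M. ((\<lambda>r. S (t - r) (0, h - G \<omega> r))
           has_integral (y \<omega> t - S t (y \<omega> 0) - Z \<omega>)) {0..t}))"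

definition solves_u ::
  "real \<Rightarrow> 'w measure \<Rightarrow> (real \<Rightarrow> h1 \<times> l2 \<Rightarrow> h1 \<times> l2) \<Rightarrow> l2 \<Rightarrow> (real \<Rightarrow> 'w \<Rightarrow> l2) \<Rightarrow>
   ('w \<Rightarrow> real \<Rightarrow> h1 \<times> l2) \<Rightarrow> bool" where
  "solves_u m M S h W yu \<longleftrightarrow>
     mild_solution M S h W (\<lambda>\<omega> r. nemytskii m (fst (yu \<omega> r))) yu"

definition solves_v ::
  "real \<Rightarrow> (nat \<Rightarrow> l2) \<Rightarrow> nat \<Rightarrow> 'w measure \<Rightarrow> (real \<Rightarrow> h1 \<times> l2 \<Rightarrow> h1 \<times> l2) \<Rightarrow> l2 \<Rightarrow>
   (real \<Rightarrow> 'w \<Rightarrow> l2) \<Rightarrow> ('w \<Rightarrow> real \<Rightarrow> h1 \<times> l2) \<Rightarrow> ('w \<Rightarrow> real \<Rightarrow> h1 \<times> l2) \<Rightarrow> bool" where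
  "solves_v m e N M S h W yu yv \<longleftrightarrow>
     mild_solution M S h W
       (\<lambda>\<omega> r. nemytskii m (fst (yv \<omega> r)) +
              proj_N e N (nemytskii m (fst (yu \<omega> r)) - nemytskii m (fst (yv \<omega> r)))) yv"

end

(*
  The difference w = y^u - y^v solves a mild equation in which noise and h have cancelled, with
  forcing -(I - P_N)(f(u) - f(v)). In the norm |.|_H the linear semigroup decays like
  exp(-3 alpha t / 4), with alpha = gamma / (2 + gamma^2), because its generator is dissipative there; a
  Gronwall argument for the mild equation then reduces both claims to bounds of the form
  ||(I - P_N)(f(u) - f(v))|| <= c ||u - v||_1.

  For (1), H^1 is embedded in L^infinity and ||u||^(2m) is at most a small constant plus
  C ||u||^2 because 2m < 2. For (2), where |x| is large, |u| <= |psi u| / K with K large, since psi >= K there for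
  t >= T_0. On a bounded interval, f(u) - f(v) has a modulus of continuity which is linear in
  ||u - v||_1, so it is uniformly close to step functions on a fixed grid, and I - P_N tends to 0
  on these finitely many steps.
*)
theory Submission
  imports Defs
begin

text \<open>Two obstacles shape the proof. First, a mild trajectory need not be differentiable in
  \<open>h1 \<times> l2\<close>, so the energy identity cannot be obtained by differentiating
  \<open>energy_norm\<close>. It is replaced by difference quotients over short intervals that
  contain the given time; one step of variation of constants bounds these from above, and the
  Gronwall lemma is phrased for exactly such bounds. Second, the mild equation holds, for each time,
  off a null set that depends on this time. It is therefore used at rational times only, and
  continuity of the paths together with joint continuity of the semigroup carries it to all times,
  so that one null set serves all pairs s, t.

  The integrals and the uniform boundedness principle require complete spaces, hence the
  completeness of \<open>l2\<close> and \<open>h1\<close>. Pointwise bounds require a continuous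
  representative of each element of \<open>h1\<close>, which is built from the weak derivative. The
  same \<alpha> serves both claims, and the constant of claim (2) is 2.\<close>

section \<open>A Gronwall inequality for straddling difference quotients\<close>

text \<open>Bisection: the bound \<open>\<psi> s' - \<psi> s \<le> \<epsilon> * (s' - s)\<close>
  adds up over adjacent intervals, so if it failed on [a, b] it would fail on arbitrarily short
  intervals around some t, which \<open>loc\<close> excludes. The quotients need only lie below a
  convergent sequence, because the semigroup decay used later is itself an inequality.\<close>

lemma nonincreasing_if_straddle_le_0:
  fixes \<psi> :: "real \<Rightarrow> real"
  assumes "a \<le> b"
    and loc: "\<And>t s s'. \<lbrakk>t \<in> {a..b}; \<And>n::nat. a \<le> s n \<and> s n \<le> t \<and> t \<le> s' n \<and> s' n \<le> b \<and> s n < s' n;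
      s \<longlonglongrightarrow> t; s' \<longlonglongrightarrow> t\<rbrakk> \<Longrightarrow>
      \<exists>X l. (\<forall>n. (\<psi> (s' n) - \<psi> (s n)) / (s' n - s n) \<le> X n) \<and> X \<longlonglongrightarrow> l \<and> l \<le> 0"
  shows "\<psi> b \<le> \<psi> a"
proof -
  have *: "\<psi> b - \<psi> a \<le> \<epsilon> * (b - a)" if "\<epsilon> > 0" for \<epsilon>
  proof -
    \<comment> \<open>The guards \<open>a \<le> s\<close> and \<open>s' \<le> b\<close> make
      \<open>P\<close> vacuous for intervals that leave [a, b], which the local step of
      \<open>Bolzano\<close> does not exclude.\<close>
    define P where "P s s' \<longleftrightarrow> (a \<le> s \<longrightarrow> s' \<le> b \<longrightarrow> s \<le> s' \<longrightarrow> \<psi> s' - \<psi> s \<le> \<epsilon> * (s' - s))" for s s'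
    have "P a b"
      using \<open>a \<le> b\<close>
    proof (induction rule: Bolzano)
      case (trans x y z)
      then show ?case unfolding P_def by (fastforce simp: algebra_simps)
    next
      case (local t)
      show ?case
      proof (rule ccontr)
        assume "\<not> ?thesis"
        then have "\<exists>s s'. s \<le> t \<and> t \<le> s' \<and> s' - s < inverse (real (Suc n)) \<and> \<not> P s s'" for n
          by (metis inverse_positive_iff_positive of_nat_0_less_iff zero_less_Suc)
        then obtain s s' where s: "\<And>n. s n \<le> t" "\<And>n. t \<le> s' n"
          "\<And>n. s' n - s n < inverse (real (Suc n))" "\<And>n. \<not> P (s n) (s' n)"
          by metis
        have lt: "s n < s' n" and ab: "a \<le> s n" "s' n \<le> b"
          and big: "\<psi> (s' n) - \<psi> (s n) > \<epsilon> * (s' n - s n)" for n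
          using s(4)[of n] s(1,2)[of n] unfolding P_def by (auto simp: not_le less_le)
        have lim0: "(\<lambda>n. inverse (real (Suc n))) \<longlonglongrightarrow> 0" by (rule LIMSEQ_inverse_real_of_nat)
        have "(\<lambda>n. s n - t) \<longlonglongrightarrow> 0"
          by (rule Lim_null_comparison[OF _ lim0], rule always_eventually)
             (smt (verit) s(1-3) real_norm_def)
        then have s1: "s \<longlonglongrightarrow> t" using Lim_null by blast
        have "(\<lambda>n. s' n - t) \<longlonglongrightarrow> 0"
          by (rule Lim_null_comparison[OF _ lim0], rule always_eventually)
             (smt (verit) s(1-3) real_norm_def)
        then have s2: "s' \<longlonglongrightarrow> t" using Lim_null by blast
        obtain X l where X: "\<And>n. (\<psi> (s' n) - \<psi> (s n)) / (s' n - s n) \<le> X n" "X \<longlonglongrightarrow> l" "l \<le> 0"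
          using loc[of t s s'] local s(1,2) lt ab s1 s2 by auto
        have "\<epsilon> \<le> X n" for n
          using X(1)[of n] big[of n] lt[of n] by (smt (verit) pos_less_divide_eq)
        then have "\<epsilon> \<le> l" by (intro LIMSEQ_le_const[OF X(2)]) auto
        then show False using X(3) that by simp
      qed
    qed
    then show ?thesis using \<open>a \<le> b\<close> by (simp add: P_def)
  qed
  show ?thesis
  proof (rule field_le_epsilon)
    fix e :: real assume "e > 0"
    have "e / (b - a + 1) * (b - a) \<le> e"
      using \<open>a \<le> b\<close> \<open>e > 0\<close> by (simp add: field_simps)
    then show "\<psi> b \<le> \<psi> a + e"
      using *[of "e / (b - a + 1)"] \<open>a \<le> b\<close> \<open>e > 0\<close> by simp
  qed
qed

text \<open>The mean value theorem turns each quotient into a value of \<open>E'\<close> at a point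
  squeezed towards t. This supplies the derivative of the integrating factor below.\<close>

lemma straddle_quotient_tendsto:
  fixes E E' :: "real \<Rightarrow> real"
  assumes E: "\<And>x. x \<in> {a..b} \<Longrightarrow> (E has_vector_derivative E' x) (at x within {a..b})"
    and c: "continuous_on {a..b} E'"
    and s: "\<And>n::nat. a \<le> s n \<and> s n \<le> t \<and> t \<le> s' n \<and> s' n \<le> b \<and> s n < s' n"
    and lim: "s \<longlonglongrightarrow> t" "s' \<longlonglongrightarrow> t"
  shows "(\<lambda>n. (E (s' n) - E (s n)) / (s' n - s n)) \<longlonglongrightarrow> E' t"
proof -
  have "\<exists>\<xi>. s n \<le> \<xi> \<and> \<xi> \<le> s' n \<and> (E (s' n) - E (s n)) / (s' n - s n) = E' \<xi>" for n
  proof -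
    have "\<exists>x\<in>{s n<..<s' n}. E (s' n) - E (s n) = (\<lambda>h. h *\<^sub>R E' x) (s' n - s n)"
    proof (rule mvt_simple[of "s n" "s' n" E "\<lambda>x h. h *\<^sub>R E' x"])
      show "s n < s' n" using s by blast
      fix x assume "s n \<le> x" "x \<le> s' n"
      then have "(E has_vector_derivative E' x) (at x within {s n..s' n})"
        using s[of n] by (intro has_vector_derivative_within_subset[OF E]) auto
      then show "(E has_derivative (\<lambda>h. h *\<^sub>R E' x)) (at x within {s n..s' n})"
        by (simp add: has_vector_derivative_def)
    qed
    then obtain x where "x \<in> {s n<..<s' n}" "E (s' n) - E (s n) = (s' n - s n) * E' x" by auto
    then show ?thesis using s[of n] by (intro exI[of _ x]) auto
  qed
  then obtain \<xi> where \<xi>: "\<And>n. s n \<le> \<xi> n" "\<And>n. \<xi> n \<le> s' n"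
    "\<And>n. (E (s' n) - E (s n)) / (s' n - s n) = E' (\<xi> n)" by metis
  have "\<xi> \<longlonglongrightarrow> t"
    by (rule tendsto_sandwich[OF _ _ lim]) (use \<xi> in auto)
  moreover have "t \<in> {a..b}" "\<And>n. \<xi> n \<in> {a..b}"
    using s \<xi>(1,2) by (auto intro: order_trans)
  ultimately have "(\<lambda>n. E' (\<xi> n)) \<longlonglongrightarrow> E' t"
    by (intro continuous_on_tendsto_compose[OF c]) auto
  then show ?thesis by (simp add: \<xi>(3))
qed

text \<open>The integrating factor \<open>exp (- I t)\<close> reduces the claim to
  \<open>nonincreasing_if_straddle_le_0\<close>.\<close>

lemma gronwall_straddle:
  fixes \<phi> c :: "real \<Rightarrow> real"
  assumes "a \<le> b" and \<phi>: "continuous_on {a..b} \<phi>" and c: "continuous_on {a..b} c"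
    and loc: "\<And>t s s'. \<lbrakk>t \<in> {a..b}; \<And>n::nat. a \<le> s n \<and> s n \<le> t \<and> t \<le> s' n \<and> s' n \<le> b \<and> s n < s' n;
      s \<longlonglongrightarrow> t; s' \<longlonglongrightarrow> t\<rbrakk> \<Longrightarrow>
      \<exists>X l. (\<forall>n. (\<phi> (s' n) - \<phi> (s n)) / (s' n - s n) \<le> X n) \<and> X \<longlonglongrightarrow> l \<and> l \<le> c t * \<phi> t"
  shows "\<phi> b \<le> \<phi> a * exp (integral {a..b} c)"
proof -
  define I where "I t = integral {a..t} c" for t
  define E where "E t = exp (- I t)" for t
  have I: "(I has_vector_derivative c t) (at t within {a..b})" if "t \<in> {a..b}" for t
    unfolding I_def by (rule integral_has_vector_derivative[OF c that])
  have E: "(E has_vector_derivative - c t * E t) (at t within {a..b})" if "t \<in> {a..b}" for t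
    using I[OF that] unfolding E_def has_real_derivative_iff_has_vector_derivative[symmetric]
    by (auto intro!: derivative_eq_intros)
  have Ec: "continuous_on {a..b} E"
    using E by (meson continuous_on_eq_continuous_within has_vector_derivative_continuous)
  have "\<phi> b * E b \<le> \<phi> a * E a"
  proof (rule nonincreasing_if_straddle_le_0[OF \<open>a \<le> b\<close>])
    fix t and s s' :: "nat \<Rightarrow> real"
    assume t: "t \<in> {a..b}" and s: "\<And>n. a \<le> s n \<and> s n \<le> t \<and> t \<le> s' n \<and> s' n \<le> b \<and> s n < s' n"
      and lim: "s \<longlonglongrightarrow> t" "s' \<longlonglongrightarrow> t"
    obtain X l where X: "\<And>n. (\<phi> (s' n) - \<phi> (s n)) / (s' n - s n) \<le> X n" "X \<longlonglongrightarrow> l" "l \<le> c t * \<phi> t"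
      using loc[OF t s lim] by auto
    define q where "q n = (E (s' n) - E (s n)) / (s' n - s n)" for n
    have q: "q \<longlonglongrightarrow> - c t * E t"
      unfolding q_def
      by (rule straddle_quotient_tendsto[OF E _ s lim]) (auto intro!: continuous_intros c Ec)
    have sab: "s n \<in> {a..b}" "s' n \<in> {a..b}" for n
      using s[of n] by auto
    have l1: "(\<lambda>n. E (s' n)) \<longlonglongrightarrow> E t" "(\<lambda>n. \<phi> (s n)) \<longlonglongrightarrow> \<phi> t"
      using continuous_on_tendsto_compose[OF Ec lim(2)] continuous_on_tendsto_compose[OF \<phi> lim(1)] t sab
      by auto
    have "(\<lambda>n. E (s' n) * X n + \<phi> (s n) * q n) \<longlonglongrightarrow> E t * l + \<phi> t * (- c t * E t)"
      by (intro tendsto_intros l1 X q)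
    moreover have "E t * l + \<phi> t * (- c t * E t) \<le> 0"
    proof -
      have "E t * l \<le> E t * (c t * \<phi> t)" using X(3) by (intro mult_left_mono) (auto simp: E_def)
      then show ?thesis by (simp add: algebra_simps)
    qed
    moreover have "(\<phi> (s' n) * E (s' n) - \<phi> (s n) * E (s n)) / (s' n - s n) \<le> E (s' n) * X n + \<phi> (s n) * q n" for n
    proof -
      \<comment> \<open>Discrete product rule with the later value of \<open>E\<close> and the
        earlier value of \<open>\<phi>\<close>. Since \<open>E\<close> is positive, the upper bound
        on the quotients of \<open>\<phi>\<close> survives the multiplication.\<close>
      have "(\<phi> (s' n) * E (s' n) - \<phi> (s n) * E (s n)) / (s' n - s n) =
        E (s' n) * ((\<phi> (s' n) - \<phi> (s n)) / (s' n - s n)) + \<phi> (s n) * q n"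
        by (simp add: q_def diff_divide_distrib algebra_simps)
      also have "\<dots> \<le> E (s' n) * X n + \<phi> (s n) * q n"
        by (intro add_right_mono mult_left_mono X) (auto simp: E_def)
      finally show ?thesis .
    qed
    ultimately show "\<exists>X l. (\<forall>n. (\<phi> (s' n) * E (s' n) - \<phi> (s n) * E (s n)) / (s' n - s n) \<le> X n) \<and> X \<longlonglongrightarrow> l \<and> l \<le> 0"
      by (intro exI[of _ "\<lambda>n. E (s' n) * X n + \<phi> (s n) * q n"]
          exI[of _ "E t * l + \<phi> t * (- c t * E t)"] conjI allI)
  qed
  then show ?thesis by (simp add: E_def I_def exp_minus field_simps)
qed

section \<open>Strongly continuous semigroups\<close>

text \<open>Banach-Steinhaus by Baire: the closed sets \<open>A k\<close> cover the space, so one of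
  them contains a ball. Sequences suffice, as the operators are taken at times tending to 0.\<close>

lemma uniform_boundedness:
  fixes T :: "nat \<Rightarrow> 'a::banach \<Rightarrow> 'b::real_normed_vector"
  assumes lin: "\<And>n. bounded_linear (T n)" and bdd: "\<And>x. \<exists>B. \<forall>n. norm (T n x) \<le> B"
  shows "\<exists>K. \<forall>n x. norm (T n x) \<le> K * norm x"
proof -
  define A where "A k = {x. \<forall>n. norm (T n x) \<le> real k}" for k
  have cl: "closed (A k)" for k
  proof -
    have "A k = (\<Inter>n. {x. norm (T n x) \<le> real k})" by (auto simp: A_def)
    moreover have "closed {x. norm (T n x) \<le> real k}" for n
      by (intro closed_Collect_le continuous_intros linear_continuous_on lin)
    ultimately show ?thesis by auto
  qed
  have un: "(\<Union>k. A k) = UNIV"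
  proof -
    have "\<exists>k. x \<in> A k" for x
    proof -
      obtain B where "\<forall>n. norm (T n x) \<le> B" using bdd by blast
      moreover obtain k where "B \<le> real k" using real_arch_simple by blast
      ultimately show ?thesis unfolding A_def by (auto intro: order_trans)
    qed
    then show ?thesis by auto
  qed
  have "\<exists>k. interior (A k) \<noteq> {}"
  proof (rule ccontr)
    assume "\<not> ?thesis"
    then have "euclidean interior_of (\<Union>(range A)) = {}"
      using cl by (intro Baire_category_alt) (auto simp: completely_metrizable_space_euclidean)
    then show False using un by simp
  qed
  then obtain k x0 where "x0 \<in> interior (A k)" by blast
  then obtain r where r: "r > 0" "cball x0 r \<subseteq> A k"
    by (meson interior_subset open_contains_cball open_interior subset_trans)
  have "norm (T n x) \<le> (2 * real k / r) * norm x" for n x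
  proof (cases "x = 0")
    case True
    then show ?thesis using linear_simps(3)[OF lin] by simp
  next
    case False
    interpret bounded_linear "T n" by (rule lin)
    \<comment> \<open>\<open>x\<close> is rescaled to the radius of the ball; the result is a
      difference of two points of \<open>A k\<close>, hence the bound
      \<open>2 * real k\<close>.\<close>
    define y where "y = (r / norm x) *\<^sub>R x"
    have "norm y = r" using False r(1) by (simp add: y_def)
    then have "x0 + y \<in> A k" "x0 \<in> A k" using r by (auto simp: dist_norm subset_iff)
    then have "norm (T n (x0 + y)) \<le> k" "norm (T n x0) \<le> k" by (auto simp: A_def)
    then have "norm (T n y) \<le> 2 * real k"
      by (smt (verit) add add_diff_cancel_left' norm_triangle_ineq4)
    then have "(r / norm x) * norm (T n x) \<le> 2 * real k"
      using r(1) by (simp add: y_def scale)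
    then show ?thesis using r(1) False by (simp add: field_simps)
  qed
  then show ?thesis by blast
qed

context
  fixes S :: "real \<Rightarrow> 'a::banach \<Rightarrow> 'a"
  assumes S: "c0_semigroup S"
begin

lemma c0_bl: "t \<ge> 0 \<Longrightarrow> bounded_linear (S t)"
  and c0_0: "S 0 y = y"
  and c0_add: "s \<ge> 0 \<Longrightarrow> t \<ge> 0 \<Longrightarrow> S (s + t) y = S s (S t y)"
  and c0_lim: "((\<lambda>t. S t y) \<longlongrightarrow> y) (at_right 0)"
  using S by (auto simp: c0_semigroup_def)

text \<open>Otherwise there are times tending to 0 at which the operator norms grow without bound,
  while every orbit converges along these times; this contradicts uniform boundedness.\<close>

lemma c0_bounded_near_0: "\<exists>d>0. \<exists>K\<ge>1. \<forall>t\<in>{0..d}. \<forall>y. norm (S t y) \<le> K * norm y"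
proof (rule ccontr)
  assume neg: "\<not> ?thesis"
  have "\<exists>t y. 0 \<le> t \<and> t \<le> inverse (real (Suc n)) \<and> norm (S t y) > real (Suc n) * norm y" for n
  proof -
    have "inverse (real (Suc n)) > 0" "real (Suc n) \<ge> 1" by auto
    then show ?thesis using neg by (metis atLeastAtMost_iff not_le)
  qed
  then obtain t y where ty: "\<And>n. 0 \<le> t n" "\<And>n. t n \<le> inverse (real (Suc n))"
    "\<And>n. norm (S (t n) (y n)) > real (Suc n) * norm (y n)" by metis
  \<comment> \<open>Positivity matters because strong continuity at 0 is a limit over
    \<open>at_right 0\<close>.\<close>
  have pos: "t n > 0" for n
  proof -
    have "t n \<noteq> 0"
    proof
      assume "t n = 0"
      then have "real (Suc n) * norm (y n) < norm (y n)" using ty(3)[of n] by (simp add: c0_0)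
      moreover have "1 * norm (y n) \<le> real (Suc n) * norm (y n)" by (intro mult_right_mono) auto
      ultimately show False by simp
    qed
    then show ?thesis using ty(1)[of n] by simp
  qed
  have "t \<longlonglongrightarrow> 0"
    by (rule tendsto_sandwich[OF _ _ tendsto_const LIMSEQ_inverse_real_of_nat])
       (use ty in \<open>auto intro!: always_eventually\<close>)
  then have "filterlim t (at_right 0) sequentially"
    using pos by (simp add: filterlim_at always_eventually less_imp_neq[THEN not_sym])
  then have "(\<lambda>n. S (t n) x) \<longlonglongrightarrow> x" for x
    using filterlim_compose[OF c0_lim] by auto
  then have "\<exists>B. \<forall>n. norm (S (t n) x) \<le> B" for x
    by (meson Bseq_def convergent_def convergent_imp_Bseq)
  then obtain K where K: "\<And>n x. norm (S (t n) x) \<le> K * norm x"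
    using uniform_boundedness[of "\<lambda>n. S (t n)"] c0_bl ty(1) by metis
  obtain n where "K \<le> real n" using real_arch_simple by blast
  then have "K * norm (y n) \<le> real (Suc n) * norm (y n)" by (intro mult_right_mono) auto
  then show False using K[of n "y n"] ty(3)[of n] by simp
qed

lemma c0_bounded_on: "\<exists>K\<ge>1. \<forall>t\<in>{0..b}. \<forall>y. norm (S t y) \<le> K * norm y"
proof -
  obtain d K where d: "d > 0" "K \<ge> 1" and K: "\<And>t y. t \<in> {0..d} \<Longrightarrow> norm (S t y) \<le> K * norm y"
    using c0_bounded_near_0 by blast
  have *: "norm (S t y) \<le> K ^ (Suc n) * norm y" if "0 \<le> t" "t \<le> real (Suc n) * d" for n t y
    using that
  proof (induction n arbitrary: t y)
    case 0
    then show ?case using K by simp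
  next
    case (Suc n)
    show ?case
    proof (cases "t \<le> real (Suc n) * d")
      case True
      then have "norm (S t y) \<le> K ^ Suc n * norm y" using Suc by simp
      also have "\<dots> \<le> K ^ Suc (Suc n) * norm y"
        using d(2) by (intro mult_right_mono power_increasing) auto
      finally show ?thesis .
    next
      case False
      then have "t - d \<ge> 0" using d(1) by (simp add: algebra_simps) (smt (verit) mult_nonneg_nonneg of_nat_0_le_iff)
      have "S t y = S d (S (t - d) y)" using c0_add[of d "t - d" y] d(1) \<open>t - d \<ge> 0\<close> by simp
      then have "norm (S t y) \<le> K * norm (S (t - d) y)" using K d(1) by simp
      also have "\<dots> \<le> K * (K ^ Suc n * norm y)"
        using Suc.IH[of "t - d" y] Suc.prems(2) \<open>t - d \<ge> 0\<close> d(2)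
        by (intro mult_left_mono) (auto simp: algebra_simps)
      finally show ?thesis by simp
    qed
  qed
  obtain n where "b / d \<le> real n" using real_arch_simple by blast
  then have "b \<le> real (Suc n) * d" using d(1) by (simp add: field_simps)
  then show ?thesis using * d(2) by (intro exI[of _ "K ^ Suc n"]) (auto simp: one_le_power simp del: power_Suc)
qed

text \<open>Factoring out the operator at the smaller time reduces continuity at any time, from
  either side, to continuity of orbits at 0.\<close>

lemma c0_orbit_diff:
  assumes K: "\<And>t y. t \<in> {0..b} \<Longrightarrow> norm (S t y) \<le> K * norm y" and "p \<in> {0..b}" "q \<in> {0..b}"
  shows "norm (S p y - S q y) \<le> K * norm (S \<bar>p - q\<bar> y - y)"
proof -
  have *: "norm (S p y - S q y) \<le> K * norm (S \<bar>p - q\<bar> y - y)" if "q \<le> p" "p \<in> {0..b}" "q \<in> {0..b}" for p q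
  proof -
    have "S p y - S q y = S q (S (p - q) y - y)"
      using c0_add[of q "p - q" y] that linear_simps(2)[OF c0_bl[of q]] by simp
    then show ?thesis using K[of q] that by simp
  qed
  show ?thesis
    using *[of q p] *[of p q] assms by (cases "q \<le> p") (auto simp: norm_minus_commute abs_minus_commute)
qed

text \<open>Joint continuity is what the integrand \<open>S (t - r) (F r)\<close> needs, where time
  and argument vary together.\<close>

lemma c0_continuous: "continuous_on ({0..} \<times> UNIV) (\<lambda>(t, y). S t y)"
  unfolding continuous_on_sequentially
proof (intro allI ballI impI)
  fix X :: "nat \<Rightarrow> real \<times> 'a" and a assume a: "a \<in> {0..} \<times> UNIV"
    and "(\<forall>n. X n \<in> {0..} \<times> UNIV) \<and> X \<longlonglongrightarrow> a"
  then have X: "\<And>n. X n \<in> {0..} \<times> UNIV" "X \<longlonglongrightarrow> a" by auto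
  obtain t y where [simp]: "a = (t, y)" by force
  define r z where "r = (\<lambda>n. fst (X n))" and "z = (\<lambda>n. snd (X n))"
  have r0: "r n \<ge> 0" for n using X(1)[of n] by (auto simp: r_def mem_Times_iff)
  have t0: "t \<ge> 0" using a by simp
  have r: "r \<longlonglongrightarrow> t" and z: "z \<longlonglongrightarrow> y"
    using tendsto_fst[OF X(2)] tendsto_snd[OF X(2)] by (auto simp: r_def z_def)
  obtain K where "K \<ge> 1" and K: "\<And>p y. p \<in> {0..t+1} \<Longrightarrow> norm (S p y) \<le> K * norm y"
    using c0_bounded_on[of "t + 1"] by blast
  \<comment> \<open>The absolute value makes the one-sided limit at 0 two-sided, so that it applies
    to \<open>r n - t\<close> of either sign.\<close>
  have "(\<lambda>\<tau>. S \<bar>\<tau>\<bar> y) \<midarrow>0\<rightarrow> y"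
  proof -
    have "((\<lambda>\<tau>. S \<bar>\<tau>\<bar> y) \<longlongrightarrow> y) (at_right 0)"
      by (rule Lim_transform_eventually[OF c0_lim]) (auto simp: eventually_at_filter)
    moreover have "((\<lambda>\<tau>. S \<bar>\<tau>\<bar> y) \<longlongrightarrow> y) (at_left 0)"
    proof -
      have "((\<lambda>\<tau>. S \<bar>-\<tau>\<bar> y) \<longlongrightarrow> y) (at_right 0)"
        using \<open>((\<lambda>\<tau>. S \<bar>\<tau>\<bar> y) \<longlongrightarrow> y) (at_right 0)\<close> by simp
      then show ?thesis by (subst at_left_minus) (simp add: filterlim_filtermap)
    qed
    ultimately show ?thesis by (simp add: filterlim_split_at_real)
  qed
  then have "isCont (\<lambda>\<tau>. S \<bar>\<tau>\<bar> y) 0" by (simp add: isCont_def c0_0)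
  moreover have "(\<lambda>n. r n - t) \<longlonglongrightarrow> 0" using r LIM_zero by blast
  ultimately have "(\<lambda>n. S \<bar>r n - t\<bar> y) \<longlonglongrightarrow> y"
    using isCont_tendsto_compose[of 0 "\<lambda>\<tau>. S \<bar>\<tau>\<bar> y"] by (auto simp: c0_0)
  then have lim: "(\<lambda>n. K * norm (z n - y) + K * norm (S \<bar>r n - t\<bar> y - y)) \<longlonglongrightarrow> K * 0 + K * 0"
    using z by (intro tendsto_intros tendsto_norm_zero LIM_zero) auto
  have "eventually (\<lambda>n. r n \<in> {0..t+1}) sequentially"
    using order_tendstoD(2)[OF r, of "t + 1", simplified] by (rule eventually_mono) (use r0 in auto)
  then have "eventually (\<lambda>n. norm (S (r n) (z n) - S t y) \<le> K * norm (z n - y) + K * norm (S \<bar>r n - t\<bar> y - y)) sequentially"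
  proof eventually_elim
    case (elim n)
    have "S (r n) (z n) - S t y = S (r n) (z n - y) + (S (r n) y - S t y)"
      using linear_simps(2)[OF c0_bl[OF r0[of n]]] by simp
    then have "norm (S (r n) (z n) - S t y) \<le> norm (S (r n) (z n - y)) + norm (S (r n) y - S t y)"
      using norm_triangle_ineq by metis
    also have "\<dots> \<le> K * norm (z n - y) + K * norm (S \<bar>r n - t\<bar> y - y)"
      using elim t0 by (intro add_mono K c0_orbit_diff[OF K, where b="t+1"]) auto
    finally show ?case .
  qed
  then have "(\<lambda>n. S (r n) (z n) - S t y) \<longlonglongrightarrow> 0"
    using Lim_null_comparison lim by auto
  then have "(\<lambda>n. S (r n) (z n)) \<longlonglongrightarrow> S t y" using Lim_null by blast
  then show "((\<lambda>(t, y). S t y) \<circ> X) \<longlonglongrightarrow> (case a of (t, y) \<Rightarrow> S t y)"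
    by (simp add: o_def r_def z_def case_prod_beta)
qed

lemma c0_tendsto:
  assumes "r \<longlonglongrightarrow> t" "z \<longlonglongrightarrow> y" "\<And>n::nat. r n \<ge> 0"
  shows "(\<lambda>n. S (r n) (z n)) \<longlonglongrightarrow> S t y"
proof -
  have "t \<ge> 0" using LIMSEQ_le_const[OF assms(1)] assms(3) by auto
  then show ?thesis
    using continuous_on_tendsto_compose[OF c0_continuous tendsto_Pair[OF assms(1,2)]] assms(3) by simp
qed

lemma c0_continuous_on:
  assumes "continuous_on A f" "continuous_on A g" "\<And>x. x \<in> A \<Longrightarrow> f x \<ge> 0"
  shows "continuous_on A (\<lambda>x. S (f x) (g x))"
  using continuous_on_compose2[OF c0_continuous continuous_on_Pair[OF assms(1,2)]] assms(3)
  by auto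

text \<open>The averages of an orbit over [0, t] lie in the domain and tend to \<open>y\<close> as t
  tends to 0.\<close>

lemma c0_domain_dense:
  assumes L: "\<And>y z. L y z \<longleftrightarrow> ((\<lambda>t. (S t y - y) /\<^sub>R t) \<longlongrightarrow> z) (at_right 0)"
  shows "closure {y. \<exists>z. L y z} = UNIV"
proof -
  have "y \<in> closure {y. \<exists>z. L y z}" for y
  proof -
    define I where "I a = integral {0..a} (\<lambda>s. S s y)" for a
    have int: "(\<lambda>s. S s y) integrable_on {a..b}" if "a \<ge> 0" for a b
      using that by (intro integrable_continuous_real c0_continuous_on continuous_intros) auto
    have cont: "continuous_on {0..b} (\<lambda>s. S s y)" for b
      by (intro c0_continuous_on continuous_intros) auto
    have Ider: "((\<lambda>t. (I (a + t) - I a) /\<^sub>R t) \<longlongrightarrow> S a y) (at_right 0)" if "a \<ge> 0" for a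
    proof -
      have "(I has_vector_derivative S a y) (at a within {0..a+1})"
        unfolding I_def using that by (intro integral_has_vector_derivative cont) auto
      then have "(I has_vector_derivative S a y) (at a within {a..a+1})"
        by (rule has_vector_derivative_within_subset) (use that in auto)
      then have *: "((\<lambda>x. (I x - I a) /\<^sub>R (x - a)) \<longlongrightarrow> S a y) (at_right a)"
      proof -
        have "((\<lambda>x. (1 / norm (x - a)) *\<^sub>R (I x - (I a + (x - a) *\<^sub>R S a y))) \<longlongrightarrow> 0) (at_right a)"
          using \<open>(I has_vector_derivative S a y) (at a within {a..a+1})\<close>
          by (simp add: has_vector_derivative_def has_derivative_within at_within_Icc_at_right)
        then have "((\<lambda>x. (I x - I a) /\<^sub>R (x - a) - S a y) \<longlongrightarrow> 0) (at_right a)"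
        proof (rule Lim_transform_eventually)
          have "(1 / norm (x - a)) *\<^sub>R (I x - (I a + (x - a) *\<^sub>R S a y)) = (I x - I a) /\<^sub>R (x - a) - S a y"
            if "x > a" for x
          proof -
            have "(1 / norm (x - a)) *\<^sub>R ((I x - I a) - (x - a) *\<^sub>R S a y) = (I x - I a) /\<^sub>R (x - a) - S a y"
              using that by (subst scaleR_diff_right) (simp add: divide_inverse)
            then show ?thesis by (simp only: diff_diff_add)
          qed
          then show "\<forall>\<^sub>F x in at_right a. (1 / norm (x - a)) *\<^sub>R (I x - (I a + (x - a) *\<^sub>R S a y)) =
            (I x - I a) /\<^sub>R (x - a) - S a y"
            by (simp add: eventually_at_filter)
        qed
        then show ?thesis by (rule LIM_zero_cancel)
      qed
      have eq: "at_right a = filtermap (\<lambda>x. x + a) (at_right 0)"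
        by (rule at_right_to_0)
      then show ?thesis using * by (simp add: filterlim_filtermap eq add.commute)
    qed
    \<comment> \<open>\<open>S \<tau>\<close> shifts the window of integration, so
      \<open>S \<tau> (I b) - I b\<close> telescopes into two short integrals at the ends, whose
      quotients are given by \<open>Ider\<close>.\<close>
    have SI: "S \<tau> (I b) = I (b + \<tau>) - I \<tau>" if "\<tau> \<ge> 0" "b \<ge> 0" for \<tau> b
    proof -
      have "((\<lambda>s. S \<tau> (S s y)) has_integral S \<tau> (I b)) {0..b}"
        using has_integral_linear[OF integrable_integral[OF int[of 0 b]] c0_bl[OF \<open>\<tau> \<ge> 0\<close>]]
        by (simp add: o_def I_def)
      then have 1: "((\<lambda>s. S (s + \<tau>) y) has_integral S \<tau> (I b)) {0..b}"
        by (rule has_integral_eq[rotated]) (use c0_add[of \<tau>] that in \<open>auto simp: add.commute\<close>)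
      have "((\<lambda>s. S s y) has_integral integral {\<tau>..b+\<tau>} (\<lambda>s. S s y)) {\<tau>..b+\<tau>}"
        using int[OF \<open>\<tau> \<ge> 0\<close>] by blast
      then have "((\<lambda>s. S (s + \<tau>) y) has_integral integral {\<tau>..b+\<tau>} (\<lambda>s. S s y)) {0..b}"
        using has_integral_affinity'[of "\<lambda>s. S s y" _ \<tau> "b + \<tau>" 1 \<tau>] by simp
      then have "S \<tau> (I b) = integral {\<tau>..b+\<tau>} (\<lambda>s. S s y)"
        using 1 has_integral_unique by blast
      moreover have "I \<tau> + integral {\<tau>..b+\<tau>} (\<lambda>s. S s y) = I (b + \<tau>)"
        unfolding I_def using that by (intro Henstock_Kurzweil_Integration.integral_combine int) auto
      ultimately show ?thesis by (simp add: algebra_simps)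
    qed
    have dom: "L (I b) (S b y - y)" if "b \<ge> 0" for b
    proof -
      have "I 0 = 0" by (simp add: I_def)
      then have "((\<lambda>t. (I (b + t) - I b) /\<^sub>R t - (I (0 + t) - I 0) /\<^sub>R t) \<longlongrightarrow> S b y - S 0 y) (at_right 0)"
        using that by (intro tendsto_diff Ider) auto
      then have "((\<lambda>t. (S t (I b) - I b) /\<^sub>R t) \<longlongrightarrow> S b y - y) (at_right 0)"
        unfolding c0_0
      proof (rule Lim_transform_eventually)
        show "\<forall>\<^sub>F t in at_right 0. (I (b + t) - I b) /\<^sub>R t - (I (0 + t) - I 0) /\<^sub>R t = (S t (I b) - I b) /\<^sub>R t"
          using SI[OF _ that] \<open>I 0 = 0\<close>
          by (auto simp: eventually_at_filter scaleR_diff_right[symmetric] diff_right_commute)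
      qed
      then show ?thesis by (simp add: L)
    qed
    have "((\<lambda>t. (1 / t) *\<^sub>R I t) \<longlongrightarrow> y) (at_right 0)"
      using Ider[of 0] by (simp add: I_def c0_0 divide_inverse)
    moreover have "\<forall>\<^sub>F t in at_right 0. (1 / t) *\<^sub>R I t \<in> closure {y. \<exists>z. L y z}"
    proof -
      have "\<exists>z. L ((1 / t) *\<^sub>R I t) z" if "t > 0" for t
      proof -
        have "((\<lambda>s. (1 / t) *\<^sub>R ((S s (I t) - I t) /\<^sub>R s)) \<longlongrightarrow> (1 / t) *\<^sub>R (S t y - y)) (at_right 0)"
          using dom[of t] that unfolding L by (intro tendsto_intros) auto
        then have "((\<lambda>s. (S s ((1 / t) *\<^sub>R I t) - (1 / t) *\<^sub>R I t) /\<^sub>R s) \<longlongrightarrow> (1 / t) *\<^sub>R (S t y - y)) (at_right 0)"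
          by (rule Lim_transform_eventually)
             (auto simp: eventually_at_filter linear_simps(5)[OF c0_bl] scaleR_diff_right mult.commute)
        then show ?thesis using L by blast
      qed
      then show ?thesis
        by (intro eventually_mono[OF eventually_at_right_less] subsetD[OF closure_subset]) auto
    qed
    ultimately show ?thesis
      by (intro Lim_in_closed_set[OF closed_closure]) auto
  qed
  then show ?thesis by auto
qed

end

text \<open>\<open>S t\<close> commutes with \<open>S \<tau>\<close>, so orbits that start in the
  domain stay there and the generator commutes with \<open>S t\<close>.\<close>

lemma c0_generator_orbit:
  fixes S :: "real \<Rightarrow> 'a::banach \<Rightarrow> 'a"
  assumes S: "c0_semigroup S" and t: "t \<ge> 0"
    and z: "((\<lambda>\<tau>. (S \<tau> y - y) /\<^sub>R \<tau>) \<longlongrightarrow> z) (at_right 0)"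
  shows "((\<lambda>\<tau>. (S \<tau> (S t y) - S t y) /\<^sub>R \<tau>) \<longlongrightarrow> S t z) (at_right 0)"
proof -
  have bl: "bounded_linear (S t)" using S t by (simp add: c0_semigroup_def)
  have "((\<lambda>\<tau>. S t ((S \<tau> y - y) /\<^sub>R \<tau>)) \<longlongrightarrow> S t z) (at_right 0)"
    by (rule bounded_linear.tendsto[OF bl z])
  then show ?thesis
  proof (rule Lim_transform_eventually)
    have "S t ((S \<tau> y - y) /\<^sub>R \<tau>) = (S \<tau> (S t y) - S t y) /\<^sub>R \<tau>" if "\<tau> > 0" for \<tau>
    proof -
      have "S \<tau> (S t y) = S t (S \<tau> y)"
        using c0_add[OF S, of \<tau> t y] c0_add[OF S, of t \<tau> y] t that by (simp add: add.commute)
      then show ?thesis by (simp add: linear_simps(2,5)[OF bl])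
    qed
    then show "\<forall>\<^sub>F \<tau> in at_right 0. S t ((S \<tau> y - y) /\<^sub>R \<tau>) = (S \<tau> (S t y) - S t y) /\<^sub>R \<tau>"
      by (intro eventually_mono[OF eventually_at_right_less]) auto
  qed
qed

text \<open>On the domain the squared norm of \<open>J (S r y)\<close> satisfies a differential
  inequality; the resulting bound is a closed condition on \<open>y\<close>, and the domain is
  dense. \<open>J\<close> encodes a change of norm, which will be the energy norm.\<close>

lemma c0_dissipative_decay:
  fixes S :: "real \<Rightarrow> 'a::banach \<Rightarrow> 'a" and J :: "'a \<Rightarrow> 'b::real_inner"
  assumes gen: "c0_generated_by S L" and J: "bounded_linear J"
    and diss: "\<And>y z. L y z \<Longrightarrow> inner (J y) (J z) \<le> - \<kappa> * (norm (J y))\<^sup>2"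
    and "t \<ge> 0"
  shows "norm (J (S t y)) \<le> exp (- \<kappa> * t) * norm (J y)"
proof -
  have S: "c0_semigroup S" and L: "\<And>y z. L y z \<longleftrightarrow> ((\<lambda>t. (S t y - y) /\<^sub>R t) \<longlongrightarrow> z) (at_right 0)"
    using gen by (auto simp: c0_generated_by_def)
  note bl = c0_bl[OF S]
  have *: "norm (J (S t y)) \<le> exp (- \<kappa> * t) * norm (J y)" if "L y z" for y z
  proof -
    define \<phi> where "\<phi> r = (norm (J (S r y)))\<^sup>2" for r
    have "\<phi> t \<le> \<phi> 0 * exp (integral {0..t} (\<lambda>_. - 2 * \<kappa>))"
    proof (rule gronwall_straddle[OF \<open>t \<ge> 0\<close>])
      show "continuous_on {0..t} \<phi>"
        unfolding \<phi>_def
        by (intro continuous_intros bounded_linear.continuous_on[OF J] c0_continuous_on[OF S]) auto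
      show "continuous_on {0..t} (\<lambda>_. - 2 * \<kappa>)" by simp
      fix r and s s' :: "nat \<Rightarrow> real"
      assume r: "r \<in> {0..t}" and s: "\<And>n. 0 \<le> s n \<and> s n \<le> r \<and> r \<le> s' n \<and> s' n \<le> t \<and> s n < s' n"
        and lim: "s \<longlonglongrightarrow> r" "s' \<longlonglongrightarrow> r"
      \<comment> \<open>Increments are counted from the left end:
        \<open>S (s' n) y - S (s n) y\<close> is \<open>s' n - s n\<close> times
        \<open>S (s n) (D n)\<close>. So the right-hand limit that defines the generator suffices
        although \<open>r\<close> lies inside the interval.\<close>
      define D where "D n = (S (s' n - s n) y - y) /\<^sub>R (s' n - s n)" for n
      have "(\<lambda>n. s' n - s n) \<longlonglongrightarrow> 0" using tendsto_diff[OF lim(2,1)] by simp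
      then have "filterlim (\<lambda>n. s' n - s n) (at_right 0) sequentially"
        using s by (simp add: filterlim_at always_eventually less_imp_neq[THEN not_sym])
      then have D: "D \<longlonglongrightarrow> z"
        unfolding D_def using that filterlim_compose L by blast
      define X where "X n = inner (J (S (s' n) y) + J (S (s n) y)) (J (S (s n) (D n)))" for n
      have "X \<longlonglongrightarrow> inner (J (S r y) + J (S r y)) (J (S r z))"
        unfolding X_def using s D
        by (intro tendsto_intros bounded_linear.tendsto[OF J] c0_tendsto[OF S] lim)
           (auto intro: order_trans less_imp_le)
      moreover have "(\<phi> (s' n) - \<phi> (s n)) / (s' n - s n) = X n" for n
      proof -
        have "S (s' n) y = S (s n) (S (s' n - s n) y)"
          using c0_add[OF S, of "s n" "s' n - s n" y] s[of n] by simp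
        then have "S (s' n) y - S (s n) y = (s' n - s n) *\<^sub>R S (s n) (D n)"
          using s[of n] by (simp add: D_def linear_simps(2,5)[OF bl])
        then have "J (S (s' n) y) - J (S (s n) y) = (s' n - s n) *\<^sub>R J (S (s n) (D n))"
          by (metis linear_simps(2,5)[OF J])
        moreover have "\<phi> (s' n) - \<phi> (s n) =
            inner (J (S (s' n) y) + J (S (s n) y)) (J (S (s' n) y) - J (S (s n) y))"
          unfolding \<phi>_def power2_norm_eq_inner
          by (simp add: inner_add_left inner_diff_right inner_commute[of "J (S (s n) y)" "J (S (s' n) y)"])
        ultimately have "\<phi> (s' n) - \<phi> (s n) = (s' n - s n) * X n"
          by (simp add: X_def)
        then show ?thesis using s[of n] by simp
      qed
      moreover have "inner (J (S r y) + J (S r y)) (J (S r z)) \<le> - 2 * \<kappa> * \<phi> r"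
      proof -
        have "L (S r y) (S r z)" using that r unfolding L by (intro c0_generator_orbit[OF S]) auto
        then show ?thesis using diss by (auto simp: \<phi>_def inner_add_left)
      qed
      ultimately show "\<exists>X l. (\<forall>n. (\<phi> (s' n) - \<phi> (s n)) / (s' n - s n) \<le> X n) \<and> X \<longlonglongrightarrow> l \<and> l \<le> - 2 * \<kappa> * \<phi> r"
        by (metis order_refl)
    qed
    also have "\<dots> = (exp (- \<kappa> * t) * norm (J y))\<^sup>2"
      using \<open>t \<ge> 0\<close> by (simp add: \<phi>_def c0_0[OF S] power_mult_distrib exp_double[symmetric] algebra_simps)
    finally show ?thesis
      unfolding \<phi>_def by (rule power2_le_imp_le) simp
  qed
  have "closed {y. norm (J (S t y)) \<le> exp (- \<kappa> * t) * norm (J y)}"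
    by (intro closed_Collect_le continuous_intros bounded_linear.continuous_on[OF J]
        bounded_linear.continuous_on[OF bl[OF \<open>t \<ge> 0\<close>]])
  then have "closure {y. \<exists>z. L y z} \<subseteq> {y. norm (J (S t y)) \<le> exp (- \<kappa> * t) * norm (J y)}"
    using * by (intro closure_minimal) auto
  then show ?thesis using c0_domain_dense[OF S L] by auto
qed

section \<open>Mild solutions of abstract evolution equations\<close>

text \<open>The equation is requested at rational times only: each time brings its own null set, and
  only countably many of them can be discarded.\<close>

locale mild_path =
  fixes S :: "real \<Rightarrow> 'a::banach \<Rightarrow> 'a" and w F :: "real \<Rightarrow> 'a"
  assumes S: "c0_semigroup S"
    and w: "continuous_on {0..} w" and F: "continuous_on {0..} F"
    and mild: "\<And>t. t \<in> \<rat> \<Longrightarrow> t \<ge> 0 \<Longrightarrow>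
      ((\<lambda>r. S (t - r) (F r)) has_integral (w t - S t (w 0))) {0..t}"
begin

text \<open>Applying \<open>S (t - s)\<close> to the equation on [0, s] and subtracting it from the
  one on [0, t] restarts the equation at time s.\<close>

lemma mild_restart:
  assumes "s \<in> \<rat>" "t \<in> \<rat>" "0 \<le> s" "s \<le> t"
  shows "((\<lambda>r. S (t - r) (F r)) has_integral (w t - S (t - s) (w s))) {s..t}"
proof -
  have int: "(\<lambda>r. S (t - r) (F r)) integrable_on {a..b}" if "0 \<le> a" "b \<le> t" for a b
    using that by (intro integrable_continuous_real c0_continuous_on[OF S] continuous_intros
        continuous_on_subset[OF F]) auto
  have "((\<lambda>r. S (t - s) (S (s - r) (F r))) has_integral S (t - s) (w s - S s (w 0))) {0..s}"
    using has_integral_linear[OF mild[OF assms(1,3)] c0_bl[OF S, of "t - s"]] assms by (simp add: o_def)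
  then have "((\<lambda>r. S (t - r) (F r)) has_integral S (t - s) (w s - S s (w 0))) {0..s}"
  proof (rule has_integral_eq[rotated])
    fix r assume "r \<in> {0..s}"
    then show "S (t - s) (S (s - r) (F r)) = S (t - r) (F r)"
      using c0_add[OF S, of "t - s" "s - r" "F r"] assms by simp
  qed
  moreover have "S (t - s) (w s - S s (w 0)) = S (t - s) (w s) - S t (w 0)"
    using c0_add[OF S, of "t - s" s "w 0"] assms linear_simps(2)[OF c0_bl[OF S, of "t - s"]] by simp
  ultimately have 1: "integral {0..s} (\<lambda>r. S (t - r) (F r)) = S (t - s) (w s) - S t (w 0)"
    by (simp add: integral_unique)
  have 2: "integral {0..t} (\<lambda>r. S (t - r) (F r)) = w t - S t (w 0)"
    using mild[of t] assms by (simp add: integral_unique)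
  have "integral {0..s} (\<lambda>r. S (t - r) (F r)) + integral {s..t} (\<lambda>r. S (t - r) (F r))
      = integral {0..t} (\<lambda>r. S (t - r) (F r))"
    using assms by (intro Henstock_Kurzweil_Integration.integral_combine int) auto
  then have "integral {s..t} (\<lambda>r. S (t - r) (F r)) = w t - S (t - s) (w s)"
    using 1 2 by (simp add: algebra_simps)
  then show ?thesis using int[of s t] assms by (metis integrable_integral order_refl)
qed

text \<open>A mean value inequality. The deviation of the integrand from \<open>z\<close> attains
  its maximum at a pair (r, q) of a compact triangle; naming the maximizer keeps it in [s, t], so it
  is squeezed when the interval shrinks. Continuity removes the restriction to rational
  times.\<close>

lemma mild_increment:
  assumes "0 \<le> s" "s < t"
  shows "\<exists>r q. s \<le> r \<and> r \<le> q \<and> q \<le> t \<and>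
    norm (w t - S (t - s) (w s) - (t - s) *\<^sub>R z) \<le> (t - s) * norm (S (q - r) (F r) - z)"
proof -
  \<comment> \<open>The triangle contains all (r, b) with s \<le> r \<le> b \<le> t, so a single
    maximum serves all rational subintervals of [s, t].\<close>
  define T where "T = ({s..t} \<times> {s..t}) \<inter> {(r, q). r \<le> q}"
  define g where "g = (\<lambda>p. norm (S (snd p - fst p) (F (fst p)) - z))"
  have "closed {(r, q). r \<le> (q::real)}"
    unfolding case_prod_beta by (intro closed_Collect_le continuous_intros)
  then have "compact T" unfolding T_def
    by (intro compact_Int_closed compact_Times) auto
  moreover have "(s, t) \<in> T" using assms by (auto simp: T_def)
  moreover have "continuous_on T g"
    unfolding g_def
    by (intro continuous_intros c0_continuous_on[OF S] continuous_on_compose2[OF F])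
       (use assms in \<open>auto simp: T_def\<close>)
  ultimately obtain p where p: "p \<in> T" "\<And>p'. p' \<in> T \<Longrightarrow> g p' \<le> g p"
    using continuous_attains_sup[of T g] by blast
  have rat: "norm (w b - S (b - a) (w a) - (b - a) *\<^sub>R z) \<le> (b - a) * g p"
    if "a \<in> \<rat>" "b \<in> \<rat>" "s \<le> a" "a \<le> b" "b \<le> t" for a b
  proof -
    have "((\<lambda>r. S (b - r) (F r) - z) has_integral (w b - S (b - a) (w a) - (b - a) *\<^sub>R z)) {a..b}"
      using has_integral_diff[OF mild_restart has_integral_const_real[of z a b]] that assms by simp
    moreover have "norm (S (b - r) (F r) - z) \<le> g p" if "r \<in> {a..b}" for r
      using p(2)[of "(r, b)"] that \<open>s \<le> a\<close> \<open>b \<le> t\<close> by (auto simp: g_def T_def)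
    ultimately have "norm (w b - S (b - a) (w a) - (b - a) *\<^sub>R z) \<le> g p * Henstock_Kurzweil_Integration.content {a..b}"
      by (intro has_integral_bound_real[where S = "{}"]) (auto simp: g_def)
    then show ?thesis using \<open>a \<le> b\<close> by (simp add: mult.commute)
  qed
  \<comment> \<open>The 3 keeps \<open>a n\<close> below \<open>b n\<close>: each stays within a
    third of \<open>t - s\<close> of its endpoint.\<close>
  define d where "d = (\<lambda>n::nat. (t - s) / (real n + 3))"
  have dpos: "d n > 0" for n using assms by (simp add: d_def add_nonneg_pos)
  have "\<exists>a. s < a \<and> a < s + d n \<and> a \<in> \<rat>"
       "\<exists>b. t - d n < b \<and> b < t \<and> b \<in> \<rat>" for n
    using dpos[of n] Rats_dense_in_real[of s "s + d n"]
      Rats_dense_in_real[of "t - d n" t] assms by auto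
  then obtain a b where ab: "\<And>n. s < a n" "\<And>n. a n < s + d n" "\<And>n. a n \<in> \<rat>"
    "\<And>n. t - d n < b n" "\<And>n. b n < t" "\<And>n. b n \<in> \<rat>"
    by metis
  have 0: "d \<longlonglongrightarrow> 0"
    unfolding d_def using LIMSEQ_ignore_initial_segment[OF lim_const_over_n[of "t - s"], of 3] by simp
  have le: "a n \<le> b n" for n
  proof -
    have "d n \<le> (t - s) / 3" unfolding d_def using assms by (intro divide_left_mono) auto
    then have "3 * d n \<le> t - s" by simp
    then show ?thesis using ab(2)[of n] ab(4)[of n] dpos[of n] by linarith
  qed
  have al: "a \<longlonglongrightarrow> s"
    by (rule tendsto_sandwich[of "\<lambda>_. s" _ _ "\<lambda>n. s + d n"])
       (use ab tendsto_add[OF tendsto_const 0, of s] in \<open>auto intro!: always_eventually less_imp_le\<close>)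
  have bl: "b \<longlonglongrightarrow> t"
    by (rule tendsto_sandwich[of "\<lambda>n. t - d n" _ _ "\<lambda>_. t"])
       (use ab tendsto_diff[OF tendsto_const 0, of t] in \<open>auto intro!: always_eventually less_imp_le\<close>)
  have pos: "a n \<ge> 0" "b n \<ge> 0" for n
    using ab(1)[of n] le[of n] assms by linarith+
  have wl: "(\<lambda>n. w (a n)) \<longlonglongrightarrow> w s" "(\<lambda>n. w (b n)) \<longlonglongrightarrow> w t"
    using continuous_on_tendsto_compose[OF w al] continuous_on_tendsto_compose[OF w bl] pos assms by auto
  have "norm (w t - S (t - s) (w s) - (t - s) *\<^sub>R z) \<le> (t - s) * g p"
  proof (rule LIMSEQ_le)
    show "(\<lambda>n. norm (w (b n) - S (b n - a n) (w (a n)) - (b n - a n) *\<^sub>R z)) \<longlonglongrightarrow>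
        norm (w t - S (t - s) (w s) - (t - s) *\<^sub>R z)"
      using le by (intro tendsto_intros c0_tendsto[OF S] wl al bl) auto
    show "(\<lambda>n. (b n - a n) * g p) \<longlonglongrightarrow> (t - s) * g p"
      by (intro tendsto_intros al bl)
    show "\<exists>N. \<forall>n\<ge>N. norm (w (b n) - S (b n - a n) (w (a n)) - (b n - a n) *\<^sub>R z) \<le> (b n - a n) * g p"
      using rat ab le by (meson less_imp_le)
  qed
  then show ?thesis
    using p(1) by (intro exI[of _ "fst p"] exI[of _ "snd p"]) (auto simp: T_def g_def)
qed

text \<open>The squared norm is followed through one step of variation of constants: decay of the
  semigroup part, a cross term, and a remainder quadratic in the step. The
  \<open>2 * \<kappa>\<close> in \<open>bound\<close> is the decay that the semigroup already
  provides, so \<open>c\<close> is the net growth rate.\<close>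

lemma mild_gronwall:
  fixes J :: "'a \<Rightarrow> 'b::real_inner"
  assumes J: "bounded_linear J"
    and decay: "\<And>t y. t \<ge> 0 \<Longrightarrow> norm (J (S t y)) \<le> exp (- \<kappa> * t) * norm (J y)"
    and ab: "0 \<le> a" "a \<le> b" and c: "continuous_on {a..b} c"
    and bound: "\<And>r. r \<in> {a..b} \<Longrightarrow> 2 * inner (J (w r)) (J (F r)) \<le> (c r + 2 * \<kappa>) * (norm (J (w r)))\<^sup>2"
  shows "(norm (J (w b)))\<^sup>2 \<le> (norm (J (w a)))\<^sup>2 * exp (integral {a..b} c)"
proof (rule gronwall_straddle[OF ab(2) _ c])
  show "continuous_on {a..b} (\<lambda>x. (norm (J (w x)))\<^sup>2)"
    using ab by (intro continuous_intros bounded_linear.continuous_on[OF J] continuous_on_subset[OF w]) auto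
  fix t and s s' :: "nat \<Rightarrow> real"
  assume t: "t \<in> {a..b}" and s: "\<And>n. a \<le> s n \<and> s n \<le> t \<and> t \<le> s' n \<and> s' n \<le> b \<and> s n < s' n"
    and lim: "s \<longlonglongrightarrow> t" "s' \<longlonglongrightarrow> t"
  define \<tau> where "\<tau> = (\<lambda>n. s' n - s n)"
  have \<tau>0: "\<tau> \<longlonglongrightarrow> 0" using tendsto_diff[OF lim(2,1)] by (simp add: \<tau>_def)
  have \<tau>pos: "\<tau> n > 0" for n using s by (simp add: \<tau>_def)
  have spos: "s n \<ge> 0" "s' n \<ge> 0" for n using s[of n] ab by auto
  \<comment> \<open>The contribution of the forcing to the step, per unit time;
    \<open>mild_increment\<close> shows that it tends to \<open>F t\<close>.\<close>
  define v where "v n = (w (s' n) - S (\<tau> n) (w (s n))) /\<^sub>R \<tau> n" for n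
  have "\<exists>r q. s n \<le> r \<and> r \<le> q \<and> q \<le> s' n \<and> norm (v n - F t) \<le> norm (S (q - r) (F r) - F t)" for n
  proof -
    obtain r q where rq: "s n \<le> r" "r \<le> q" "q \<le> s' n"
      "norm (w (s' n) - S (\<tau> n) (w (s n)) - \<tau> n *\<^sub>R F t) \<le> \<tau> n * norm (S (q - r) (F r) - F t)"
      using mild_increment[of "s n" "s' n" "F t"] s spos unfolding \<tau>_def by blast
    have "w (s' n) - S (\<tau> n) (w (s n)) - \<tau> n *\<^sub>R F t = \<tau> n *\<^sub>R (v n - F t)"
      using \<tau>pos[of n] by (simp add: v_def scaleR_diff_right)
    then have "\<tau> n * norm (v n - F t) \<le> \<tau> n * norm (S (q - r) (F r) - F t)"
      using rq(4) \<tau>pos[of n] by simp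
    then show ?thesis using rq \<tau>pos[of n] by auto
  qed
  then obtain r q where rq: "\<And>n. s n \<le> r n" "\<And>n. r n \<le> q n" "\<And>n. q n \<le> s' n"
    "\<And>n. norm (v n - F t) \<le> norm (S (q n - r n) (F (r n)) - F t)" by metis
  have rl: "r \<longlonglongrightarrow> t" and ql: "q \<longlonglongrightarrow> t"
    using rq by (auto intro!: tendsto_sandwich[OF _ _ lim] always_eventually intro: order_trans)
  have rpos: "r n \<ge> 0" for n using rq(1)[of n] spos(1)[of n] by simp
  have "(\<lambda>n. S (q n - r n) (F (r n)) - F t) \<longlonglongrightarrow> S (t - t) (F t) - F t"
    using rq(2) rpos t ab
    by (intro tendsto_intros c0_tendsto[OF S] ql rl continuous_on_tendsto_compose[OF F rl]) auto
  then have "(\<lambda>n. norm (S (q n - r n) (F (r n)) - F t)) \<longlonglongrightarrow> 0"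
    by (simp add: c0_0[OF S] tendsto_norm_zero_iff)
  then have "(\<lambda>n. v n - F t) \<longlonglongrightarrow> 0"
    by (rule Lim_null_comparison[rotated]) (use rq(4) in auto)
  then have v: "v \<longlonglongrightarrow> F t" by (rule LIM_zero_cancel)
  have ws: "(\<lambda>n. w (s n)) \<longlonglongrightarrow> w t"
    using t ab spos by (intro continuous_on_tendsto_compose[OF w lim(1)]) auto
  have "(\<lambda>n. S (\<tau> n) (w (s n))) \<longlonglongrightarrow> S 0 (w t)"
    using \<tau>pos by (intro c0_tendsto[OF S] \<tau>0 ws) (auto intro: less_imp_le)
  then have Sw: "(\<lambda>n. S (\<tau> n) (w (s n))) \<longlonglongrightarrow> w t" by (simp add: c0_0[OF S])
  \<comment> \<open>Per unit time: the loss through the semigroup, the work of the forcing, and a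
    square that vanishes in the limit.\<close>
  define X where "X n = (norm (J (w (s n))))\<^sup>2 * ((exp (- 2 * \<kappa> * \<tau> n) - 1) / \<tau> n) +
    2 * inner (J (S (\<tau> n) (w (s n)))) (J (v n)) + \<tau> n * (norm (J (v n)))\<^sup>2" for n
  have "((\<lambda>x. exp (- 2 * \<kappa> * x)) has_real_derivative - 2 * \<kappa>) (at 0)"
    by (auto intro!: derivative_eq_intros)
  then have "(\<lambda>x. (exp (- 2 * \<kappa> * x) - 1) / x) \<midarrow>0\<rightarrow> - 2 * \<kappa>"
    by (simp add: DERIV_def)
  moreover have "filterlim \<tau> (at 0) sequentially"
    using \<tau>0 \<tau>pos by (simp add: filterlim_at always_eventually less_imp_neq[THEN not_sym])
  ultimately have e: "(\<lambda>n. (exp (- 2 * \<kappa> * \<tau> n) - 1) / \<tau> n) \<longlonglongrightarrow> - 2 * \<kappa>"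
    by (rule filterlim_compose)
  have "X \<longlonglongrightarrow> (norm (J (w t)))\<^sup>2 * (- 2 * \<kappa>) + 2 * inner (J (w t)) (J (F t)) + 0 * (norm (J (F t)))\<^sup>2"
    unfolding X_def by (intro tendsto_intros e bounded_linear.tendsto[OF J] ws Sw v \<tau>0)
  moreover have "(norm (J (w t)))\<^sup>2 * (- 2 * \<kappa>) + 2 * inner (J (w t)) (J (F t)) + 0 * (norm (J (F t)))\<^sup>2
      \<le> c t * (norm (J (w t)))\<^sup>2"
    using bound[OF t] by (simp add: algebra_simps)
  moreover have "((norm (J (w (s' n))))\<^sup>2 - (norm (J (w (s n))))\<^sup>2) / (s' n - s n) \<le> X n" for n
  proof -
    define x where "x = J (S (\<tau> n) (w (s n)))"
    have "w (s' n) = S (\<tau> n) (w (s n)) + \<tau> n *\<^sub>R v n"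
      using \<tau>pos[of n] by (simp add: v_def)
    then have "J (w (s' n)) = x + \<tau> n *\<^sub>R J (v n)"
      by (simp add: x_def linear_simps(1,5)[OF J])
    then have 1: "(norm (J (w (s' n))))\<^sup>2 = (norm x)\<^sup>2 + \<tau> n * (2 * inner x (J (v n)) + \<tau> n * (norm (J (v n)))\<^sup>2)"
      by (simp add: power2_norm_eq_inner inner_add_left inner_add_right inner_commute algebra_simps)
    have "(norm x)\<^sup>2 \<le> (exp (- \<kappa> * \<tau> n) * norm (J (w (s n))))\<^sup>2"
      unfolding x_def using decay[of "\<tau> n"] \<tau>pos[of n] by (intro power_mono) auto
    also have "\<dots> = exp (- 2 * \<kappa> * \<tau> n) * (norm (J (w (s n))))\<^sup>2"
      by (simp add: power_mult_distrib exp_double[symmetric] algebra_simps)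
    finally have "(norm x)\<^sup>2 \<le> exp (- 2 * \<kappa> * \<tau> n) * (norm (J (w (s n))))\<^sup>2" .
    then have "(norm (J (w (s' n))))\<^sup>2 - (norm (J (w (s n))))\<^sup>2 \<le> \<tau> n * X n"
    proof -
      have "T * (N * ((E - 1) / T) + 2 * i + T * j) = N * (E - 1) + T * (2 * i + T * j)"
        if "T > 0" for T N E i j :: real
        using that by (simp add: field_simps)
      from this[OF \<tau>pos[of n]] have "\<tau> n * X n = (norm (J (w (s n))))\<^sup>2 * (exp (- 2 * \<kappa> * \<tau> n) - 1)
          + \<tau> n * (2 * inner x (J (v n)) + \<tau> n * (norm (J (v n)))\<^sup>2)"
        unfolding X_def x_def .
      then show ?thesis
        using \<open>(norm x)\<^sup>2 \<le> exp (- 2 * \<kappa> * \<tau> n) * (norm (J (w (s n))))\<^sup>2\<close>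
        unfolding 1 by (simp add: algebra_simps)
    qed
    moreover have "s' n - s n = \<tau> n" by (simp add: \<tau>_def)
    ultimately show ?thesis
      using \<tau>pos[of n] by (simp add: pos_divide_le_eq mult.commute)
  qed
  ultimately show "\<exists>X l. (\<forall>n. ((norm (J (w (s' n))))\<^sup>2 - (norm (J (w (s n))))\<^sup>2) / (s' n - s n) \<le> X n)
      \<and> X \<longlonglongrightarrow> l \<and> l \<le> c t * (norm (J (w t)))\<^sup>2"
    by (intro exI[of _ X] exI[of _ "(norm (J (w t)))\<^sup>2 * (- 2 * \<kappa>) + 2 * inner (J (w t)) (J (F t))
        + 0 * (norm (J (F t)))\<^sup>2"] conjI allI)
qed

end

section \<open>Completeness of \<open>L\<^sup>2\<close> and \<open>H\<^sup>1\<close>\<close>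

lemma rep_l2_sq_integrable: "sq_integrable (rep_l2 u)"
  using Quotient3_rep_reflp[OF Quotient3_l2] by (auto simp: l2_eq_def)

lemma abs_rep_l2 [simp]: "abs_l2 (rep_l2 u) = u"
  by (rule Quotient3_abs_rep[OF Quotient3_l2])

lemma rep_abs_l2: "sq_integrable f \<Longrightarrow> AE x in lborel. rep_l2 (abs_l2 f) x = f x"
  using rep_abs_rsp_left[OF Quotient3_l2, of f f] Quotient3_rep_abs[OF Quotient3_l2, of f]
  by (auto simp: l2_eq_def)

lemma abs_l2_cong:
  assumes "sq_integrable f" "sq_integrable g" "AE x in lborel. f x = g x"
  shows "abs_l2 f = abs_l2 g"
  using assms by (intro Quotient3_rel_abs[OF Quotient3_l2]) (simp add: l2_eq_def)

lemma rep_l2_measurable [measurable]: "rep_l2 u \<in> borel_measurable borel"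
  using rep_l2_sq_integrable by (simp add: sq_integrable_def)

lemma sq_integrable_minus: "sq_integrable f \<Longrightarrow> sq_integrable g \<Longrightarrow> sq_integrable (\<lambda>x. f x - g x)"
  using sq_integrable_add[of f "\<lambda>x. -1 * g x"] sq_integrable_scale[of g "-1"] by simp

lemma sq_integrable_AE_cong:
  assumes "sq_integrable f" "g \<in> borel_measurable borel" "AE x in lborel. f x = g x"
  shows "sq_integrable g"
proof -
  have "integrable lborel (\<lambda>x. (f x)\<^sup>2) \<longleftrightarrow> integrable lborel (\<lambda>x. (g x)\<^sup>2)"
    using assms by (intro integrable_cong_AE) (auto simp: sq_integrable_def)
  then show ?thesis using assms by (simp add: sq_integrable_def)
qed

lemma sq_integrable_bound:
  assumes "sq_integrable g" "f \<in> borel_measurable borel" "AE x in lborel. \<bar>f x\<bar> \<le> C * \<bar>g x\<bar>"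
  shows "sq_integrable f"
  unfolding sq_integrable_def
proof
  show "integrable lborel (\<lambda>x. (f x)\<^sup>2)"
  proof (rule Bochner_Integration.integrable_bound)
    show "integrable lborel (\<lambda>x. C\<^sup>2 * (g x)\<^sup>2)" using assms(1) by (simp add: sq_integrable_def)
    show "AE x in lborel. norm ((f x)\<^sup>2) \<le> norm (C\<^sup>2 * (g x)\<^sup>2)"
      using assms(3)
    proof eventually_elim
      case (elim x)
      then have "\<bar>f x\<bar>\<^sup>2 \<le> (C * \<bar>g x\<bar>)\<^sup>2" by (intro power_mono) auto
      then show ?case by (simp add: power_mult_distrib)
    qed
  qed (use assms(2) in simp)
qed (use assms in simp)

context
  includes l2.lifting
begin

lemma plus_l2_abs:
  assumes "sq_integrable f" "sq_integrable g"
  shows "abs_l2 f + abs_l2 g = abs_l2 (\<lambda>x. f x + g x)"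
  using assms by (intro plus_l2.abs_eq) (auto simp: l2_eq_def)

lemma scaleR_l2_abs: "sq_integrable f \<Longrightarrow> c *\<^sub>R abs_l2 f = abs_l2 (\<lambda>x. c * f x)"
  by (intro scaleR_l2.abs_eq) (auto simp: l2_eq_def)

lemma inner_l2_abs:
  assumes "sq_integrable f" "sq_integrable g"
  shows "inner (abs_l2 f) (abs_l2 g) = (LINT x|lborel. f x * g x)"
  using assms by (intro inner_l2.abs_eq) (auto simp: l2_eq_def)

lemma weak_deriv_abs:
  assumes "sq_integrable f" "sq_integrable g"
  shows "weak_deriv (abs_l2 f) (abs_l2 g) \<longleftrightarrow>
    (\<forall>\<phi>. test_function \<phi> \<longrightarrow> (LINT x|lborel. f x * deriv \<phi> x) = - (LINT x|lborel. g x * \<phi> x))"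
  using assms by (intro weak_deriv.abs_eq) (auto simp: l2_eq_def)

end

lemma minus_l2_abs:
  assumes "sq_integrable f" "sq_integrable g"
  shows "abs_l2 f - abs_l2 g = abs_l2 (\<lambda>x. f x - g x)"
proof -
  have "abs_l2 f - abs_l2 g = abs_l2 f + (-1) *\<^sub>R abs_l2 g" by simp
  also have "\<dots> = abs_l2 f + abs_l2 (\<lambda>x. -1 * g x)" by (simp only: scaleR_l2_abs[OF assms(2)])
  also have "\<dots> = abs_l2 (\<lambda>x. f x + -1 * g x)"
    by (intro plus_l2_abs sq_integrable_scale assms)
  finally show ?thesis by simp
qed

lemma inner_l2: "inner u v = (LINT x|lborel. rep_l2 u x * rep_l2 v x)"
  using inner_l2_abs[OF rep_l2_sq_integrable rep_l2_sq_integrable, of u v] by simp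

lemma norm_l2_abs: "sq_integrable f \<Longrightarrow> (norm (abs_l2 f))\<^sup>2 = (LINT x|lborel. (f x)\<^sup>2)"
  unfolding power2_norm_eq_inner by (simp add: inner_l2_abs power2_eq_square)

lemma rep_l2_diff: "AE x in lborel. rep_l2 (u - v) x = rep_l2 u x - rep_l2 v x"
  using rep_abs_l2[OF sq_integrable_minus[OF rep_l2_sq_integrable rep_l2_sq_integrable], of u v]
    minus_l2_abs[OF rep_l2_sq_integrable rep_l2_sq_integrable, of u v] by simp

lemma norm_l2_abs_le:
  assumes f: "sq_integrable f" and g: "sq_integrable g" and "AE x in lborel. \<bar>f x\<bar> \<le> C * \<bar>g x\<bar>" "C \<ge> 0"
  shows "norm (abs_l2 f) \<le> C * norm (abs_l2 g)"
proof -
  have "(norm (abs_l2 f))\<^sup>2 \<le> (LINT x|lborel. C\<^sup>2 * (g x)\<^sup>2)"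
    unfolding norm_l2_abs[OF f]
  proof (rule integral_mono_AE)
    show "AE x in lborel. (f x)\<^sup>2 \<le> C\<^sup>2 * (g x)\<^sup>2"
      using assms(3)
    proof eventually_elim
      case (elim x)
      then have "\<bar>f x\<bar>\<^sup>2 \<le> (C * \<bar>g x\<bar>)\<^sup>2" by (intro power_mono) auto
      then show ?case by (simp add: power_mult_distrib)
    qed
  qed (use f g in \<open>auto simp: sq_integrable_def\<close>)
  also have "\<dots> = (C * norm (abs_l2 g))\<^sup>2"
    by (simp add: norm_l2_abs[OF g, symmetric] power_mult_distrib)
  finally show ?thesis by (rule power2_le_imp_le) (use assms(4) in simp)
qed

lemma nn_integral_l2_diff:
  "(\<integral>\<^sup>+ x. ennreal ((rep_l2 u x - rep_l2 v x)\<^sup>2) \<partial>lborel) = ennreal ((norm (u - v))\<^sup>2)"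
proof -
  note sq = sq_integrable_minus[OF rep_l2_sq_integrable rep_l2_sq_integrable, of u v]
  have "(norm (u - v))\<^sup>2 = (LINT x|lborel. (rep_l2 u x - rep_l2 v x)\<^sup>2)"
    using norm_l2_abs[OF sq] minus_l2_abs[OF rep_l2_sq_integrable rep_l2_sq_integrable, of u v] by simp
  then show ?thesis
    using sq by (subst nn_integral_eq_integral) (auto simp: sq_integrable_def)
qed

text \<open>The Riesz-Fischer argument. The squared increments have integrals at most (1/16)^n; the
  weight \<open>4 ^ n\<close> splits this evenly between summable integrals and pointwise decay like
  (1/2)^n.\<close>

lemma l2_fast_Cauchy_AE_convergent:
  fixes Y :: "nat \<Rightarrow> l2"
  assumes Y: "\<And>n. norm (Y (Suc n) - Y n) \<le> (1/4) ^ n"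
  shows "AE x in lborel. convergent (\<lambda>n. rep_l2 (Y n) x)"
proof -
  define d where "d n x = rep_l2 (Y (Suc n)) x - rep_l2 (Y n) x" for n x
  have [measurable]: "d n \<in> borel_measurable lborel" for n by (simp add: d_def[abs_def])
  have "(\<integral>\<^sup>+ x. (\<Sum>n. ennreal (4 ^ n * (d n x)\<^sup>2)) \<partial>lborel) = (\<Sum>n. \<integral>\<^sup>+ x. ennreal (4 ^ n * (d n x)\<^sup>2) \<partial>lborel)"
    by (intro nn_integral_suminf) simp
  also have "\<dots> \<le> (\<Sum>n. ennreal ((1/4) ^ n))"
  proof (intro suminf_le)
    fix n
    have "(\<integral>\<^sup>+ x. ennreal (4 ^ n * (d n x)\<^sup>2) \<partial>lborel) = ennreal (4 ^ n) * (\<integral>\<^sup>+ x. ennreal ((d n x)\<^sup>2) \<partial>lborel)"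
      by (subst nn_integral_cmult[symmetric]) (auto simp: ennreal_mult)
    also have "\<dots> = ennreal (4 ^ n * (norm (Y (Suc n) - Y n))\<^sup>2)"
      unfolding d_def nn_integral_l2_diff by (simp add: ennreal_mult)
    also have "\<dots> \<le> ennreal (4 ^ n * ((1/4) ^ n)\<^sup>2)"
      by (intro ennreal_leI mult_left_mono power_mono Y) auto
    also have "4 ^ n * ((1/4) ^ n)\<^sup>2 = (1/4 :: real) ^ n"
      by (simp add: power2_eq_square power_mult_distrib[symmetric])
    finally show "(\<integral>\<^sup>+ x. ennreal (4 ^ n * (d n x)\<^sup>2) \<partial>lborel) \<le> ennreal ((1/4) ^ n)" .
  qed auto
  also have "\<dots> = ennreal (\<Sum>n. (1/4) ^ n)"
    by (intro suminf_ennreal2) (auto intro: summable_geometric)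
  finally have "(\<integral>\<^sup>+ x. (\<Sum>n. ennreal (4 ^ n * (d n x)\<^sup>2)) \<partial>lborel) \<noteq> \<infinity>"
    by (auto simp: top_unique)
  then have "AE x in lborel. (\<Sum>n. ennreal (4 ^ n * (d n x)\<^sup>2)) \<noteq> \<infinity>"
    by (intro nn_integral_PInf_AE) auto
  then show ?thesis
  proof eventually_elim
    case (elim x)
    then have sm: "summable (\<lambda>n. 4 ^ n * (d n x)\<^sup>2)"
      by (intro summable_suminf_not_top) auto
    then have "(\<lambda>n. 4 ^ n * (d n x)\<^sup>2) \<longlonglongrightarrow> 0" by (rule summable_LIMSEQ_zero)
    then have "eventually (\<lambda>n. 4 ^ n * (d n x)\<^sup>2 < 1) sequentially"
      using order_tendstoD(2) zero_less_one by blast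
    then have "eventually (\<lambda>n. norm (d n x) \<le> (1/2) ^ n) sequentially"
    proof eventually_elim
      case (elim n)
      have "((2::real) ^ n)\<^sup>2 = 4 ^ n" by (simp add: power2_eq_square flip: power_mult_distrib)
      then have "(2 ^ n * \<bar>d n x\<bar>)\<^sup>2 = 4 ^ n * (d n x)\<^sup>2" by (simp add: power_mult_distrib)
      then have "(2 ^ n * \<bar>d n x\<bar>)\<^sup>2 \<le> 1\<^sup>2" using elim by simp
      then have "2 ^ n * \<bar>d n x\<bar> \<le> 1" by (rule power2_le_imp_le) simp
      then show ?case by (simp add: power_one_over field_simps)
    qed
    then have "summable (\<lambda>n. d n x)"
      by (rule summable_comparison_test_ev) (rule summable_geometric, simp)
    then have "convergent (\<lambda>n. rep_l2 (Y n) x - rep_l2 (Y 0) x)"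
      using sum_lessThan_telescope[of "\<lambda>n. rep_l2 (Y n) x"]
      unfolding d_def summable_iff_convergent by simp
    from convergent_add[OF this convergent_const[of "rep_l2 (Y 0) x"]] show ?case by simp
  qed
qed

text \<open>The pointwise limit is also the limit in norm: Fatou's lemma, applied in
  \<open>m\<close>, transfers the Cauchy bound on \<open>Y m - Y n\<close> to the distance between
  the limit and \<open>Y n\<close>.\<close>

lemma l2_fast_Cauchy_convergent:
  fixes Y :: "nat \<Rightarrow> l2"
  assumes Y: "\<And>n. norm (Y (Suc n) - Y n) \<le> (1/4) ^ n" and "Cauchy Y"
  shows "convergent Y"
proof -
  \<comment> \<open>Where the sequence diverges, \<open>lim\<close> is an unspecified value; this
    concerns a null set only.\<close>
  define F where "F x = lim (\<lambda>n. rep_l2 (Y n) x)" for x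
  have [measurable]: "F \<in> borel_measurable borel"
    unfolding F_def by measurable
  have F: "AE x in lborel. (\<lambda>n. rep_l2 (Y n) x) \<longlonglongrightarrow> F x"
    using l2_fast_Cauchy_AE_convergent[OF Y] by eventually_elim (simp add: F_def convergent_LIMSEQ_iff)
  have fatou: "(\<integral>\<^sup>+ x. ennreal ((F x - rep_l2 (Y n) x)\<^sup>2) \<partial>lborel) \<le> ennreal (e\<^sup>2)"
    if N: "\<And>m. m \<ge> N \<Longrightarrow> norm (Y m - Y n) \<le> e" for e N n
  proof -
    have "AE x in lborel. ennreal ((F x - rep_l2 (Y n) x)\<^sup>2) =
        liminf (\<lambda>m. ennreal ((rep_l2 (Y m) x - rep_l2 (Y n) x)\<^sup>2))"
      using F
    proof eventually_elim
      case (elim x)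
      have "(\<lambda>m. ennreal ((rep_l2 (Y m) x - rep_l2 (Y n) x)\<^sup>2)) \<longlonglongrightarrow> ennreal ((F x - rep_l2 (Y n) x)\<^sup>2)"
        by (intro tendsto_intros elim)
      then show ?case by (rule lim_imp_Liminf[OF sequentially_bot, symmetric])
    qed
    then have "(\<integral>\<^sup>+ x. ennreal ((F x - rep_l2 (Y n) x)\<^sup>2) \<partial>lborel) =
        (\<integral>\<^sup>+ x. liminf (\<lambda>m. ennreal ((rep_l2 (Y m) x - rep_l2 (Y n) x)\<^sup>2)) \<partial>lborel)"
      by (rule nn_integral_cong_AE)
    also have "\<dots> \<le> liminf (\<lambda>m. \<integral>\<^sup>+ x. ennreal ((rep_l2 (Y m) x - rep_l2 (Y n) x)\<^sup>2) \<partial>lborel)"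
      by (intro nn_integral_liminf) simp
    also have "\<dots> = liminf (\<lambda>m. ennreal ((norm (Y m - Y n))\<^sup>2))"
      by (simp add: nn_integral_l2_diff)
    also have "\<dots> \<le> ennreal (e\<^sup>2)"
    proof (rule Liminf_le)
      show "\<forall>\<^sub>F m in sequentially. ennreal ((norm (Y m - Y n))\<^sup>2) \<le> ennreal (e\<^sup>2)"
        unfolding eventually_sequentially using N
        by (intro exI[of _ N] allI impI ennreal_leI power_mono) auto
    qed simp
    finally show ?thesis .
  qed
  obtain N1 where N1: "\<And>m n. m \<ge> N1 \<Longrightarrow> n \<ge> N1 \<Longrightarrow> norm (Y m - Y n) < 1"
    using CauchyD[OF \<open>Cauchy Y\<close>, of 1] by auto
  \<comment> \<open>Fatou's lemma controls only differences, so square integrability of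
    \<open>F\<close> is obtained by adding \<open>Y N1\<close> back.\<close>
  have dsq: "integrable lborel (\<lambda>x. (F x - rep_l2 (Y N1) x)\<^sup>2)"
  proof (rule integrableI_bounded)
    have "(\<integral>\<^sup>+ x. ennreal ((F x - rep_l2 (Y N1) x)\<^sup>2) \<partial>lborel) \<le> ennreal (1\<^sup>2)"
      using N1 by (intro fatou[of N1]) (simp add: less_imp_le)
    then show "(\<integral>\<^sup>+ x. ennreal (norm ((F x - rep_l2 (Y N1) x)\<^sup>2)) \<partial>lborel) < \<infinity>"
      by (auto simp: less_top[symmetric] top_unique)
  qed simp
  have "sq_integrable (\<lambda>x. (F x - rep_l2 (Y N1) x) + rep_l2 (Y N1) x)"
    using dsq by (intro sq_integrable_add rep_l2_sq_integrable) (simp add: sq_integrable_def)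
  then have Fsq: "sq_integrable F" by simp
  have "Y \<longlonglongrightarrow> abs_l2 F"
  proof (rule LIMSEQ_I)
    fix e :: real assume "e > 0"
    obtain N where N: "\<And>m n. m \<ge> N \<Longrightarrow> n \<ge> N \<Longrightarrow> norm (Y m - Y n) < e / 2"
      using CauchyD[OF \<open>Cauchy Y\<close>, of "e / 2"] \<open>e > 0\<close> by auto
    have "norm (Y n - abs_l2 F) < e" if "n \<ge> N" for n
    proof -
      have "AE x in lborel. ((F x - rep_l2 (Y n) x)\<^sup>2) = ((rep_l2 (abs_l2 F) x - rep_l2 (Y n) x)\<^sup>2)"
        using rep_abs_l2[OF Fsq] by eventually_elim simp
      then have "ennreal ((norm (abs_l2 F - Y n))\<^sup>2) = (\<integral>\<^sup>+ x. ennreal ((F x - rep_l2 (Y n) x)\<^sup>2) \<partial>lborel)"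
        unfolding nn_integral_l2_diff[symmetric] by (intro nn_integral_cong_AE) auto
      also have "\<dots> \<le> ennreal ((e / 2)\<^sup>2)"
        using N that by (intro fatou[of N]) (simp add: less_imp_le)
      finally have "(norm (abs_l2 F - Y n))\<^sup>2 \<le> (e / 2)\<^sup>2" by simp
      then have "norm (abs_l2 F - Y n) \<le> e / 2"
        by (rule power2_le_imp_le) (use \<open>e > 0\<close> in simp)
      then show ?thesis using \<open>e > 0\<close> by (simp add: norm_minus_commute)
    qed
    then show "\<exists>N. \<forall>n\<ge>N. norm (Y n - abs_l2 F) < e" by blast
  qed
  then show ?thesis by (rule convergentI)
qed

instance l2 :: banach
proof
  fix X :: "nat \<Rightarrow> l2" assume X: "Cauchy X"
  have "\<exists>N. \<forall>m\<ge>N. \<forall>n\<ge>N. norm (X m - X n) < (1/4) ^ k" for k :: nat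
    using CauchyD[OF X, of "(1/4) ^ k"] by auto
  then obtain N where N: "\<And>k m n. m \<ge> N k \<Longrightarrow> n \<ge> N k \<Longrightarrow> norm (X m - X n) < (1/4) ^ k"
    by metis
  \<comment> \<open>The recursion makes \<open>r\<close> strictly increasing and keeps
    \<open>r k\<close> beyond \<open>N k\<close>, so the subsequence has the geometric rate required
    above.\<close>
  define r where "r = rec_nat (N 0) (\<lambda>k j. max (Suc j) (N (Suc k)))"
  have r1: "r (Suc k) > r k" for k by (simp add: r_def less_max_iff_disj)
  have r2: "r k \<ge> N k" for k by (cases k) (auto simp: r_def)
  have mono: "strict_mono r" using r1 by (simp add: strict_mono_Suc_iff)
  have "norm (X (r (Suc k)) - X (r k)) \<le> (1/4) ^ k" for k
    using N[of k "r (Suc k)" "r k"] r1[of k] r2[of k] by (simp add: less_imp_le)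
  then have "convergent (X \<circ> r)"
    by (intro l2_fast_Cauchy_convergent Cauchy_subseq_Cauchy[OF X mono]) auto
  then obtain l where "(X \<circ> r) \<longlonglongrightarrow> l" by (auto simp: convergent_def)
  then have "X \<longlonglongrightarrow> l" using Cauchy_converges_subseq[OF X mono] by blast
  then show "convergent X" by (rule convergentI)
qed

section \<open>Weak derivatives as inner product identities and completeness of H^1\<close>

lemma test_function_inner:
  assumes "test_function \<phi>"
  shows "(LINT x|lborel. rep_l2 u x * deriv \<phi> x) = inner u (abs_l2 (deriv \<phi>))"
    "(LINT x|lborel. rep_l2 u x * \<phi> x) = inner u (abs_l2 \<phi>)"
  using inner_l2_abs[OF rep_l2_sq_integrable test_function_sq_integrable(1)[OF assms], of u]
    inner_l2_abs[OF rep_l2_sq_integrable test_function_sq_integrable(2)[OF assms], of u] by auto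

text \<open>For each test function this is an equation between continuous functionals, so the
  relation is closed under L^2 convergence of function and derivative. Completeness of H^1 rests on
  this.\<close>

lemma weak_deriv_inner:
  "weak_deriv u g \<longleftrightarrow> (\<forall>\<phi>. test_function \<phi> \<longrightarrow> inner u (abs_l2 (deriv \<phi>)) = - inner g (abs_l2 \<phi>))"
  using weak_deriv_abs[OF rep_l2_sq_integrable rep_l2_sq_integrable, of u g] by (simp add: test_function_inner)

lemma weak_deriv_h1: "weak_deriv (h1_emb U) (h1_deriv U)"
  by transfer simp

lemma h1_exists: "weak_deriv u g \<Longrightarrow> \<exists>U. h1_emb U = u \<and> h1_deriv U = g"
  by transfer auto

lemma h1_emb_add: "h1_emb (U + V) = h1_emb U + h1_emb V"
  and h1_deriv_add: "h1_deriv (U + V) = h1_deriv U + h1_deriv V"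
  and h1_emb_scaleR: "h1_emb (c *\<^sub>R U) = c *\<^sub>R h1_emb U"
  and h1_deriv_scaleR: "h1_deriv (c *\<^sub>R U) = c *\<^sub>R h1_deriv U"
  by (transfer; simp)+

lemma h1_emb_diff: "h1_emb (U - V) = h1_emb U - h1_emb V"
  and h1_deriv_diff: "h1_deriv (U - V) = h1_deriv U - h1_deriv V"
  using h1_emb_add[of "U - V" V] h1_deriv_add[of "U - V" V] by simp_all

lemma norm_h1_emb_le: "norm (h1_emb U) \<le> norm U"
  by (rule power2_le_imp_le) (simp_all add: norm_h1)

lemma norm_h1_deriv_le: "norm (h1_deriv U) \<le> norm U"
  by (rule power2_le_imp_le) (simp_all add: norm_h1)

lemma bounded_linear_h1_emb: "bounded_linear h1_emb"
  by (rule bounded_linear_intro[where K = 1]) (auto simp: h1_emb_add h1_emb_scaleR norm_h1_emb_le)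

lemma bounded_linear_h1_deriv: "bounded_linear h1_deriv"
  by (rule bounded_linear_intro[where K = 1]) (auto simp: h1_deriv_add h1_deriv_scaleR norm_h1_deriv_le)

lemma inner_h1: "inner U V = inner (h1_emb U) (h1_emb V) + inner (h1_deriv U) (h1_deriv V)"
  by transfer (simp add: inner_prod_def)

instance h1 :: banach
proof
  fix X :: "nat \<Rightarrow> h1" assume X: "Cauchy X"
  obtain u where u: "(\<lambda>n. h1_emb (X n)) \<longlonglongrightarrow> u"
    using Cauchy_convergent[OF bounded_linear.Cauchy[OF bounded_linear_h1_emb X]] unfolding convergent_def ..
  obtain g where g: "(\<lambda>n. h1_deriv (X n)) \<longlonglongrightarrow> g"
    using Cauchy_convergent[OF bounded_linear.Cauchy[OF bounded_linear_h1_deriv X]] unfolding convergent_def ..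
  have "weak_deriv u g"
    unfolding weak_deriv_inner
  proof (intro allI impI)
    fix \<phi> assume "test_function \<phi>"
    then have "inner (h1_emb (X n)) (abs_l2 (deriv \<phi>)) = - inner (h1_deriv (X n)) (abs_l2 \<phi>)" for n
      using weak_deriv_h1[of "X n"] by (simp add: weak_deriv_inner)
    moreover have "(\<lambda>n. inner (h1_emb (X n)) (abs_l2 (deriv \<phi>))) \<longlonglongrightarrow> inner u (abs_l2 (deriv \<phi>))"
      by (intro tendsto_intros u)
    ultimately have "(\<lambda>n. - inner (h1_deriv (X n)) (abs_l2 \<phi>)) \<longlonglongrightarrow> inner u (abs_l2 (deriv \<phi>))"
      by simp
    moreover have "(\<lambda>n. - inner (h1_deriv (X n)) (abs_l2 \<phi>)) \<longlonglongrightarrow> - inner g (abs_l2 \<phi>)"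
      by (intro tendsto_intros g)
    ultimately show "inner u (abs_l2 (deriv \<phi>)) = - inner g (abs_l2 \<phi>)"
      by (rule LIMSEQ_unique)
  qed
  then obtain U where U: "h1_emb U = u" "h1_deriv U = g" using h1_exists by blast
  have "(\<lambda>n. norm (h1_emb (X n) - u)) \<longlonglongrightarrow> 0" "(\<lambda>n. norm (h1_deriv (X n) - g)) \<longlonglongrightarrow> 0"
    using u g by (auto intro: tendsto_norm_zero LIM_zero)
  then have "(\<lambda>n. norm (h1_emb (X n) - u) + norm (h1_deriv (X n) - g)) \<longlonglongrightarrow> 0"
    using tendsto_add_zero by blast
  then have "(\<lambda>n. X n - U) \<longlonglongrightarrow> 0"
  proof (rule Lim_null_comparison[rotated], intro always_eventually allI)
    fix n
    have "(norm (X n - U))\<^sup>2 \<le> (norm (h1_emb (X n) - u) + norm (h1_deriv (X n) - g))\<^sup>2"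
      by (simp add: norm_h1 h1_emb_diff h1_deriv_diff U power2_sum)
    then show "norm (X n - U) \<le> norm (h1_emb (X n) - u) + norm (h1_deriv (X n) - g)"
      by (rule power2_le_imp_le) simp
  qed
  then show "convergent X" by (rule convergentI[OF LIM_zero_cancel])
qed

section \<open>Locally integrable functions and their primitives\<close>

text \<open>Weak derivatives are square integrable but may fail to be integrable over the line;
  primitives need integrability over bounded intervals only.\<close>

definition loc_integrable :: "(real \<Rightarrow> real) \<Rightarrow> bool" where
  "loc_integrable f \<longleftrightarrow> (\<forall>a b. set_integrable lborel {a..b} f)"

lemma loc_integrable_add: "loc_integrable f \<Longrightarrow> loc_integrable g \<Longrightarrow> loc_integrable (\<lambda>x. f x + g x)"
  and loc_integrable_diff: "loc_integrable f \<Longrightarrow> loc_integrable g \<Longrightarrow> loc_integrable (\<lambda>x. f x - g x)"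
  and loc_integrable_abs: "loc_integrable f \<Longrightarrow> loc_integrable (\<lambda>x. \<bar>f x\<bar>)"
  by (auto simp: loc_integrable_def intro: set_integral_add set_integral_diff set_integrable_abs)

lemma loc_integrable_continuous: "continuous_on UNIV f \<Longrightarrow> loc_integrable f"
  unfolding loc_integrable_def using borel_integrable_atLeastAtMost' continuous_on_subset by blast

lemma loc_integrable_measurable:
  assumes "loc_integrable f"
  shows "f \<in> borel_measurable borel"
proof (rule borel_measurable_LIMSEQ_real)
  fix n :: nat
  show "(\<lambda>x. indicator {-real n..real n} x *\<^sub>R f x) \<in> borel_measurable borel"
    using assms borel_measurable_integrable unfolding loc_integrable_def set_integrable_def by fastforce
next
  fix x
  obtain N where "\<bar>x\<bar> \<le> real N" using real_arch_simple by blast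
  then have "eventually (\<lambda>n. indicator {-real n..real n} x *\<^sub>R f x = f x) sequentially"
    unfolding eventually_sequentially by (intro exI[of _ N]) (auto simp: indicator_def)
  then show "(\<lambda>n. indicator {-real n..real n} x *\<^sub>R f x) \<longlonglongrightarrow> f x"
    by (rule tendsto_eventually)
qed

lemma loc_integrable_mult_continuous:
  assumes f: "loc_integrable f" and g: "continuous_on UNIV g"
  shows "loc_integrable (\<lambda>x. f x * g x)"
  unfolding loc_integrable_def
proof (intro allI)
  fix a b :: real
  have "compact (g ` {a..b})"
    by (intro compact_continuous_image continuous_on_subset[OF g]) auto
  then obtain C where C: "\<And>x. x \<in> {a..b} \<Longrightarrow> \<bar>g x\<bar> \<le> C"
    by (metis bounded_iff compact_imp_bounded image_eqI real_norm_def)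
  have [measurable]: "f \<in> borel_measurable borel" "g \<in> borel_measurable borel"
    using loc_integrable_measurable[OF f] borel_measurable_continuous_onI[OF g] by auto
  show "set_integrable lborel {a..b} (\<lambda>x. f x * g x)"
    unfolding set_integrable_def
  proof (rule Bochner_Integration.integrable_bound)
    show "integrable lborel (\<lambda>x. C * (indicator {a..b} x *\<^sub>R f x))"
      using f by (auto simp: loc_integrable_def set_integrable_def)
    show "AE x in lborel. norm (indicator {a..b} x *\<^sub>R (f x * g x)) \<le> norm (C * (indicator {a..b} x *\<^sub>R f x))"
    proof (rule AE_I2)
      fix x
      show "norm (indicator {a..b} x *\<^sub>R (f x * g x)) \<le> norm (C * (indicator {a..b} x *\<^sub>R f x))"
      proof (cases "x \<in> {a..b}")
        case True
        then have "\<bar>g x\<bar> * \<bar>f x\<bar> \<le> \<bar>C\<bar> * \<bar>f x\<bar>" using C[of x] by (intro mult_right_mono) auto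
        then show ?thesis using True by (simp add: abs_mult mult.commute)
      qed simp
    qed
  qed measurable
qed

lemma loc_integrable_rep_l2: "loc_integrable (rep_l2 u)"
  unfolding loc_integrable_def set_integrable_def
proof (intro allI)
  fix a b :: real
  have "sq_integrable (indicator {a..b})"
    unfolding sq_integrable_def power2_eq_square indicator_inter_arith[symmetric]
    by (auto intro!: integrable_real_indicator simp: emeasure_lborel_Icc_eq)
  from sq_integrable_mult[OF this rep_l2_sq_integrable, of u]
  show "integrable lborel (\<lambda>x. indicator {a..b} x *\<^sub>R rep_l2 u x)" by simp
qed

lemma loc_integrable_hk: "loc_integrable f \<Longrightarrow> f integrable_on {a..b}"
  by (simp add: loc_integrable_def set_borel_integral_eq_integral(1))

lemma loc_integrable_integral: "loc_integrable f \<Longrightarrow> (LINT x:{a..b}|lborel. f x) = integral {a..b} f"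
  by (simp add: loc_integrable_def set_borel_integral_eq_integral(2))

lemma integral_compact_support:
  assumes "loc_integrable f" "\<And>x. \<bar>x\<bar> > R \<Longrightarrow> f x = 0"
  shows "integrable lborel f" "(LINT x|lborel. f x) = integral {-R..R} f"
proof -
  have "(\<lambda>x. indicator {-R..R} x *\<^sub>R f x) = f"
    using assms(2) by (force simp: indicator_def fun_eq_iff)
  then show "integrable lborel f" "(LINT x|lborel. f x) = integral {-R..R} f"
    using assms(1) loc_integrable_integral[OF assms(1), of "-R" R]
    unfolding loc_integrable_def set_integrable_def set_lebesgue_integral_def by metis+
qed

text \<open>On [-n, n] the positive and the negative part of \<open>k\<close> are densities of
  finite measures with the same distribution function, hence of the same measure, so the two parts
  agree almost everywhere.\<close>

lemma AE_0_if_interval_integrals_0: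
  assumes k: "loc_integrable k" and 0: "\<And>a b. a \<le> b \<Longrightarrow> integral {a..b} k = 0"
  shows "AE x in lborel. k x = 0"
proof -
  have [measurable]: "k \<in> borel_measurable borel" by (rule loc_integrable_measurable[OF k])
  have *: "AE x in lborel. x \<in> {-real n..real n} \<longrightarrow> k x = 0" for n :: nat
  proof -
    define q where "q x = indicator {-real n..real n} x * k x" for x
    have q: "integrable lborel q"
      using k by (auto simp: loc_integrable_def set_integrable_def q_def[abs_def])
    define M1 M2 where "M1 = density lborel (\<lambda>x. ennreal (max 0 (q x)))"
      and "M2 = density lborel (\<lambda>x. ennreal (max 0 (- q x)))"
    have int: "integrable lborel (\<lambda>x. max 0 (q x))" "integrable lborel (\<lambda>x. max 0 (- q x))"
      using q by (auto intro!: integrable_max)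
    have [measurable]: "q \<in> borel_measurable borel" using q by (auto dest: borel_measurable_integrable)
    have em: "emeasure (density lborel (\<lambda>x. ennreal (max 0 (p x)))) A = ennreal (LINT x|lborel. max 0 (p x) * indicator A x)"
      if p: "integrable lborel (\<lambda>x. max 0 (p x))" and A: "A \<in> sets borel" for p :: "real \<Rightarrow> real" and A
    proof -
      have "emeasure (density lborel (\<lambda>x. ennreal (max 0 (p x)))) A = (\<integral>\<^sup>+ x. ennreal (max 0 (p x)) * indicator A x \<partial>lborel)"
        using A by (intro emeasure_density measurable_compose[OF borel_measurable_integrable[OF p] measurable_ennreal]) simp
      also have "\<dots> = (\<integral>\<^sup>+ x. ennreal (max 0 (p x) * indicator A x) \<partial>lborel)"
        by (intro nn_integral_cong) (auto simp: indicator_def)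
      also have "\<dots> = ennreal (LINT x|lborel. max 0 (p x) * indicator A x)"
        using p A by (intro nn_integral_eq_integral integrable_real_mult_indicator) auto
      finally show ?thesis .
    qed
    have fin: "finite_borel_measure M1" "finite_borel_measure M2"
      unfolding finite_borel_measure_def finite_borel_measure_axioms_def M1_def M2_def
      using em[OF int(1), of UNIV] em[OF int(2), of UNIV] by (auto intro!: finite_measureI)
    have "cdf M1 t = cdf M2 t" for t
    proof -
      have t: "{..t} \<in> sets borel" by simp
      have 1: "(LINT x|lborel. q x * indicator {..t} x) = 0"
      proof -
        have "(LINT x|lborel. q x * indicator {..t} x) = (LINT x:{-real n..min (real n) t}|lborel. k x)"
          unfolding set_lebesgue_integral_def q_def
          by (intro Bochner_Integration.integral_cong) (auto simp: indicator_def)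
        also have "\<dots> = integral {-real n..min (real n) t} k" by (rule loc_integrable_integral[OF k])
        also have "\<dots> = 0" using 0 by (cases "-real n \<le> min (real n) t") auto
        finally show ?thesis .
      qed
      have "(LINT x|lborel. max 0 (q x) * indicator {..t} x) - (LINT x|lborel. max 0 (- q x) * indicator {..t} x)
          = (LINT x|lborel. max 0 (q x) * indicator {..t} x - max 0 (- q x) * indicator {..t} x)"
        using int by (intro Bochner_Integration.integral_diff[symmetric] integrable_real_mult_indicator) auto
      also have "\<dots> = (LINT x|lborel. q x * indicator {..t} x)"
        by (intro Bochner_Integration.integral_cong) (auto simp: indicator_def)
      finally show ?thesis
        using 1 unfolding cdf_def measure_def M1_def M2_def em[OF int(1) t] em[OF int(2) t] by simp
    qed
    then have "M1 = M2" using cdf_unique'[OF fin] by blast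
    then have "AE x in lborel. ennreal (max 0 (q x)) = ennreal (max 0 (- q x))"
      unfolding M1_def M2_def using em[OF int(1), of UNIV]
      by (subst (asm) finite_density_unique) (auto simp: emeasure_density)
    then show ?thesis
    proof eventually_elim
      case (elim x)
      then have "max 0 (q x) = max 0 (- q x)" by (subst (asm) ennreal_inj) auto
      then have "q x = 0" by (simp add: max_def split: if_splits)
      then show ?case by (auto simp: q_def)
    qed
  qed
  have "AE x in lborel. \<forall>n::nat. x \<in> {-real n..real n} \<longrightarrow> k x = 0"
    unfolding AE_all_countable using * by blast
  then show ?thesis
  proof eventually_elim
    case (elim x)
    obtain n where "\<bar>x\<bar> \<le> real n" using real_arch_simple by blast
    then show ?case using elim by (auto simp: abs_le_iff)
  qed
qed

text \<open>Local absolute continuity in integral form. Since \<open>f\<close> matters only up to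
  null sets, calculus rules are derived from integrals and not from pointwise derivatives.\<close>

definition is_primitive :: "(real \<Rightarrow> real) \<Rightarrow> (real \<Rightarrow> real) \<Rightarrow> bool" where
  "is_primitive F f \<longleftrightarrow> loc_integrable f \<and> (\<forall>a b. a \<le> b \<longrightarrow> F b - F a = integral {a..b} f)"

lemma is_primitiveD:
  assumes "is_primitive F f"
  shows "loc_integrable f" "a \<le> b \<Longrightarrow> F b - F a = integral {a..b} f"
  using assms by (auto simp: is_primitive_def)

lemma is_primitive_on: "is_primitive F f \<Longrightarrow> x \<ge> a \<Longrightarrow> F x = F a + integral {a..x} f"
  using is_primitiveD(2)[of F f a x] by simp

lemma is_primitive_add_const: "is_primitive F f \<Longrightarrow> is_primitive (\<lambda>x. F x + c) f"
  by (simp add: is_primitive_def)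

lemma is_primitive_continuous:
  assumes "is_primitive F f"
  shows "continuous_on UNIV F"
proof (rule continuous_at_imp_continuous_on, rule ballI)
  fix x :: real
  have "continuous_on {x-1..x+1} (\<lambda>y. F (x-1) + integral {x-1..y} f)"
    by (intro continuous_intros indefinite_integral_continuous_1 loc_integrable_hk is_primitiveD[OF assms])
  then have "continuous_on {x-1..x+1} F"
    by (rule continuous_on_cong[THEN iffD1, OF refl, rotated]) (use is_primitive_on[OF assms] in auto)
  then show "isCont F x"
    by (rule continuous_on_interior) (simp add: interior_atLeastAtMost_real)
qed

lemma is_primitive_exists:
  assumes f: "loc_integrable f"
  shows "\<exists>F. is_primitive F f"
proof -
  define F where "F x = (if x \<ge> 0 then integral {0..x} f else - integral {x..0} f)" for x
  have "F b - F a = integral {a..b} f" if "a \<le> b" for a b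
    using that Henstock_Kurzweil_Integration.integral_combine[of 0 a b f]
      Henstock_Kurzweil_Integration.integral_combine[of a 0 b f]
      Henstock_Kurzweil_Integration.integral_combine[of a b 0 f]
      loc_integrable_hk[OF f]
    unfolding F_def by (auto simp: not_le)
  then show ?thesis using f by (auto simp: is_primitive_def)
qed

lemma is_primitive_has_derivative:
  assumes "is_primitive F f" and "continuous_on UNIV f"
  shows "(F has_vector_derivative f x) (at x)"
proof -
  have "((\<lambda>y. integral {x-1..y} f) has_vector_derivative f x) (at x within {x-1..x+1})"
    by (rule integral_has_vector_derivative) (auto intro: continuous_on_subset[OF assms(2)])
  then have "((\<lambda>y. F (x-1) + integral {x-1..y} f) has_vector_derivative 0 + f x) (at x within {x-1..x+1})"
    by (intro has_vector_derivative_add has_vector_derivative_const)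
  then have "((\<lambda>y. F (x-1) + integral {x-1..y} f) has_vector_derivative f x) (at x)"
    by (simp add: at_within_Icc_at)
  then show ?thesis
    by (rule has_vector_derivative_transform_within_open[of _ _ _ "{x-1<..}"])
       (auto simp: is_primitive_on[OF assms(1), of "x - 1", symmetric])
qed

text \<open>The defect \<open>H\<close> of the product rule is additive over adjacent intervals. On
  a short interval, freezing \<open>G\<close> at the right end and \<open>F\<close> at the left end
  makes it at most \<open>\<epsilon>\<close> times the integral of \<open>A\<close>, by continuity;
  bisection carries this bound to [a, b], and \<open>\<epsilon>\<close> is arbitrary.\<close>

lemma is_primitive_mult:
  assumes F: "is_primitive F f" and G: "is_primitive G g"
  shows "is_primitive (\<lambda>x. F x * G x) (\<lambda>x. f x * G x + g x * F x)"
proof -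
  note Fc = is_primitive_continuous[OF F] and Gc = is_primitive_continuous[OF G]
  note fl = is_primitiveD(1)[OF F] and gl = is_primitiveD(1)[OF G]
  define h where "h x = f x * G x + g x * F x" for x
  define A where "A x = \<bar>f x\<bar> + \<bar>g x\<bar>" for x
  have hl: "loc_integrable h"
    unfolding h_def[abs_def]
    by (intro loc_integrable_add loc_integrable_mult_continuous fl gl Fc Gc)
  have Al: "loc_integrable A"
    unfolding A_def[abs_def] by (intro loc_integrable_add loc_integrable_abs fl gl)
  have "F b * G b - F a * G a = integral {a..b} h" if "a \<le> b" for a b
  proof -
    define H where "H s t = F t * G t - F s * G s - integral {s..t} h" for s t
    have H0: "\<bar>H a b\<bar> \<le> \<epsilon> * integral {a..b} A" if "\<epsilon> > 0" for \<epsilon>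
    proof -
      define P where "P s t \<longleftrightarrow> (s \<le> t \<longrightarrow> \<bar>H s t\<bar> \<le> \<epsilon> * integral {s..t} A)" for s t
      have "P a b"
        using \<open>a \<le> b\<close>
      proof (induction rule: Bolzano)
        case (trans x y z)
        have "integral {x..y} h + integral {y..z} h = integral {x..z} h"
          "integral {x..y} A + integral {y..z} A = integral {x..z} A"
          using trans by (auto intro!: Henstock_Kurzweil_Integration.integral_combine loc_integrable_hk hl Al)
        then have "H x z = H x y + H y z" "\<epsilon> * integral {x..z} A = \<epsilon> * integral {x..y} A + \<epsilon> * integral {y..z} A"
          by (simp_all add: H_def flip: distrib_left)
        then show ?case using trans unfolding P_def by linarith
      next
        case (local x)
        have "isCont F x" "isCont G x"
          using Fc Gc by (auto simp: continuous_on_eq_continuous_at)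
        then obtain d1 d2 where d: "d1 > 0" "\<And>y. \<bar>y - x\<bar> < d1 \<Longrightarrow> \<bar>F y - F x\<bar> < \<epsilon> / 2"
          "d2 > 0" "\<And>y. \<bar>y - x\<bar> < d2 \<Longrightarrow> \<bar>G y - G x\<bar> < \<epsilon> / 2"
          unfolding continuous_at_real_range using \<open>\<epsilon> > 0\<close> by (metis half_gt_zero real_norm_def)
        have "P s t" if st: "s \<le> x" "x \<le> t" "t - s < min d1 d2" for s t
        proof -
          have near: "\<bar>G t - G y\<bar> \<le> \<epsilon>" "\<bar>F s - F y\<bar> \<le> \<epsilon>" if "y \<in> {s..t}" for y
          proof -
            have "\<bar>y - x\<bar> < d1" "\<bar>s - x\<bar> < d1" "\<bar>y - x\<bar> < d2" "\<bar>t - x\<bar> < d2"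
              using that st by auto
            from d(2)[OF this(1)] d(2)[OF this(2)] d(4)[OF this(3)] d(4)[OF this(4)]
            show "\<bar>G t - G y\<bar> \<le> \<epsilon>" "\<bar>F s - F y\<bar> \<le> \<epsilon>" by linarith+
          qed
          have ints: "(\<lambda>y. f y * G t + g y * F s) integrable_on {s..t}"
            by (intro loc_integrable_hk loc_integrable_add loc_integrable_mult_continuous fl gl continuous_on_const)
          have "F t * G t - F s * G s = (F t - F s) * G t + (G t - G s) * F s"
            by (simp add: algebra_simps)
          also have "\<dots> = integral {s..t} f * G t + integral {s..t} g * F s"
            using is_primitiveD(2)[OF F] is_primitiveD(2)[OF G] st by simp
          also have "\<dots> = integral {s..t} (\<lambda>y. f y * G t + g y * F s)"
            by (simp add: Henstock_Kurzweil_Integration.integral_add[OF integrable_on_mult_left integrable_on_mult_left]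
                loc_integrable_hk[OF fl] loc_integrable_hk[OF gl])
          finally have "H s t = integral {s..t} (\<lambda>y. f y * G t + g y * F s) - integral {s..t} h"
            by (simp add: H_def)
          also have "\<dots> = integral {s..t} (\<lambda>y. f y * G t + g y * F s - h y)"
            by (intro Henstock_Kurzweil_Integration.integral_diff[symmetric] ints loc_integrable_hk hl)
          also have "\<bar>\<dots>\<bar> \<le> integral {s..t} (\<lambda>y. \<epsilon> * A y)"
            unfolding real_norm_def[symmetric]
          proof (rule integral_norm_bound_integral)
            show "(\<lambda>y. f y * G t + g y * F s - h y) integrable_on {s..t}"
              by (intro Henstock_Kurzweil_Integration.integrable_diff ints loc_integrable_hk hl)
            show "(\<lambda>y. \<epsilon> * A y) integrable_on {s..t}"
              by (intro integrable_on_mult_right loc_integrable_hk Al)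
            fix y assume y: "y \<in> {s..t}"
            have "f y * G t + g y * F s - h y = f y * (G t - G y) + g y * (F s - F y)"
              by (simp add: h_def algebra_simps)
            also have "\<bar>\<dots>\<bar> \<le> \<bar>f y\<bar> * \<bar>G t - G y\<bar> + \<bar>g y\<bar> * \<bar>F s - F y\<bar>"
              by (metis abs_mult abs_triangle_ineq)
            also have "\<dots> \<le> \<bar>f y\<bar> * \<epsilon> + \<bar>g y\<bar> * \<epsilon>"
              using near[OF y] by (intro add_mono mult_left_mono) auto
            finally show "norm (f y * G t + g y * F s - h y) \<le> \<epsilon> * A y"
              by (simp add: A_def algebra_simps)
          qed
          finally show ?thesis unfolding P_def by simp
        qed
        then show ?case using d(1,3) by (intro exI[of _ "min d1 d2"]) auto
      qed
      then show ?thesis using \<open>a \<le> b\<close> by (simp add: P_def)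
    qed
    have A0: "integral {a..b} A \<ge> 0"
      by (intro Henstock_Kurzweil_Integration.integral_nonneg loc_integrable_hk Al) (simp add: A_def)
    have "\<bar>H a b\<bar> \<le> 0"
    proof (rule field_le_epsilon)
      fix e :: real assume "e > 0"
      then have "\<bar>H a b\<bar> \<le> e / (integral {a..b} A + 1) * integral {a..b} A" using A0 by (intro H0) auto
      also have "\<dots> \<le> e" using A0 \<open>e > 0\<close> by (simp add: field_simps)
      finally show "\<bar>H a b\<bar> \<le> 0 + e" by simp
    qed
    then show ?thesis by (simp add: H_def)
  qed
  then show ?thesis using hl unfolding is_primitive_def h_def[abs_def] by blast
qed

section \<open>The continuous representative of an \<open>H\<^sup>1\<close> function\<close>

text \<open>Mean zero is what lets a primitive vanish on both sides of the support. It explains why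
  mean-zero functions are the tests in \<open>du_Bois_Reymond\<close>.\<close>

lemma test_function_of_derivative:
  assumes \<psi>: "continuous_on UNIV \<psi>" and supp: "\<And>x. \<bar>x\<bar> > R \<Longrightarrow> \<psi> x = 0" and 0: "(LINT x|lborel. \<psi> x) = 0"
  shows "\<exists>\<phi>. test_function \<phi> \<and> deriv \<phi> = \<psi> \<and> is_primitive \<phi> \<psi> \<and> (\<forall>x. \<bar>x\<bar> > R \<longrightarrow> \<phi> x = 0)"
proof -
  note \<psi>l = loc_integrable_continuous[OF \<psi>]
  obtain F where F: "is_primitive F \<psi>" using is_primitive_exists[OF \<psi>l] by blast
  \<comment> \<open>Normalised to vanish to the left of the support; the zero integral then gives 0
    on the right.\<close>
  define \<phi> where "\<phi> x = F x + - F (-\<bar>R\<bar>-1)" for x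
  have \<phi>: "is_primitive \<phi> \<psi>" unfolding \<phi>_def[abs_def] by (rule is_primitive_add_const[OF F])
  have d: "(\<phi> has_vector_derivative \<psi> x) (at x)" for x
    by (rule is_primitive_has_derivative[OF \<phi> \<psi>])
  have const: "\<phi> b = \<phi> a" if "a \<le> b" "\<And>x. x \<in> {a..b} \<Longrightarrow> \<psi> x = 0" for a b
  proof -
    have "integral {a..b} \<psi> = integral {a..b} (\<lambda>x. 0)"
      using that by (intro Henstock_Kurzweil_Integration.integral_cong) auto
    then show ?thesis using is_primitiveD(2)[OF \<phi> that(1)] by simp
  qed
  have left: "\<phi> x = 0" if "x < - R" for x
  proof -
    have "\<phi> (-\<bar>R\<bar>-1) = 0" by (simp add: \<phi>_def)
    moreover have "\<phi> x = \<phi> (-\<bar>R\<bar>-1)"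
    proof (cases "x \<le> -\<bar>R\<bar>-1")
      case True
      then show ?thesis using that supp by (intro const[symmetric]) auto
    next
      case False
      then show ?thesis using that supp by (intro const) auto
    qed
    ultimately show ?thesis by simp
  qed
  have right: "\<phi> x = 0" if "x > R" "x \<ge> - R" for x
  proof -
    define T where "T = \<bar>x\<bar> + \<bar>R\<bar> + 1"
    have "\<phi> T - \<phi> (-T) = integral {-T..T} \<psi>"
      by (intro is_primitiveD[OF \<phi>]) (simp add: T_def)
    also have "\<dots> = 0"
      using integral_compact_support(2)[OF \<psi>l, of T] 0 supp by (simp add: T_def)
    finally have "\<phi> T = 0" using left[of "-T"] by (simp add: T_def)
    moreover have "\<phi> T = \<phi> x" using that supp by (intro const) (auto simp: T_def)
    ultimately show ?thesis by simp
  qed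
  have out: "\<phi> x = 0" if "\<bar>x\<bar> > R" for x
    using left[of x] right[of x] that by linarith
  have "test_function \<phi>"
    unfolding test_function_def C1_differentiable_on_def using d \<psi> out by blast
  moreover have "deriv \<phi> = \<psi>"
    using d by (auto simp: fun_eq_iff has_real_derivative_iff_has_vector_derivative[symmetric] intro: DERIV_imp_deriv)
  ultimately show ?thesis using \<phi> out by blast
qed

text \<open>Continuous cutoffs that equal 1 on [a, b] and fall off with slope n + 1. For
  \<open>a \<le> b\<close> they share a bounded support, which allows dominated convergence to the
  indicator.\<close>

definition trapezoid :: "real \<Rightarrow> real \<Rightarrow> nat \<Rightarrow> real \<Rightarrow> real" where
  "trapezoid a b n x = max 0 (min 1 (1 - (real n + 1) * max (a - x) (x - b)))"

lemma trapezoid: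
  shows "continuous_on UNIV (trapezoid a b n)" "a \<le> b \<Longrightarrow> \<bar>x\<bar> > \<bar>a\<bar> + \<bar>b\<bar> + 1 \<Longrightarrow> trapezoid a b n x = 0"
    "\<bar>trapezoid a b n x\<bar> \<le> 1" "(\<lambda>n. trapezoid a b n x) \<longlonglongrightarrow> indicator {a..b} x"
proof -
  show "continuous_on UNIV (trapezoid a b n)" unfolding trapezoid_def by (intro continuous_intros)
  show "\<bar>trapezoid a b n x\<bar> \<le> 1" by (auto simp: trapezoid_def)
  have large: "trapezoid a b n x = 0" if "(real n + 1) * max (a - x) (x - b) \<ge> 1" for n x
    using that by (simp add: trapezoid_def)
  show "trapezoid a b n x = 0" if "a \<le> b" "\<bar>x\<bar> > \<bar>a\<bar> + \<bar>b\<bar> + 1"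
  proof -
    have "max (a - x) (x - b) \<ge> 1" using that by (auto simp: max_def)
    then have "1 * 1 \<le> (real n + 1) * max (a - x) (x - b)" by (intro mult_mono) auto
    then show ?thesis by (intro large) simp
  qed
  show "(\<lambda>n. trapezoid a b n x) \<longlonglongrightarrow> indicator {a..b} x"
  proof (cases "x \<in> {a..b}")
    case True
    then have "max (a - x) (x - b) \<le> 0" by auto
    then have "(real n + 1) * max (a - x) (x - b) \<le> 0" for n :: nat by (intro mult_nonneg_nonpos) auto
    then have "trapezoid a b n x = 1" for n by (simp add: trapezoid_def)
    then show ?thesis using True by simp
  next
    case False
    then have pos: "max (a - x) (x - b) > 0" by auto
    obtain N where N: "1 / max (a - x) (x - b) \<le> real N" using real_arch_simple by blast
    have "trapezoid a b n x = 0" if "n \<ge> N" for n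
    proof (rule large)
      have "1 / max (a - x) (x - b) \<le> real n + 1" using N that by simp
      then show "(real n + 1) * max (a - x) (x - b) \<ge> 1"
        using pos by (simp only: pos_divide_le_eq)
    qed
    then have "eventually (\<lambda>n. trapezoid a b n x = indicator {a..b} x) sequentially"
      unfolding eventually_sequentially using False by (intro exI[of _ N]) simp
    then show ?thesis by (rule tendsto_eventually)
  qed
qed

text \<open>Subtracting a multiple of a fixed tent \<open>\<theta>\<close> brings any continuous
  function of bounded support to mean zero, and \<open>c\<close> is the constant for which
  \<open>k - c\<close> annihilates \<open>\<theta>\<close> too. Hence \<open>k - c\<close>
  annihilates all such functions and, by approximation, all indicators of intervals.\<close>

lemma du_Bois_Reymond:
  assumes k: "loc_integrable k"
    and 0: "\<And>\<psi> R. \<lbrakk>continuous_on UNIV \<psi>; \<And>x. \<bar>x\<bar> > R \<Longrightarrow> \<psi> x = 0; (LINT x|lborel. \<psi> x) = 0\<rbrakk> \<Longrightarrow>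
      (LINT x|lborel. k x * \<psi> x) = 0"
  shows "\<exists>c. AE x in lborel. k x = c"
proof -
  define \<theta> where "\<theta> x = max 0 (1 - \<bar>x\<bar>)" for x :: real
  have \<theta>: "continuous_on UNIV \<theta>" unfolding \<theta>_def by (intro continuous_intros)
  have \<theta>0: "\<theta> x = 0" if "\<bar>x\<bar> > 1" for x using that by (simp add: \<theta>_def)
  have \<theta>i: "integrable lborel \<theta>"
    using integral_compact_support(1)[OF loc_integrable_continuous[OF \<theta>] \<theta>0] by blast
  define I where "I = (LINT x|lborel. \<theta> x)"
  \<comment> \<open>A step function below the tent shows that its integral is positive.\<close>
  have "(LINT x|lborel. 1 / 2 * indicator {-1/2..1/2::real} x) \<le> I"
    unfolding I_def
    by (intro integral_mono \<theta>i integrable_mult_right integrable_real_indicator)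
       (auto simp: \<theta>_def indicator_def emeasure_lborel_Icc_eq)
  then have "I \<noteq> 0" by auto
  define c where "c = (LINT x|lborel. k x * \<theta> x) / I"
  have *: "(LINT x|lborel. (k x - c) * \<psi> x) = 0"
    if \<psi>: "continuous_on UNIV \<psi>" "\<And>x. \<bar>x\<bar> > R \<Longrightarrow> \<psi> x = 0" for \<psi> R
  proof -
    define d where "d = (LINT x|lborel. \<psi> x) / I"
    have \<psi>i: "integrable lborel \<psi>"
      using integral_compact_support(1)[OF loc_integrable_continuous[OF \<psi>(1)]] \<psi>(2) by blast
    have k\<psi>: "integrable lborel (\<lambda>x. k x * \<psi> x)"
      using integral_compact_support(1)[OF loc_integrable_mult_continuous[OF k \<psi>(1)], of R] \<psi>(2) by simp
    have k\<theta>: "integrable lborel (\<lambda>x. k x * \<theta> x)"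
      using integral_compact_support(1)[OF loc_integrable_mult_continuous[OF k \<theta>], of 1] \<theta>0 by simp
    have "(LINT x|lborel. k x * (\<psi> x - d * \<theta> x)) = 0"
    proof (rule 0[where R = "max R 1"])
      show "continuous_on UNIV (\<lambda>x. \<psi> x - d * \<theta> x)" by (intro continuous_intros \<psi> \<theta>)
      show "(LINT x|lborel. \<psi> x - d * \<theta> x) = 0"
        using \<psi>i \<theta>i \<open>I \<noteq> 0\<close> by (simp add: d_def I_def)
    qed (use \<psi>(2) \<theta>0 in auto)
    then have "(LINT x|lborel. k x * \<psi> x) = d * (LINT x|lborel. k x * \<theta> x)"
      using k\<psi> k\<theta> by (simp add: right_diff_distrib mult.left_commute[of _ d])
    also have "\<dots> = c * (LINT x|lborel. \<psi> x)" by (simp add: d_def c_def)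
    finally show ?thesis using k\<psi> \<psi>i by (simp add: left_diff_distrib)
  qed
  have kc: "loc_integrable (\<lambda>x. k x - c)"
    by (intro loc_integrable_diff k loc_integrable_continuous continuous_intros)
  have "AE x in lborel. k x - c = 0"
  proof (rule AE_0_if_interval_integrals_0[OF kc])
    fix a b :: real assume "a \<le> b"
    define \<psi> where "\<psi> = trapezoid a b"
    note tr = trapezoid[where a = a and b = b, folded \<psi>_def]
    define R where "R = \<bar>a\<bar> + \<bar>b\<bar> + 1"
    have [measurable]: "k \<in> borel_measurable borel" "\<psi> n \<in> borel_measurable borel" for n
      using loc_integrable_measurable[OF k] borel_measurable_continuous_onI[OF tr(1)] by auto
    have "(\<lambda>n. LINT x|lborel. (k x - c) * \<psi> n x) \<longlonglongrightarrow> (LINT x|lborel. (k x - c) * indicator {a..b} x)"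
    proof (rule integral_dominated_convergence[where w = "\<lambda>x. indicator {-R..R} x *\<^sub>R \<bar>k x - c\<bar>"])
      show "integrable lborel (\<lambda>x. indicator {-R..R} x *\<^sub>R \<bar>k x - c\<bar>)"
        using loc_integrable_abs[OF kc] by (simp add: loc_integrable_def set_integrable_def)
      show "AE x in lborel. (\<lambda>n. (k x - c) * \<psi> n x) \<longlonglongrightarrow> (k x - c) * indicator {a..b} x"
        by (intro AE_I2 tendsto_intros tr)
      show "AE x in lborel. norm ((k x - c) * \<psi> n x) \<le> indicator {-R..R} x *\<^sub>R \<bar>k x - c\<bar>" for n
      proof (rule AE_I2)
        fix x
        show "norm ((k x - c) * \<psi> n x) \<le> indicator {-R..R} x *\<^sub>R \<bar>k x - c\<bar>"
        proof (cases "x \<in> {-R..R}")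
          case True
          then show ?thesis using tr(3)[of n x] mult_left_mono[OF tr(3)[of n x], of "\<bar>k x - c\<bar>"]
            by (simp add: abs_mult)
        next
          case False
          then have "\<psi> n x = 0" using \<open>a \<le> b\<close> by (intro tr(2)) (auto simp: R_def)
          then show ?thesis by simp
        qed
      qed
    qed measurable
    moreover have "(LINT x|lborel. (k x - c) * \<psi> n x) = 0" for n
      using tr(2)[OF \<open>a \<le> b\<close>] by (intro *[OF tr(1), of R]) (simp add: R_def)
    ultimately have "(LINT x|lborel. (k x - c) * indicator {a..b} x) = 0"
      using LIMSEQ_unique[OF _ tendsto_const] by simp
    then show "integral {a..b} (\<lambda>x. k x - c) = 0"
      using loc_integrable_integral[OF kc, of a b]
      by (simp add: set_lebesgue_integral_def mult.commute)
  qed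
  then show ?thesis by auto
qed

lemma integrable_imp_loc_integrable: "integrable lborel f \<Longrightarrow> loc_integrable f"
  unfolding loc_integrable_def set_integrable_def by (intro allI integrable_mult_indicator) auto

text \<open>Integration by parts against a primitive \<open>V\<close> of the weak derivative shows
  that \<open>u - V\<close> is annihilated by all mean-zero tests, hence constant. Shifting
  \<open>V\<close> by this constant gives the representative.\<close>

lemma h1_rep_exists:
  "\<exists>F. is_primitive F (rep_l2 (h1_deriv U)) \<and> (AE x in lborel. rep_l2 (h1_emb U) x = F x)"
proof -
  define u g where "u = rep_l2 (h1_emb U)" and "g = rep_l2 (h1_deriv U)"
  have wd: "(LINT x|lborel. u x * deriv \<phi> x) = - (LINT x|lborel. g x * \<phi> x)" if "test_function \<phi>" for \<phi>
    using weak_deriv_h1[of U] that weak_deriv_abs[OF rep_l2_sq_integrable rep_l2_sq_integrable]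
    unfolding u_def g_def by (metis abs_rep_l2)
  have ul: "loc_integrable u" and gl: "loc_integrable g"
    unfolding u_def g_def by (rule loc_integrable_rep_l2)+
  obtain V where V: "is_primitive V g" using is_primitive_exists[OF gl] by blast
  note Vc = is_primitive_continuous[OF V]
  have "\<exists>c. AE x in lborel. u x - V x = c"
  proof (rule du_Bois_Reymond)
    show "loc_integrable (\<lambda>x. u x - V x)"
      by (intro loc_integrable_diff ul loc_integrable_continuous Vc)
    fix \<psi> :: "real \<Rightarrow> real" and R
    assume \<psi>: "continuous_on UNIV \<psi>" "\<And>x. \<bar>x\<bar> > R \<Longrightarrow> \<psi> x = 0" "(LINT x|lborel. \<psi> x) = 0"
    obtain \<phi> where \<phi>: "test_function \<phi>" "deriv \<phi> = \<psi>" "is_primitive \<phi> \<psi>" "\<And>x. \<bar>x\<bar> > R \<Longrightarrow> \<phi> x = 0"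
      using test_function_of_derivative[OF \<psi>] by blast
    define T where "T = \<bar>R\<bar> + 1"
    have l1: "loc_integrable (\<lambda>x. g x * \<phi> x)" and l2: "loc_integrable (\<lambda>x. \<psi> x * V x)" and l3: "loc_integrable (\<lambda>x. u x * \<psi> x)"
      by (intro loc_integrable_mult_continuous gl ul loc_integrable_continuous \<psi> Vc
          is_primitive_continuous[OF \<phi>(3)])+
    have z: "\<psi> x = 0" "\<phi> x = 0" if "\<bar>x\<bar> > T" for x
      using that \<psi>(2) \<phi>(4) by (auto simp: T_def)
    have "integral {-T..T} (\<lambda>x. g x * \<phi> x + \<psi> x * V x) = V T * \<phi> T - V (-T) * \<phi> (-T)"
      using is_primitiveD(2)[OF is_primitive_mult[OF V \<phi>(3)], of "-T" T] by (simp add: T_def)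
    also have "\<dots> = 0" using \<phi>(4)[of T] \<phi>(4)[of "-T"] by (simp add: T_def)
    finally have "(LINT x|lborel. g x * \<phi> x) + (LINT x|lborel. \<psi> x * V x) = 0"
      using integral_compact_support[OF l1, of T] integral_compact_support[OF l2, of T] z
      by (simp add: Henstock_Kurzweil_Integration.integral_add loc_integrable_hk[OF l1] loc_integrable_hk[OF l2])
    then have "(LINT x|lborel. u x * \<psi> x) = (LINT x|lborel. V x * \<psi> x)"
      using wd[OF \<phi>(1)] by (simp add: \<phi>(2) mult.commute)
    moreover have "integrable lborel (\<lambda>x. u x * \<psi> x)" "integrable lborel (\<lambda>x. V x * \<psi> x)"
      using integral_compact_support(1)[OF l3, of T] integral_compact_support(1)[OF l2, of T] z
      by (simp_all add: mult.commute)
    ultimately show "(LINT x|lborel. (u x - V x) * \<psi> x) = 0"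
      by (simp add: left_diff_distrib)
  qed
  then obtain c where "AE x in lborel. u x - V x = c" by blast
  then have "AE x in lborel. u x = V x + c" by eventually_elim simp
  then show ?thesis
    using is_primitive_add_const[OF V] unfolding u_def g_def by blast
qed

text \<open>The choice is unique, since continuous functions that agree almost everywhere are equal
  (\<open>continuous_AE_eq_imp_eq\<close>).\<close>

definition h1_fun :: "h1 \<Rightarrow> real \<Rightarrow> real" where
  "h1_fun U = (SOME F. is_primitive F (rep_l2 (h1_deriv U)) \<and> (AE x in lborel. rep_l2 (h1_emb U) x = F x))"

lemma h1_fun_primitive: "is_primitive (h1_fun U) (rep_l2 (h1_deriv U))"
  and h1_fun_AE: "AE x in lborel. rep_l2 (h1_emb U) x = h1_fun U x"
  using someI_ex[OF h1_rep_exists[of U]] unfolding h1_fun_def by blast+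

lemma h1_fun_continuous: "continuous_on UNIV (h1_fun U)"
  by (rule is_primitive_continuous[OF h1_fun_primitive])

lemma h1_fun_measurable [measurable]: "h1_fun U \<in> borel_measurable borel"
  by (rule borel_measurable_continuous_onI[OF h1_fun_continuous])

lemma h1_fun_sq_integrable: "sq_integrable (h1_fun U)"
  by (rule sq_integrable_AE_cong[OF rep_l2_sq_integrable h1_fun_measurable h1_fun_AE])

lemma abs_l2_h1_fun: "abs_l2 (h1_fun U) = h1_emb U"
  by (metis abs_l2_cong abs_rep_l2 h1_fun_AE h1_fun_sq_integrable rep_l2_sq_integrable)

lemma continuous_AE_eq_imp_eq:
  fixes f g :: "real \<Rightarrow> real"
  assumes "continuous_on UNIV f" "continuous_on UNIV g" "AE x in lborel. f x = g x"
  shows "f = g"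
proof -
  have "open {x. f x \<noteq> g x}" by (intro open_Collect_neq assms)
  moreover have "{x. f x \<noteq> g x} \<in> null_sets lborel"
    using assms(3) \<open>open {x. f x \<noteq> g x}\<close> by (subst AE_iff_null_sets) auto
  then have "negligible {x. f x \<noteq> g x}"
    by (simp add: negligible_iff_null_sets null_sets_completionI)
  ultimately have "{x. f x \<noteq> g x} = {}" using open_not_negligible by blast
  then show ?thesis by auto
qed

lemma h1_fun_diff: "h1_fun (U - V) x = h1_fun U x - h1_fun V x"
proof -
  have "AE x in lborel. h1_fun (U - V) x = h1_fun U x - h1_fun V x"
    using h1_fun_AE[of "U - V"] h1_fun_AE[of U] h1_fun_AE[of V] rep_l2_diff[of "h1_emb U" "h1_emb V"]
    unfolding h1_emb_diff by eventually_elim simp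
  then have "h1_fun (U - V) = (\<lambda>x. h1_fun U x - h1_fun V x)"
    by (intro continuous_AE_eq_imp_eq continuous_intros h1_fun_continuous)
  then show ?thesis by simp
qed

section \<open>Pointwise bounds, decay at infinity and integration by parts in H^1\<close>

lemma rep_l2_sq_hk:
  "(\<lambda>x. (rep_l2 u x)\<^sup>2) integrable_on {a..b}" "integral {a..b} (\<lambda>x. (rep_l2 u x)\<^sup>2) \<le> (norm u)\<^sup>2"
proof -
  have i: "integrable lborel (\<lambda>x. (rep_l2 u x)\<^sup>2)"
    using rep_l2_sq_integrable[of u] by (simp add: sq_integrable_def)
  then have l: "loc_integrable (\<lambda>x. (rep_l2 u x)\<^sup>2)"
    by (rule integrable_imp_loc_integrable)
  then show "(\<lambda>x. (rep_l2 u x)\<^sup>2) integrable_on {a..b}" by (rule loc_integrable_hk)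
  have "integral {a..b} (\<lambda>x. (rep_l2 u x)\<^sup>2) = (LINT x:{a..b}|lborel. (rep_l2 u x)\<^sup>2)"
    by (rule loc_integrable_integral[OF l, symmetric])
  also have "\<dots> \<le> (LINT x|lborel. (rep_l2 u x)\<^sup>2)"
    unfolding set_lebesgue_integral_def
    using i by (intro integral_mono integrable_mult_indicator) (auto simp: indicator_def)
  also have "\<dots> = (norm u)\<^sup>2"
    using norm_l2_abs[OF rep_l2_sq_integrable, of u] by simp
  finally show "integral {a..b} (\<lambda>x. (rep_l2 u x)\<^sup>2) \<le> (norm u)\<^sup>2" .
qed

text \<open>f(y)^2 exceeds f(x)^2 by at most the integral of |2 f f'|; averaging over x in an
  interval of length 1 removes the point value. Being local, the bound yields both boundedness and
  decay at infinity.\<close>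

lemma h1_fun_sq_le_local:
  "(h1_fun U y)\<^sup>2 \<le> integral {y..y+1} (\<lambda>x. 2 * (h1_fun U x)\<^sup>2 + (rep_l2 (h1_deriv U) x)\<^sup>2)"
proof -
  define f g where "f = h1_fun U" and "g = rep_l2 (h1_deriv U)"
  have fc: "continuous_on A f" for A
    using h1_fun_continuous continuous_on_subset unfolding f_def by blast
  have f2: "(\<lambda>x. (f x)\<^sup>2) integrable_on {a..b}" for a b
    by (intro integrable_continuous_real continuous_intros fc)
  have g2: "(\<lambda>x. (g x)\<^sup>2) integrable_on {a..b}" for a b
    unfolding g_def by (rule rep_l2_sq_hk)
  define K where "K = integral {y..y+1} (\<lambda>x. (f x)\<^sup>2 + (g x)\<^sup>2)"
  have p: "is_primitive (\<lambda>x. f x * f x) (\<lambda>x. g x * f x + g x * f x)"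
    unfolding f_def g_def by (intro is_primitive_mult h1_fun_primitive)
  have "(f y)\<^sup>2 \<le> (f x)\<^sup>2 + K" if "x \<in> {y..y+1}" for x
  proof -
    have "(f y)\<^sup>2 - (f x)\<^sup>2 = - integral {y..x} (\<lambda>x. g x * f x + g x * f x)"
      using is_primitiveD(2)[OF p, of y x] that by (simp add: power2_eq_square)
    also have "\<dots> = integral {y..x} (\<lambda>x. - (g x * f x + g x * f x))"
      by simp
    also have "\<dots> \<le> integral {y..x} (\<lambda>x. (f x)\<^sup>2 + (g x)\<^sup>2)"
    proof (rule integral_le)
      show "(\<lambda>x. - (g x * f x + g x * f x)) integrable_on {y..x}"
        using loc_integrable_hk[OF is_primitiveD(1)[OF p]] integrable_neg by blast
      show "(\<lambda>x. (f x)\<^sup>2 + (g x)\<^sup>2) integrable_on {y..x}"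
        by (intro Henstock_Kurzweil_Integration.integrable_add f2 g2)
      fix t
      have "0 \<le> (f t + g t)\<^sup>2" by simp
      then show "- (g t * f t + g t * f t) \<le> (f t)\<^sup>2 + (g t)\<^sup>2"
        by (auto simp: power2_sum algebra_simps)
    qed
    also have "\<dots> \<le> K"
      unfolding K_def using that
      by (intro integral_subset_le Henstock_Kurzweil_Integration.integrable_add f2 g2) auto
    finally show ?thesis by simp
  qed
  then have "integral {y..y+1} (\<lambda>x. (f y)\<^sup>2) \<le> integral {y..y+1} (\<lambda>x. (f x)\<^sup>2 + K)"
    by (intro integral_le Henstock_Kurzweil_Integration.integrable_add f2) auto
  also have "\<dots> = integral {y..y+1} (\<lambda>x. (f x)\<^sup>2) + K"
    by (subst Henstock_Kurzweil_Integration.integral_add[OF f2 integrable_const_ivl]) simp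
  also have "\<dots> = integral {y..y+1} (\<lambda>x. 2 * (f x)\<^sup>2 + (g x)\<^sup>2)"
    unfolding K_def
    by (subst Henstock_Kurzweil_Integration.integral_add[symmetric])
       (auto intro!: f2 g2 Henstock_Kurzweil_Integration.integrable_add Henstock_Kurzweil_Integration.integral_cong)
  finally show ?thesis by (simp add: f_def g_def)
qed

lemma h1_fun_sq_integral:
  "integral {a..b} (\<lambda>x. (h1_fun U x)\<^sup>2) = integral {a..b} (\<lambda>x. (rep_l2 (h1_emb U) x)\<^sup>2)"
proof -
  have l: "loc_integrable (\<lambda>x. (h1_fun U x)\<^sup>2)" "loc_integrable (\<lambda>x. (rep_l2 (h1_emb U) x)\<^sup>2)"
    using h1_fun_sq_integrable[of U] rep_l2_sq_integrable[of "h1_emb U"]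
    by (auto simp: sq_integrable_def intro: integrable_imp_loc_integrable)
  show ?thesis
    unfolding loc_integrable_integral[OF l(1), symmetric] loc_integrable_integral[OF l(2), symmetric]
      set_lebesgue_integral_def
    using h1_fun_AE[of U] by (intro integral_cong_AE) (auto elim!: eventually_mono)
qed

text \<open>The embedding of H^1 into bounded functions. The constant 2 is generous; the argument
  gives the square root of 2.\<close>

lemma h1_fun_bound: "\<bar>h1_fun U y\<bar> \<le> 2 * norm U"
proof -
  have "(h1_fun U y)\<^sup>2 \<le> integral {y..y+1} (\<lambda>x. 2 * (h1_fun U x)\<^sup>2 + (rep_l2 (h1_deriv U) x)\<^sup>2)"
    by (rule h1_fun_sq_le_local)
  also have "\<dots> = 2 * integral {y..y+1} (\<lambda>x. (h1_fun U x)\<^sup>2) + integral {y..y+1} (\<lambda>x. (rep_l2 (h1_deriv U) x)\<^sup>2)"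
    by (subst Henstock_Kurzweil_Integration.integral_add)
       (auto intro!: integrable_continuous_real continuous_intros rep_l2_sq_hk continuous_on_subset[OF h1_fun_continuous])
  also have "\<dots> \<le> 2 * (norm (h1_emb U))\<^sup>2 + (norm (h1_deriv U))\<^sup>2"
    unfolding h1_fun_sq_integral by (intro add_mono mult_left_mono rep_l2_sq_hk) auto
  also have "\<dots> \<le> (2 * norm U)\<^sup>2" by (simp add: norm_h1 power_mult_distrib)
  finally have "\<bar>h1_fun U y\<bar>\<^sup>2 \<le> (2 * norm U)\<^sup>2" by simp
  then show ?thesis by (rule power2_le_imp_le) simp
qed

text \<open>Cauchy-Schwarz for the derivative against the indicator of [a, b]. This Hoelder
  continuity of order 1/2 is the source of equicontinuity in the frequency estimate.\<close>

lemma h1_fun_holder: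
  assumes "a \<le> b"
  shows "(h1_fun U b - h1_fun U a)\<^sup>2 \<le> (b - a) * (norm U)\<^sup>2"
proof -
  define i1 where "i1 = abs_l2 (indicator {a..b})"
  have sq: "sq_integrable (indicator {a..b})"
    unfolding sq_integrable_def power2_eq_square indicator_inter_arith[symmetric]
    by (auto intro!: integrable_real_indicator simp: emeasure_lborel_Icc_eq)
  have "h1_fun U b - h1_fun U a = inner i1 (h1_deriv U)"
    using inner_l2_abs[OF sq rep_l2_sq_integrable, of "h1_deriv U"]
      is_primitiveD(2)[OF h1_fun_primitive assms, of U]
      loc_integrable_integral[OF loc_integrable_rep_l2, of a b "h1_deriv U"]
    by (simp add: i1_def set_lebesgue_integral_def)
  then have "(h1_fun U b - h1_fun U a)\<^sup>2 \<le> inner i1 i1 * inner (h1_deriv U) (h1_deriv U)"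
    using Cauchy_Schwarz_ineq by simp
  also have "inner i1 i1 = b - a"
    using assms by (simp add: i1_def inner_l2_abs[OF sq sq] flip: indicator_inter_arith)
  also have "(b - a) * inner (h1_deriv U) (h1_deriv U) \<le> (b - a) * (norm U)\<^sup>2"
    using assms norm_h1_deriv_le[of U]
    by (intro mult_left_mono) (auto simp flip: power2_norm_eq_inner intro!: power_mono)
  finally show ?thesis .
qed

text \<open>The local bound controls the value at n by an integral over [n, n + 1], and these
  integrals tend to 0. Values at integers suffice to remove boundary terms.\<close>

lemma h1_fun_at_infinity: "(\<lambda>n. h1_fun U (real n)) \<longlonglongrightarrow> 0" "(\<lambda>n. h1_fun U (- real n)) \<longlonglongrightarrow> 0"
proof -
  define q where "q x = 2 * (h1_fun U x)\<^sup>2 + (rep_l2 (h1_deriv U) x)\<^sup>2" for x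
  have q: "integrable lborel q"
    using h1_fun_sq_integrable[of U] rep_l2_sq_integrable[of "h1_deriv U"]
    by (auto simp: q_def[abs_def] sq_integrable_def)
  have ql: "loc_integrable q"
    using q by (rule integrable_imp_loc_integrable)
  have *: "(\<lambda>n. h1_fun U (s * real n)) \<longlonglongrightarrow> 0" if s: "s = 1 \<or> s = -1" for s
  proof -
    have "(\<lambda>n. LINT x|lborel. indicator {s * real n..s * real n + 1} x *\<^sub>R q x) \<longlonglongrightarrow> (LINT x::real|lborel. 0)"
    proof (rule integral_dominated_convergence[where w = "\<lambda>x. \<bar>q x\<bar>"])
      show "AE x in lborel. (\<lambda>n. indicator {s * real n..s * real n + 1} x *\<^sub>R q x) \<longlonglongrightarrow> 0"
      proof (rule AE_I2, rule tendsto_eventually)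
        fix x
        obtain N where "\<bar>x\<bar> + 2 \<le> real N" using real_arch_simple by blast
        then have "indicator {s * real n..s * real n + 1} x *\<^sub>R q x = 0" if "n \<ge> N" for n
          using that s by (auto simp: indicator_def)
        then show "\<forall>\<^sub>F n in sequentially. indicator {s * real n..s * real n + 1} x *\<^sub>R q x = 0"
          unfolding eventually_sequentially by blast
      qed
    qed (use q in \<open>auto simp: indicator_def intro: integrable_abs dest: borel_measurable_integrable\<close>)
    moreover have "(LINT x|lborel. indicator {s * real n..s * real n + 1} x *\<^sub>R q x) = integral {s * real n..s * real n + 1} q" for n
      using loc_integrable_integral[OF ql] by (simp add: set_lebesgue_integral_def)
    ultimately have "(\<lambda>n. integral {s * real n..s * real n + 1} q) \<longlonglongrightarrow> 0" by simp
    then have "(\<lambda>n. (h1_fun U (s * real n))\<^sup>2) \<longlonglongrightarrow> 0"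
      by (rule tendsto_sandwich[OF _ _ tendsto_const, rotated 2])
         (use h1_fun_sq_le_local in \<open>auto simp: q_def[abs_def] intro!: always_eventually\<close>)
    then have "(\<lambda>n. sqrt ((h1_fun U (s * real n))\<^sup>2)) \<longlonglongrightarrow> sqrt 0" by (rule tendsto_real_sqrt)
    then show ?thesis by (simp add: tendsto_rabs_zero_iff)
  qed
  show "(\<lambda>n. h1_fun U (real n)) \<longlonglongrightarrow> 0" "(\<lambda>n. h1_fun U (- real n)) \<longlonglongrightarrow> 0"
    using *[of 1] *[of "-1"] by simp_all
qed

text \<open>The product rule on [-n, n] leaves boundary values that vanish in the limit by
  \<open>h1_fun_at_infinity\<close>.\<close>

lemma h1_integration_by_parts: "inner (h1_deriv U) (h1_emb V) = - inner (h1_emb U) (h1_deriv V)"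
proof -
  define u v f g where "u = h1_fun U" and "v = h1_fun V" and "f = rep_l2 (h1_deriv U)" and "g = rep_l2 (h1_deriv V)"
  have int: "integrable lborel (\<lambda>x. f x * v x)" "integrable lborel (\<lambda>x. g x * u x)"
    unfolding u_def v_def f_def g_def by (intro sq_integrable_mult h1_fun_sq_integrable rep_l2_sq_integrable)+
  define h where "h x = f x * v x + g x * u x" for x
  have hi: "integrable lborel h" using int by (simp add: h_def[abs_def])
  have p: "is_primitive (\<lambda>x. u x * v x) h"
    unfolding u_def v_def f_def g_def h_def[abs_def] by (intro is_primitive_mult h1_fun_primitive)
  have "(\<lambda>n. LINT x|lborel. indicator {- real n..real n} x *\<^sub>R h x) \<longlonglongrightarrow> (LINT x|lborel. h x)"
  proof (rule integral_dominated_convergence[where w = "\<lambda>x. \<bar>h x\<bar>"])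
    show "AE x in lborel. (\<lambda>n. indicator {- real n..real n} x *\<^sub>R h x) \<longlonglongrightarrow> h x"
    proof (rule AE_I2, rule tendsto_eventually)
      fix x
      obtain N where "\<bar>x\<bar> \<le> real N" using real_arch_simple by blast
      then have "indicator {- real n..real n} x *\<^sub>R h x = h x" if "n \<ge> N" for n
        using that by (auto simp: indicator_def)
      then show "\<forall>\<^sub>F n in sequentially. indicator {- real n..real n} x *\<^sub>R h x = h x"
        unfolding eventually_sequentially by blast
    qed
  qed (use hi in \<open>auto simp: indicator_def intro: integrable_abs dest: borel_measurable_integrable\<close>)
  moreover have "(LINT x|lborel. indicator {- real n..real n} x *\<^sub>R h x) = u (real n) * v (real n) - u (- real n) * v (- real n)" for n
    using loc_integrable_integral[OF is_primitiveD(1)[OF p], of "- real n" "real n"]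
      is_primitiveD(2)[OF p, of "- real n" "real n"] by (simp add: set_lebesgue_integral_def)
  moreover have "(\<lambda>n. u (real n) * v (real n) - u (- real n) * v (- real n)) \<longlonglongrightarrow> 0 * 0 - 0 * 0"
    unfolding u_def v_def by (intro tendsto_intros h1_fun_at_infinity)
  ultimately have "(LINT x|lborel. h x) = 0" using LIMSEQ_unique by fastforce
  then have "(LINT x|lborel. f x * v x) + (LINT x|lborel. g x * u x) = 0"
    using int by (simp add: h_def)
  moreover have "inner (h1_deriv U) (h1_emb V) = (LINT x|lborel. f x * v x)"
    using inner_l2_abs[OF rep_l2_sq_integrable h1_fun_sq_integrable, of "h1_deriv U" V]
    by (simp add: abs_l2_h1_fun f_def v_def)
  moreover have "inner (h1_deriv V) (h1_emb U) = (LINT x|lborel. g x * u x)"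
    using inner_l2_abs[OF rep_l2_sq_integrable h1_fun_sq_integrable, of "h1_deriv V" U]
    by (simp add: abs_l2_h1_fun g_def u_def)
  ultimately show ?thesis by (simp add: inner_commute)
qed

text \<open>Uniqueness of the weak derivative; it makes the description in \<open>h1_of\<close> well
  defined.\<close>

lemma h1_emb_inject: "h1_emb U = h1_emb V \<longleftrightarrow> U = V"
proof
  assume eq: "h1_emb U = h1_emb V"
  define D where "D = U - V"
  have "h1_emb D = 0" by (simp add: D_def h1_emb_diff eq)
  have "AE x in lborel. h1_fun U x = h1_fun V x"
    using h1_fun_AE[of U] h1_fun_AE[of V] unfolding eq by eventually_elim simp
  then have "h1_fun U = h1_fun V" by (intro continuous_AE_eq_imp_eq h1_fun_continuous)
  then have 0: "h1_fun D x = 0" for x by (simp add: D_def h1_fun_diff)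
  have "AE x in lborel. rep_l2 (h1_deriv D) x = 0"
    using is_primitiveD[OF h1_fun_primitive[of D]] 0
    by (intro AE_0_if_interval_integrals_0) auto
  then have "(norm (h1_deriv D))\<^sup>2 = (LINT x::real|lborel. 0)"
    unfolding norm_l2_abs[OF rep_l2_sq_integrable, of "h1_deriv D", simplified abs_rep_l2]
    by (intro integral_cong_AE) (auto elim!: eventually_mono)
  then have "norm D = 0" using norm_h1[of D] \<open>h1_emb D = 0\<close> by simp
  then show "U = V" by (simp add: D_def)
qed simp

lemma h1_of_eqI: "h1_emb U = u \<Longrightarrow> h1_of u = U"
  unfolding h1_of_def by (rule the_equality) (auto simp: h1_emb_inject)

section \<open>Multiplication by a bounded function with bounded derivative\<close>

text \<open>Multiplying a test function by \<open>k\<close> gives a test function again, and testing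
  the weak derivative of \<open>U\<close> with it yields the product rule. The factor 3 counts the
  products k u, k' u and k u'.\<close>

lemma h1_mult_exists:
  assumes k: "\<And>x. (k has_vector_derivative k' x) (at x)" and k': "continuous_on UNIV k'"
    and B: "\<And>x. \<bar>k x\<bar> \<le> B" "\<And>x. \<bar>k' x\<bar> \<le> B"
  shows "\<exists>V. h1_emb V = abs_l2 (\<lambda>x. k x * rep_l2 (h1_emb U) x) \<and> norm V \<le> 3 * B * norm U"
proof -
  define u g where "u = rep_l2 (h1_emb U)" and "g = rep_l2 (h1_deriv U)"
  have usq: "sq_integrable u" and gsq: "sq_integrable g" by (auto simp: u_def g_def rep_l2_sq_integrable)
  have kc: "continuous_on UNIV k"
    using k by (meson continuous_at_imp_continuous_on has_vector_derivative_continuous)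
  have km [measurable]: "k \<in> borel_measurable borel" "k' \<in> borel_measurable borel" "u \<in> borel_measurable borel" "g \<in> borel_measurable borel"
    using kc k' usq gsq by (auto simp: borel_measurable_continuous_onI sq_integrable_def)
  have B0: "B \<ge> 0" using B(1)[of 0] by simp
  have bd: "AE x in lborel. \<bar>k x * w x\<bar> \<le> B * \<bar>w x\<bar>" "AE x in lborel. \<bar>k' x * w x\<bar> \<le> B * \<bar>w x\<bar>" for w :: "real \<Rightarrow> real"
    using B by (auto simp: abs_mult intro!: mult_right_mono)
  have sq: "sq_integrable (\<lambda>x. k x * u x)" "sq_integrable (\<lambda>x. k' x * u x)" "sq_integrable (\<lambda>x. k x * g x)"
    by (rule sq_integrable_bound[OF usq _ bd(1)] sq_integrable_bound[OF usq _ bd(2)]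
        sq_integrable_bound[OF gsq _ bd(1)], measurable)+
  have "weak_deriv (abs_l2 (\<lambda>x. k x * u x)) (abs_l2 (\<lambda>x. k' x * u x + k x * g x))"
    unfolding weak_deriv_abs[OF sq(1) sq_integrable_add[OF sq(2,3)]]
  proof (intro allI impI)
    fix \<phi> assume t: "test_function \<phi>"
    then obtain D R where D: "\<And>x. (\<phi> has_vector_derivative D x) (at x)" "continuous_on UNIV D"
      and R: "\<And>x. R < \<bar>x\<bar> \<Longrightarrow> \<phi> x = 0"
      by (auto simp: test_function_def C1_differentiable_on_def)
    have dD: "deriv \<phi> = D"
      using D(1) by (auto simp: fun_eq_iff has_real_derivative_iff_has_vector_derivative[symmetric] intro: DERIV_imp_deriv)
    have \<phi>c: "continuous_on UNIV \<phi>"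
      using D(1) by (meson continuous_at_imp_continuous_on has_vector_derivative_continuous)
    have d: "((\<lambda>x. k x * \<phi> x) has_vector_derivative k x * D x + k' x * \<phi> x) (at x)" for x
      using k[of x] D(1)[of x] unfolding has_real_derivative_iff_has_vector_derivative[symmetric]
      by (auto intro!: derivative_eq_intros)
    have t2: "test_function (\<lambda>x. k x * \<phi> x)"
      unfolding test_function_def C1_differentiable_on_def
    proof (intro conjI exI[of _ "\<lambda>x. k x * D x + k' x * \<phi> x"] exI[of _ R] ballI allI impI)
      show "continuous_on UNIV (\<lambda>x. k x * D x + k' x * \<phi> x)" by (intro continuous_intros kc k' D \<phi>c)
    qed (use d R in auto)
    have dk: "deriv (\<lambda>x. k x * \<phi> x) = (\<lambda>x. k x * D x + k' x * \<phi> x)"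
      using d by (auto simp: fun_eq_iff has_real_derivative_iff_has_vector_derivative[symmetric] intro: DERIV_imp_deriv)
    have \<phi>sq: "sq_integrable \<phi>" "sq_integrable D"
      using test_function_sq_integrable[OF t] by (simp_all add: dD)
    have int: "integrable lborel (\<lambda>x. k x * u x * D x)" "integrable lborel (\<lambda>x. k' x * u x * \<phi> x)"
      "integrable lborel (\<lambda>x. k x * g x * \<phi> x)"
      by (intro sq_integrable_mult sq \<phi>sq)+
    have "(LINT x|lborel. u x * (k x * D x + k' x * \<phi> x)) = - (LINT x|lborel. g x * (k x * \<phi> x))"
    proof -
      have "weak_deriv (abs_l2 u) (abs_l2 g)" using weak_deriv_h1[of U] by (simp add: u_def g_def)
      then have "(LINT x|lborel. u x * deriv (\<lambda>x. k x * \<phi> x) x) = - (LINT x|lborel. g x * (k x * \<phi> x))"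
        using t2 unfolding weak_deriv_abs[OF usq gsq] by blast
      then show ?thesis by (simp add: dk)
    qed
    moreover have "(LINT x|lborel. u x * (k x * D x + k' x * \<phi> x)) =
        (LINT x|lborel. k x * u x * D x) + (LINT x|lborel. k' x * u x * \<phi> x)"
      by (subst Bochner_Integration.integral_add[OF int(1,2), symmetric])
         (simp add: algebra_simps)
    moreover have "(LINT x|lborel. g x * (k x * \<phi> x)) = (LINT x|lborel. k x * g x * \<phi> x)"
      by (simp add: algebra_simps)
    ultimately show "(LINT x|lborel. k x * u x * deriv \<phi> x) = - (LINT x|lborel. (k' x * u x + k x * g x) * \<phi> x)"
      using int by (simp add: dD distrib_right)
  qed
  then obtain V where V: "h1_emb V = abs_l2 (\<lambda>x. k x * u x)" "h1_deriv V = abs_l2 (\<lambda>x. k' x * u x + k x * g x)"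
    using h1_exists by blast
  have n1: "norm (h1_emb V) \<le> B * norm U"
  proof -
    have "norm (h1_emb V) \<le> B * norm (abs_l2 u)"
      unfolding V by (intro norm_l2_abs_le sq usq bd B0)
    also have "\<dots> \<le> B * norm U" using B0 norm_h1_emb_le[of U] by (intro mult_left_mono) (auto simp: u_def)
    finally show ?thesis .
  qed
  have n2: "norm (h1_deriv V) \<le> 2 * B * norm U"
  proof -
    have "norm (h1_deriv V) \<le> norm (abs_l2 (\<lambda>x. k' x * u x)) + norm (abs_l2 (\<lambda>x. k x * g x))"
      unfolding V plus_l2_abs[OF sq(2,3), symmetric] by (rule norm_triangle_ineq)
    also have "\<dots> \<le> B * norm (abs_l2 u) + B * norm (abs_l2 g)"
      by (intro add_mono norm_l2_abs_le sq usq gsq bd B0)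
    also have "\<dots> \<le> B * norm U + B * norm U"
      using B0 norm_h1_emb_le[of U] norm_h1_deriv_le[of U] by (intro add_mono mult_left_mono) (auto simp: u_def g_def)
    finally show ?thesis by simp
  qed
  have "(norm V)\<^sup>2 \<le> (norm (h1_emb V) + norm (h1_deriv V))\<^sup>2"
    by (simp add: norm_h1 power2_sum)
  then have "norm V \<le> norm (h1_emb V) + norm (h1_deriv V)" by (rule power2_le_imp_le) simp
  also have "\<dots> \<le> 3 * B * norm U" using n1 n2 by simp
  finally show ?thesis using V(1) unfolding u_def by blast
qed

section \<open>Orthogonal projections onto spans of basis vectors\<close>

lemma orth_proj_eqI:
  assumes "subspace V" "p \<in> V" "\<And>z. z \<in> V \<Longrightarrow> inner (g - p) z = 0"
  shows "orth_proj V g = p"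
  unfolding orth_proj_def
proof (rule the_equality)
  fix q assume q: "q \<in> V \<and> (\<forall>z\<in>V. inner (g - q) z = 0)"
  then have "q - p \<in> V" using assms by (intro subspace_diff) auto
  then have "inner (g - q) (q - p) = 0" "inner (g - p) (q - p) = 0" using q assms(3) by auto
  then have "inner (q - p) (q - p) = 0" by (simp add: inner_diff_left)
  then show "q = p" by simp
qed (use assms in auto)

locale l2_basis =
  fixes e :: "nat \<Rightarrow> l2"
  assumes e: "orthonormal_basis e"
begin

lemma inner_e: "i \<ge> 1 \<Longrightarrow> j \<ge> 1 \<Longrightarrow> inner (e i) (e j) = (if i = j then 1 else 0)"
  using e by (simp add: orthonormal_basis_def)

lemma inner_sub_proj_span:
  assumes "z \<in> span (e ` {1..N})"
  shows "inner (g - (\<Sum>i=1..N. inner g (e i) *\<^sub>R e i)) z = 0"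
  using assms
proof (induction rule: span_induct_alt)
  case (step c x y)
  then obtain j where j: "j \<in> {1..N}" "x = e j" by auto
  have "(\<Sum>i=1..N. inner g (e i) * inner (e i) (e j)) = (\<Sum>i=1..N. if i = j then inner g (e j) else 0)"
    using j by (intro sum.cong) (auto simp: inner_e)
  then have "inner (g - (\<Sum>i=1..N. inner g (e i) *\<^sub>R e i)) (e j) = 0"
    using j by (simp add: inner_diff_left inner_sum_left)
  then show ?case using step j by (simp add: inner_add_right)
qed simp

lemma proj_sum_in_span: "(\<Sum>i=1..N. inner g (e i) *\<^sub>R e i) \<in> span (e ` {1..N})"
  by (intro span_sum span_scale span_base) auto

lemma proj_N_eq: "proj_N e N g = (\<Sum>i=1..N. inner g (e i) *\<^sub>R e i)"
  unfolding proj_N_def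
  by (intro orth_proj_eqI subspace_span proj_sum_in_span inner_sub_proj_span)

definition Q :: "nat \<Rightarrow> l2 \<Rightarrow> l2" where
  "Q N g = g - proj_N e N g"

lemma Q_add: "Q N (f + g) = Q N f + Q N g" and Q_scaleR: "Q N (c *\<^sub>R f) = c *\<^sub>R Q N f"
  by (simp_all add: Q_def proj_N_eq inner_add_left scaleR_add_left sum.distrib scaleR_diff_right scaleR_sum_right)

text \<open>Best approximation by Pythagoras. With \<open>p = 0\<close> it is the contraction
  property, with \<open>p\<close> near \<open>g\<close> the convergence below.\<close>

lemma norm_Q_le_dist:
  assumes "p \<in> span (e ` {1..N})"
  shows "norm (Q N g) \<le> norm (g - p)"
proof -
  have "proj_N e N g \<in> span (e ` {1..N})"
    unfolding proj_N_eq by (rule proj_sum_in_span)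
  then have "proj_N e N g - p \<in> span (e ` {1..N})" using assms by (rule span_diff)
  then have "inner (Q N g) (proj_N e N g - p) = 0"
    using inner_sub_proj_span unfolding Q_def proj_N_eq by blast
  then have "(norm (Q N g + (proj_N e N g - p)))\<^sup>2 = (norm (Q N g))\<^sup>2 + (norm (proj_N e N g - p))\<^sup>2"
    by (simp add: power2_norm_eq_inner inner_add_left inner_add_right inner_commute)
  then have "(norm (Q N g))\<^sup>2 \<le> (norm (g - p))\<^sup>2" by (simp add: Q_def)
  then show ?thesis by (rule power2_le_imp_le) simp
qed

lemma norm_Q_le: "norm (Q N g) \<le> norm g"
  using norm_Q_le_dist[OF span_zero, of N g] by simp

lemma bounded_linear_Q: "bounded_linear (Q N)"
  by (rule bounded_linear_intro[where K = 1]) (auto simp: Q_add Q_scaleR norm_Q_le)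

text \<open>Convergence holds for each fixed \<open>g\<close>, not uniformly on bounded sets; an
  estimate uniform in the solutions must therefore be reduced to finitely many fixed
  functions.\<close>

lemma Q_tendsto_0: "(\<lambda>N. norm (Q N g)) \<longlonglongrightarrow> 0"
proof (rule LIMSEQ_I)
  fix \<epsilon> :: real assume "\<epsilon> > 0"
  have "g \<in> closure (span (e ` {1..}))" using e by (simp add: orthonormal_basis_def)
  then obtain p where p: "p \<in> span (e ` {1..})" "dist p g < \<epsilon>"
    using \<open>\<epsilon> > 0\<close> closure_approachable by blast
  from p(1) have "\<exists>N. p \<in> span (e ` {1..N})"
  proof (induction rule: span_induct_alt)
    case base
    then show ?case using span_zero by blast
  next
    case (step c x y)
    then obtain j N where "j \<ge> 1" "x = e j" "y \<in> span (e ` {1..N})" by auto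
    moreover have "span (e ` {1..N}) \<subseteq> span (e ` {1..max j N})" by (intro span_mono image_mono) auto
    moreover have "e j \<in> span (e ` {1..max j N})" if "j \<ge> 1"
      using that by (intro span_base) auto
    ultimately have "c *\<^sub>R x + y \<in> span (e ` {1..max j N})"
      by (intro span_add span_scale) auto
    then show ?case by blast
  qed
  then obtain N0 where N0: "p \<in> span (e ` {1..N0})" by blast
  have "norm (norm (Q N g) - 0) < \<epsilon>" if "N \<ge> N0" for N
  proof -
    have "span (e ` {1..N0}) \<subseteq> span (e ` {1..N})" using that by (intro span_mono image_mono) auto
    then have "norm (Q N g) \<le> norm (g - p)" using N0 by (intro norm_Q_le_dist) auto
    then show ?thesis using p(2) by (simp add: dist_norm norm_minus_commute)
  qed
  then show "\<exists>N0. \<forall>N\<ge>N0. norm (norm (Q N g) - 0) < \<epsilon>" by blast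
qed

end

section \<open>The nonlinearity\<close>

definition nonlin :: "real \<Rightarrow> real \<Rightarrow> real" where
  "nonlin m s = \<bar>s\<bar> powr (2 * m) * s"

lemma powr_le_one_add_sq:
  assumes "0 < m" "m < 1" "0 \<le> (a::real)"
  shows "a powr (2 * m) \<le> 1 + a\<^sup>2"
proof (cases "a \<le> 1")
  case True
  then have "a powr (2 * m) \<le> 1 powr (2 * m)" using assms by (intro powr_mono2) auto
  then show ?thesis by (simp add: add_increasing2)
next
  case False
  then have "a powr (2 * m) \<le> a powr 2" using assms by (intro powr_mono) auto
  then show ?thesis using False by simp
qed

text \<open>Young's inequality by scaling: \<open>powr_le_one_add_sq\<close> is applied to
  \<open>a / s\<close>, where \<open>s powr (2 * m) = \<delta>\<close>.\<close>

lemma powr_absorb: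
  fixes m \<delta> :: real
  assumes m: "0 < m" "m < 1" and "\<delta> > 0"
  shows "\<exists>C>0. \<forall>a\<ge>0. a powr (2 * m) \<le> \<delta> + C * a\<^sup>2"
proof -
  define s where "s = \<delta> powr (1 / (2 * m))"
  have s: "s > 0" "s powr (2 * m) = \<delta>"
    using assms by (auto simp: s_def powr_powr)
  have "a powr (2 * m) \<le> \<delta> + (\<delta> / s\<^sup>2) * a\<^sup>2" if "a \<ge> 0" for a
  proof -
    have "a powr (2 * m) = s powr (2 * m) * (a / s) powr (2 * m)"
      using s that assms(3) by (simp add: powr_divide)
    also have "\<dots> \<le> \<delta> * (1 + (a / s)\<^sup>2)"
      using s that assms(3) powr_le_one_add_sq[OF m, of "a / s"] by (simp add: mult_left_mono)
    finally show ?thesis by (simp add: power_divide algebra_simps)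
  qed
  moreover have "\<delta> / s\<^sup>2 > 0" using s assms by simp
  ultimately show ?thesis by blast
qed

lemma nonlin_deriv:
  assumes "0 < m"
  shows "(nonlin m has_real_derivative (2 * m + 1) * \<bar>s\<bar> powr (2 * m)) (at s)"
proof (cases "s = 0")
  case True
  \<comment> \<open>At 0 the difference quotient is |h|^(2m) itself, whose limit vanishes because m
    is positive.\<close>
  have "((\<lambda>h. \<bar>h\<bar> powr (2 * m)) \<longlongrightarrow> \<bar>0\<bar> powr (2 * m)) (at (0::real))"
    using assms by (intro tendsto_powr' tendsto_intros) auto
  then have "((\<lambda>h. (nonlin m (0 + h) - nonlin m 0) / h) \<longlongrightarrow> 0) (at 0)"
    using Lim_transform_eventually[of "\<lambda>h. \<bar>h\<bar> powr (2 * m)" 0 "at 0" "\<lambda>h. (nonlin m (0 + h) - nonlin m 0) / h"]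
    by (auto simp: eventually_at_filter nonlin_def)
  then show ?thesis using True by (simp add: DERIV_def)
next
  case False
  show ?thesis
  proof (cases "s > 0")
    case True
    have "((\<lambda>s. s powr (2 * m) * s) has_real_derivative (2 * m + 1) * s powr (2 * m)) (at s)"
      using True by (auto intro!: derivative_eq_intros simp: powr_diff field_simps)
    then have "((\<lambda>s. s powr (2 * m) * s) has_real_derivative (2 * m + 1) * \<bar>s\<bar> powr (2 * m)) (at s)"
      using True by simp
    then show ?thesis
      by (rule has_field_derivative_transform_within_open[of _ _ _ "{0<..}"])
         (use True in \<open>auto simp: nonlin_def\<close>)
  next
    case False
    then have neg: "s < 0" using \<open>s \<noteq> 0\<close> by simp
    have "((\<lambda>s. (- s) powr (2 * m) * s) has_real_derivative (2 * m + 1) * (- s) powr (2 * m)) (at s)"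
      using neg by (auto intro!: derivative_eq_intros simp: powr_diff field_simps)
    then have "((\<lambda>s. (- s) powr (2 * m) * s) has_real_derivative (2 * m + 1) * \<bar>s\<bar> powr (2 * m)) (at s)"
      using neg by simp
    then show ?thesis
      by (rule has_field_derivative_transform_within_open[of _ _ _ "{..<0}"])
         (use neg in \<open>auto simp: nonlin_def\<close>)
  qed
qed

text \<open>Mean value theorem, with 3 as a bound for \<open>2 * m + 1\<close>.\<close>

lemma nonlin_diff_le:
  assumes m: "0 < m" "m < 1" and ab: "\<bar>a\<bar> \<le> M" "\<bar>b\<bar> \<le> M"
  shows "\<bar>nonlin m a - nonlin m b\<bar> \<le> 3 * M powr (2 * m) * \<bar>a - b\<bar>"
proof -
  have "norm (nonlin m a - nonlin m b) \<le> (3 * M powr (2 * m)) * norm (a - b)"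
  proof (rule field_differentiable_bound[of "{-M..M}"])
    fix z assume z: "z \<in> {-M..M}"
    show "(nonlin m has_field_derivative (2 * m + 1) * \<bar>z\<bar> powr (2 * m)) (at z within {-M..M})"
      using nonlin_deriv[OF m(1)] by (rule has_field_derivative_at_within)
    have "\<bar>z\<bar> powr (2 * m) \<le> M powr (2 * m)" using z m by (intro powr_mono2) auto
    then have "(2 * m + 1) * \<bar>z\<bar> powr (2 * m) \<le> 3 * M powr (2 * m)" using m by (intro mult_mono) auto
    then show "norm ((2 * m + 1) * \<bar>z\<bar> powr (2 * m)) \<le> 3 * M powr (2 * m)" using m by simp
  qed (use ab in auto)
  then show ?thesis by simp
qed

text \<open>By homogeneity, uniform continuity on [-3, 3] scales to every \<open>M\<close> with the
  same \<open>\<eta>\<close>. The 3 leaves room for a point of [-M, M] shifted by at most 2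
  M.\<close>

lemma abs_powr_modulus:
  fixes m \<delta> :: real
  assumes m: "0 < m" and "\<delta> > 0"
  shows "\<exists>\<eta>>0. \<forall>M\<ge>0. \<forall>a b. \<bar>a\<bar> \<le> 3 * M \<longrightarrow> \<bar>b\<bar> \<le> 3 * M \<longrightarrow> \<bar>a - b\<bar> \<le> \<eta> * M \<longrightarrow>
    \<bar>\<bar>a\<bar> powr (2 * m) - \<bar>b\<bar> powr (2 * m)\<bar> \<le> \<delta> * M powr (2 * m)"
proof -
  have "continuous_on {-3..3} (\<lambda>x::real. \<bar>x\<bar> powr (2 * m))"
    using m by (intro continuous_on_powr' continuous_intros) auto
  then have "uniformly_continuous_on {-3..3} (\<lambda>x::real. \<bar>x\<bar> powr (2 * m))"
    by (rule compact_uniformly_continuous) simp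
  then obtain \<eta> where \<eta>: "\<eta> > 0" "\<And>x y. x \<in> {-3..3} \<Longrightarrow> y \<in> {-3..3} \<Longrightarrow> dist x y < \<eta> \<Longrightarrow>
      dist (\<bar>x\<bar> powr (2 * m)) (\<bar>y\<bar> powr (2 * m)) < \<delta>"
    using \<open>\<delta> > 0\<close> unfolding uniformly_continuous_on_def by metis
  have "\<bar>\<bar>a\<bar> powr (2 * m) - \<bar>b\<bar> powr (2 * m)\<bar> \<le> \<delta> * M powr (2 * m)"
    if *: "M \<ge> 0" "\<bar>a\<bar> \<le> 3 * M" "\<bar>b\<bar> \<le> 3 * M" "\<bar>a - b\<bar> \<le> \<eta> / 2 * M" for M a b
  proof (cases "M = 0")
    case True
    then show ?thesis using * by simp
  next
    case False
    then have M: "M > 0" using * by simp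
    have "dist (a / M) (b / M) = \<bar>a - b\<bar> / M"
      using M by (simp add: dist_real_def flip: diff_divide_distrib)
    also have "\<dots> \<le> \<eta> / 2" using * M by (simp add: pos_divide_le_eq)
    also have "\<dots> < \<eta>" using \<eta>(1) by simp
    finally have "dist (\<bar>a / M\<bar> powr (2 * m)) (\<bar>b / M\<bar> powr (2 * m)) < \<delta>"
      using * M by (intro \<eta>(2)) (auto simp: field_simps abs_le_iff)
    then have "\<bar>\<bar>a\<bar> powr (2 * m) / M powr (2 * m) - \<bar>b\<bar> powr (2 * m) / M powr (2 * m)\<bar> < \<delta>"
      using M by (simp add: dist_real_def powr_divide)
    then have "\<bar>\<bar>a\<bar> powr (2 * m) - \<bar>b\<bar> powr (2 * m)\<bar> / M powr (2 * m) < \<delta>"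
      by (simp flip: diff_divide_distrib)
    then show ?thesis using M by (simp add: pos_divide_less_eq less_imp_le)
  qed
  then show ?thesis using \<eta>(1) by (intro exI[of _ "\<eta> / 2"]) auto
qed

text \<open>
  The derivative of \<open>nonlin\<close> is merely Hoelder continuous, so \<open>f(u) - f(v)\<close> cannot be bounded in \<open>H\<^sup>1\<close>
  linearly in \<open>u - v\<close>. Its modulus of continuity, however, is linear in \<open>u - v\<close>.
\<close>

lemma nonlin_second_difference:
  assumes m: "0 < m" "m < 1" and "\<delta> > 0"
  shows "\<exists>\<eta>>0. \<forall>M a b a' b'. \<bar>a\<bar> \<le> M \<longrightarrow> \<bar>b\<bar> \<le> M \<longrightarrow> \<bar>a'\<bar> \<le> M \<longrightarrow> \<bar>b'\<bar> \<le> M \<longrightarrow> \<bar>a - a'\<bar> \<le> \<eta> * M \<longrightarrow>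
    \<bar>(nonlin m a - nonlin m b) - (nonlin m a' - nonlin m b')\<bar> \<le>
      M powr (2 * m) * (3 * \<delta> * \<bar>a' - b'\<bar> + 27 * \<bar>(a - b) - (a' - b')\<bar>)"
proof -
  obtain \<eta> where \<eta>: "\<eta> > 0" "\<And>M a b. M \<ge> 0 \<Longrightarrow> \<bar>a\<bar> \<le> 3 * M \<Longrightarrow> \<bar>b\<bar> \<le> 3 * M \<Longrightarrow> \<bar>a - b\<bar> \<le> \<eta> * M \<Longrightarrow>
    \<bar>\<bar>a\<bar> powr (2 * m) - \<bar>b\<bar> powr (2 * m)\<bar> \<le> \<delta> * M powr (2 * m)"
    using abs_powr_modulus[OF m(1) \<open>\<delta> > 0\<close>] by blast
  have "\<bar>(nonlin m a - nonlin m b) - (nonlin m a' - nonlin m b')\<bar> \<le>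
      M powr (2 * m) * (3 * \<delta> * \<bar>a' - b'\<bar> + 27 * \<bar>(a - b) - (a' - b')\<bar>)"
    if *: "\<bar>a\<bar> \<le> M" "\<bar>b\<bar> \<le> M" "\<bar>a'\<bar> \<le> M" "\<bar>b'\<bar> \<le> M" "\<bar>a - a'\<bar> \<le> \<eta> * M" for M a b a' b'
  proof -
    \<comment> \<open>The difference splits into two parts. One is the change of f(s + p) - f(s)
      between s = b' and s = a', small because f' varies little under a small shift p. The other is
      f(b' + p) - f(b), where b' + p - b is the second difference of the arguments.\<close>
    define p where "p = a - a'"
    have M0: "M \<ge> 0" using *(1) by linarith
    have p: "\<bar>p\<bar> \<le> 2 * M" "\<bar>p\<bar> \<le> \<eta> * M" using * by (auto simp: p_def)
    define G where "G s = nonlin m (s + p) - nonlin m s" for s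
    have "norm (G a' - G b') \<le> (3 * (\<delta> * M powr (2 * m))) * norm (a' - b')"
    proof (rule field_differentiable_bound[of "{-M..M}"])
      fix z assume z: "z \<in> {-M..M}"
      show "(G has_field_derivative (2 * m + 1) * (\<bar>z + p\<bar> powr (2 * m) - \<bar>z\<bar> powr (2 * m))) (at z within {-M..M})"
        unfolding G_def
        by (rule has_field_derivative_at_within)
           (auto intro!: derivative_eq_intros DERIV_chain2[OF nonlin_deriv[OF m(1)]] nonlin_deriv[OF m(1)] simp: algebra_simps)
      have "\<bar>\<bar>z + p\<bar> powr (2 * m) - \<bar>z\<bar> powr (2 * m)\<bar> \<le> \<delta> * M powr (2 * m)"
        using z p M0 by (intro \<eta>(2)) auto
      then have "(2 * m + 1) * \<bar>\<bar>z + p\<bar> powr (2 * m) - \<bar>z\<bar> powr (2 * m)\<bar> \<le> 3 * (\<delta> * M powr (2 * m))"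
        using m by (intro mult_mono) auto
      then show "norm ((2 * m + 1) * (\<bar>z + p\<bar> powr (2 * m) - \<bar>z\<bar> powr (2 * m))) \<le> 3 * (\<delta> * M powr (2 * m))"
        using m by (simp add: abs_mult)
    qed (use * in auto)
    then have 1: "\<bar>G a' - G b'\<bar> \<le> M powr (2 * m) * (3 * \<delta> * \<bar>a' - b'\<bar>)" by (simp add: algebra_simps)
    have "\<bar>nonlin m (b' + p) - nonlin m b\<bar> \<le> 3 * (3 * M) powr (2 * m) * \<bar>b' + p - b\<bar>"
      using * p by (intro nonlin_diff_le m) auto
    \<comment> \<open>The radius \<open>3 * M\<close> contains the shifted point
      \<open>b' + p\<close>; it costs the factor 9, an upper bound for
      \<open>3 powr (2 * m)\<close>.\<close>
    also have "\<dots> \<le> 3 * (9 * M powr (2 * m)) * \<bar>b' + p - b\<bar>"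
    proof -
      have "(3::real) powr (2 * m) \<le> 3 powr 2" using m by (intro powr_mono) auto
      then have "3 powr (2 * m) * M powr (2 * m) \<le> 9 * M powr (2 * m)" by (intro mult_right_mono) auto
      then show ?thesis using M0 by (intro mult_right_mono mult_left_mono) (auto simp: powr_mult)
    qed
    also have "b' + p - b = (a - b) - (a' - b')" by (simp add: p_def)
    finally have 2: "\<bar>nonlin m (b' + p) - nonlin m b\<bar> \<le> M powr (2 * m) * (27 * \<bar>(a - b) - (a' - b')\<bar>)"
      by (simp add: algebra_simps)
    have "(nonlin m a - nonlin m b) - (nonlin m a' - nonlin m b') = (G a' - G b') + (nonlin m (b' + p) - nonlin m b)"
      by (simp add: G_def p_def)
    then show ?thesis using 1 2 by (simp add: distrib_left)
  qed
  then show ?thesis using \<eta>(1) by blast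
qed

section \<open>The nonlinearity as a map from H^1 to L^2\<close>

lemma nonlin_measurable [measurable]: "nonlin m \<in> borel_measurable borel"
  unfolding nonlin_def[abs_def] by measurable

lemma nonlin_h1_sq_integrable: "0 < m \<Longrightarrow> m < 1 \<Longrightarrow> sq_integrable (\<lambda>x. nonlin m (h1_fun U x))"
  using nonlin_diff_le[where b = 0, OF _ _ h1_fun_bound[of U]]
  by (intro sq_integrable_bound[OF h1_fun_sq_integrable[of U], where C = "3 * (2 * norm U) powr (2 * m)"])
     (auto simp: nonlin_def)

lemma nemytskii_eq:
  assumes "0 < m" "m < 1"
  shows "nemytskii m U = abs_l2 (\<lambda>x. nonlin m (h1_fun U x))"
proof -
  have ae: "AE x in lborel. nonlin m (h1_fun U x) = nonlin m (rep_l2 (h1_emb U) x)"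
    using h1_fun_AE[of U] by eventually_elim simp
  have "sq_integrable (\<lambda>x. nonlin m (rep_l2 (h1_emb U) x))"
    by (rule sq_integrable_AE_cong[OF nonlin_h1_sq_integrable[OF assms] _ ae]) measurable
  then have "abs_l2 (\<lambda>x. nonlin m (h1_fun U x)) = abs_l2 (\<lambda>x. nonlin m (rep_l2 (h1_emb U) x))"
    by (intro abs_l2_cong nonlin_h1_sq_integrable assms ae)
  then show ?thesis by (simp add: nemytskii_def nonlin_def)
qed

lemma h1_fun_bound_sum:
  "\<bar>h1_fun U x\<bar> \<le> 2 * (norm U + norm V)" "\<bar>h1_fun V x\<bar> \<le> 2 * (norm U + norm V)"
  by (rule order_trans[OF h1_fun_bound], simp)+

lemma two_powr_le:
  fixes m a :: real
  shows "0 < m \<Longrightarrow> m < 1 \<Longrightarrow> a \<ge> 0 \<Longrightarrow> (2 * a) powr (2 * m) \<le> 4 * a powr (2 * m)"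
proof -
  assume m: "0 < m" "m < 1" "a \<ge> 0"
  then have "(2::real) powr (2 * m) \<le> 2 powr 2" by (intro powr_mono) auto
  then have "2 powr (2 * m) * a powr (2 * m) \<le> 4 * a powr (2 * m)" by (intro mult_right_mono) auto
  then show ?thesis using m by (simp add: powr_mult)
qed

lemma nonlin_h1_diff_le:
  assumes m: "0 < m" "m < 1"
  shows "\<bar>nonlin m (h1_fun U x) - nonlin m (h1_fun V x)\<bar>
    \<le> 12 * (norm U + norm V) powr (2 * m) * \<bar>h1_fun (U - V) x\<bar>"
proof -
  have "\<bar>nonlin m (h1_fun U x) - nonlin m (h1_fun V x)\<bar>
      \<le> 3 * (2 * (norm U + norm V)) powr (2 * m) * \<bar>h1_fun (U - V) x\<bar>"
    unfolding h1_fun_diff by (intro nonlin_diff_le m h1_fun_bound_sum)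
  also have "\<dots> \<le> 3 * (4 * (norm U + norm V) powr (2 * m)) * \<bar>h1_fun (U - V) x\<bar>"
    by (intro mult_right_mono mult_left_mono two_powr_le m) auto
  finally show ?thesis by simp
qed

text \<open>This Lipschitz bound is all that claim (1) needs, because \<open>Q N\<close> is a
  contraction for every \<open>N\<close>.\<close>

lemma norm_nemytskii_diff_le:
  assumes m: "0 < m" "m < 1"
  shows "norm (nemytskii m U - nemytskii m V) \<le> 12 * (norm U + norm V) powr (2 * m) * norm (U - V)"
proof -
  have "nemytskii m U - nemytskii m V = abs_l2 (\<lambda>x. nonlin m (h1_fun U x) - nonlin m (h1_fun V x))"
    unfolding nemytskii_eq[OF m] by (intro minus_l2_abs nonlin_h1_sq_integrable m)
  also have "norm \<dots> \<le> 12 * (norm U + norm V) powr (2 * m) * norm (abs_l2 (h1_fun (U - V)))"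
    using nonlin_h1_diff_le[OF m, of U _ V]
    by (intro norm_l2_abs_le sq_integrable_minus nonlin_h1_sq_integrable m h1_fun_sq_integrable) auto
  also have "\<dots> \<le> 12 * (norm U + norm V) powr (2 * m) * norm (U - V)"
    unfolding abs_l2_h1_fun by (intro mult_left_mono norm_h1_emb_le) auto
  finally show ?thesis .
qed

text \<open>Makes the forcing of the difference equation continuous in time, as
  \<open>mild_path\<close> demands.\<close>

lemma nemytskii_continuous:
  assumes m: "0 < m" "m < 1"
  shows "continuous_on UNIV (nemytskii m)"
  unfolding continuous_on_sequentially
proof (intro allI ballI impI)
  fix X :: "nat \<Rightarrow> h1" and U assume "(\<forall>n. X n \<in> UNIV) \<and> X \<longlonglongrightarrow> U"
  then have X: "X \<longlonglongrightarrow> U" by simp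
  have "(\<lambda>n. 12 * (1 + (norm (X n) + norm U)\<^sup>2) * norm (X n - U)) \<longlonglongrightarrow> 12 * (1 + (norm U + norm U)\<^sup>2) * 0"
    by (intro tendsto_intros X tendsto_norm_zero LIM_zero)
  then have lim: "(\<lambda>n. 12 * (1 + (norm (X n) + norm U)\<^sup>2) * norm (X n - U)) \<longlonglongrightarrow> 0" by simp
  have "norm (nemytskii m (X n) - nemytskii m U) \<le> 12 * (1 + (norm (X n) + norm U)\<^sup>2) * norm (X n - U)" for n
    by (rule order_trans[OF norm_nemytskii_diff_le[OF m]])
       (intro mult_right_mono mult_left_mono powr_le_one_add_sq m; simp)
  then have "(\<lambda>n. nemytskii m (X n) - nemytskii m U) \<longlonglongrightarrow> 0"
    by (intro Lim_null_comparison[OF _ lim]) auto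
  then show "(nemytskii m \<circ> X) \<longlonglongrightarrow> nemytskii m U"
    unfolding o_def by (rule LIM_zero_cancel)
qed

section \<open>High frequencies of the nonlinearity on bounded intervals\<close>

lemma abs_l2_sum:
  assumes "finite J" "\<And>j. j \<in> J \<Longrightarrow> sq_integrable (f j)"
  shows "sq_integrable (\<lambda>x. \<Sum>j\<in>J. f j x) \<and> (\<Sum>j\<in>J. abs_l2 (f j)) = abs_l2 (\<lambda>x. \<Sum>j\<in>J. f j x)"
  using assms
proof (induction J rule: finite_induct)
  case empty
  have "0 *\<^sub>R abs_l2 (\<lambda>x. 0) = abs_l2 (\<lambda>x. 0 * 0)" by (rule scaleR_l2_abs[OF sq_integrable_zero])
  then show ?case by (simp add: sq_integrable_zero)
next
  case (insert j J)
  then show ?case by (simp add: sq_integrable_add plus_l2_abs)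
qed

lemma h1_fun_near:
  assumes "a \<le> b" "b - a \<le> \<rho>\<^sup>2" "0 \<le> \<rho>"
  shows "\<bar>h1_fun U b - h1_fun U a\<bar> \<le> \<rho> * norm U"
proof -
  have "(h1_fun U b - h1_fun U a)\<^sup>2 \<le> (b - a) * (norm U)\<^sup>2" by (rule h1_fun_holder[OF assms(1)])
  also have "\<dots> \<le> \<rho>\<^sup>2 * (norm U)\<^sup>2" using assms(2) by (intro mult_right_mono) auto
  finally have "\<bar>h1_fun U b - h1_fun U a\<bar>\<^sup>2 \<le> (\<rho> * norm U)\<^sup>2" by (simp add: power_mult_distrib)
  then show ?thesis by (rule power2_le_imp_le) (use assms in simp)
qed

lemma sq_integrable_interval: "sq_integrable (indicator {a..<b::real})"
  unfolding sq_integrable_def power2_eq_square indicator_inter_arith[symmetric]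
  by (cases "a \<le> b") (auto intro!: integrable_real_indicator)

text \<open>Hoelder continuity controls the shift of \<open>U\<close> and the increment of
  \<open>U - V\<close> over a distance \<open>\<rho>\<^sup>2\<close>. What matters is that
  \<open>\<rho>\<close> depends on neither \<open>U\<close> nor \<open>V\<close> and that the bound
  is linear in \<open>norm (U - V)\<close>.\<close>

lemma nonlin_h1_modulus:
  assumes m: "0 < m" "m < 1" and "\<delta> > 0"
  shows "\<exists>\<rho>>0. \<forall>U V x y. y \<le> x \<longrightarrow> x - y \<le> \<rho>\<^sup>2 \<longrightarrow>
    \<bar>(nonlin m (h1_fun U x) - nonlin m (h1_fun V x)) - (nonlin m (h1_fun U y) - nonlin m (h1_fun V y))\<bar>
      \<le> \<delta> * (norm U + norm V) powr (2 * m) * norm (U - V)"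
proof -
  \<comment> \<open>132 is 4 times 3 * 2 + 27: the 4 comes from \<open>two_powr_le\<close>, the 2
    from the sup bound for \<open>U - V\<close>, and 3 and 27 from the second difference.\<close>
  define \<delta>1 where "\<delta>1 = \<delta> / 132"
  have \<delta>1: "\<delta>1 > 0" using assms by (simp add: \<delta>1_def)
  obtain \<eta> where \<eta>: "\<eta> > 0" and sd: "\<And>M a b a' b'. \<bar>a\<bar> \<le> M \<Longrightarrow> \<bar>b\<bar> \<le> M \<Longrightarrow> \<bar>a'\<bar> \<le> M \<Longrightarrow> \<bar>b'\<bar> \<le> M \<Longrightarrow> \<bar>a - a'\<bar> \<le> \<eta> * M \<Longrightarrow>
    \<bar>(nonlin m a - nonlin m b) - (nonlin m a' - nonlin m b')\<bar> \<le>
      M powr (2 * m) * (3 * \<delta>1 * \<bar>a' - b'\<bar> + 27 * \<bar>(a - b) - (a' - b')\<bar>)"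
    using nonlin_second_difference[OF m \<delta>1] by blast
  \<comment> \<open>The first bound serves the increment of \<open>U - V\<close>, the second the
    shift of \<open>U\<close> relative to the radius \<open>2 * A\<close>.\<close>
  define \<rho> where "\<rho> = min \<delta>1 (2 * \<eta>)"
  have \<rho>: "\<rho> > 0" "\<rho> \<le> \<delta>1" "\<rho> \<le> 2 * \<eta>" using \<delta>1 \<eta> by (auto simp: \<rho>_def)
  have "\<bar>(nonlin m (h1_fun U x) - nonlin m (h1_fun V x)) - (nonlin m (h1_fun U y) - nonlin m (h1_fun V y))\<bar>
      \<le> \<delta> * (norm U + norm V) powr (2 * m) * norm (U - V)"
    if xy: "y \<le> x" "x - y \<le> \<rho>\<^sup>2" for U V x y
  proof -
    define A where "A = norm U + norm V"
    have A: "A \<ge> 0" "norm U \<le> A" by (auto simp: A_def)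
    note near = h1_fun_near[OF xy less_imp_le[OF \<rho>(1)]]
    have "\<bar>h1_fun U x - h1_fun U y\<bar> \<le> \<rho> * norm U" by (rule near)
    also have "\<dots> \<le> (2 * \<eta>) * A" using \<rho> A by (intro mult_mono) auto
    finally have "\<bar>h1_fun U x - h1_fun U y\<bar> \<le> \<eta> * (2 * A)" by simp
    then have "\<bar>(nonlin m (h1_fun U x) - nonlin m (h1_fun V x)) - (nonlin m (h1_fun U y) - nonlin m (h1_fun V y))\<bar>
      \<le> (2 * A) powr (2 * m) * (3 * \<delta>1 * \<bar>h1_fun U y - h1_fun V y\<bar>
          + 27 * \<bar>(h1_fun U x - h1_fun V x) - (h1_fun U y - h1_fun V y)\<bar>)"
      unfolding A_def by (intro sd h1_fun_bound_sum)
    also have "\<dots> = (2 * A) powr (2 * m) * (3 * \<delta>1 * \<bar>h1_fun (U - V) y\<bar>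
        + 27 * \<bar>h1_fun (U - V) x - h1_fun (U - V) y\<bar>)"
      by (simp add: h1_fun_diff)
    also have "\<dots> \<le> (4 * A powr (2 * m)) * (3 * \<delta>1 * (2 * norm (U - V)) + 27 * (\<delta>1 * norm (U - V)))"
      using \<delta>1 A \<rho> order_trans[OF near[of "U - V"] mult_right_mono[OF \<rho>(2) norm_ge_zero[of "U - V"]]]
      by (intro mult_mono add_mono mult_left_mono two_powr_le m h1_fun_bound) auto
    also have "\<dots> = \<delta> * A powr (2 * m) * norm (U - V)"
      by (simp add: \<delta>1_def)
    finally show ?thesis by (simp add: A_def)
  qed
  then show ?thesis using \<rho>(1) by blast
qed

context l2_basis
begin

text \<open>The indicators \<open>I j\<close> of the grid cells do not depend on \<open>U\<close>
  and \<open>V\<close>, which enter only through the sampled coefficients, at most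
  \<open>24 * B\<close>. So the convergence of \<open>Q N\<close> to 0 on finitely many functions
  gives one \<open>N\<close> for all pairs.\<close>

lemma high_frequencies_small:
  assumes m: "0 < m" "m < 1" and "R > 0" "\<delta> > 0"
  shows "\<exists>N\<ge>1. \<forall>U V. norm (Q N (abs_l2 (\<lambda>x. indicator {-R..<R} x *
      (nonlin m (h1_fun U x) - nonlin m (h1_fun V x)))))
    \<le> \<delta> * (norm U + norm V) powr (2 * m) * norm (U - V)"
proof -
  define L where "L = norm (abs_l2 (indicator {-R..<R}))"
  \<comment> \<open>Leaves half of \<open>\<delta>\<close> for the sampling error and half for the
    step function.\<close>
  define \<delta>1 where "\<delta>1 = \<delta> / (2 * (L + 1))"
  have L: "L \<ge> 0" by (simp add: L_def)
  have \<delta>1: "\<delta>1 > 0" "\<delta>1 * L \<le> \<delta> / 2"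
    using \<open>\<delta> > 0\<close> L by (auto simp: \<delta>1_def field_simps)
  obtain \<rho> where \<rho>: "\<rho> > 0" and mod: "\<And>U V x y. y \<le> x \<Longrightarrow> x - y \<le> \<rho>\<^sup>2 \<Longrightarrow>
    \<bar>(nonlin m (h1_fun U x) - nonlin m (h1_fun V x)) - (nonlin m (h1_fun U y) - nonlin m (h1_fun V y))\<bar>
      \<le> \<delta>1 * (norm U + norm V) powr (2 * m) * norm (U - V)"
    using nonlin_h1_modulus[OF m \<delta>1(1)] by blast
  obtain n where n: "2 * R / \<rho>\<^sup>2 < real n" using reals_Archimedean2 by blast
  have npos: "real n > 0" using n \<open>R > 0\<close> \<rho> by (smt (verit) divide_pos_pos zero_less_power)
  define h where "h = 2 * R / real n"
  have h: "h > 0" "h \<le> \<rho>\<^sup>2" "real n * h = 2 * R"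
    using n npos \<open>R > 0\<close> \<rho> by (auto simp: h_def field_simps)
  define idx where "idx x = nat \<lfloor>(x + R) / h\<rfloor>" for x
  define p where "p j = real j * h - R" for j :: nat
  \<comment> \<open>The cells are half-open, so each point of [-R, R) lies in exactly one of them.
    Sampling is at the left end \<open>p j\<close>, because \<open>mod\<close> compares with a point
    to the left.\<close>
  define I where "I j x = indicator {-R..<R} x * (if idx x = j then 1 else 0 :: real)" for j x
  have idx: "idx x < n" "p (idx x) \<le> x" "x - p (idx x) \<le> \<rho>\<^sup>2" if x: "x \<in> {-R..<R}" for x
  proof -
    have f0: "\<lfloor>(x + R) / h\<rfloor> \<ge> 0" using x h by auto
    have r: "real (idx x) = of_int \<lfloor>(x + R) / h\<rfloor>" using f0 by (simp add: idx_def)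
    have "real (idx x) \<le> (x + R) / h" "(x + R) / h < real (idx x) + 1" unfolding r by linarith+
    then have b: "real (idx x) * h \<le> x + R" "x + R < (real (idx x) + 1) * h"
      using h by (auto simp: field_simps)
    show "p (idx x) \<le> x" using b by (simp add: p_def)
    show "x - p (idx x) \<le> \<rho>\<^sup>2" using b h by (simp add: p_def algebra_simps)
    have "real (idx x) * h < real n * h" using b(1) x h(3) by simp
    then show "idx x < n" using h(1) by (simp only: mult_less_cancel_right_pos of_nat_less_iff)
  qed
  have Isq: "sq_integrable (I j)" for j
  proof (rule sq_integrable_bound[OF sq_integrable_interval[of "-R" R], where C = 1])
    have [measurable]: "idx \<in> measurable borel (count_space UNIV)"
      unfolding idx_def[abs_def] by measurable
    show "I j \<in> borel_measurable borel" unfolding I_def[abs_def] by measurable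
  qed (auto simp: I_def)
  have "(\<lambda>N. \<Sum>j<n. norm (Q N (abs_l2 (I j)))) \<longlonglongrightarrow> (\<Sum>j<n. 0)"
    by (intro tendsto_sum Q_tendsto_0)
  \<comment> \<open>48 is twice the factor 24 in the bound on the coefficients.\<close>
  then have "eventually (\<lambda>N. (\<Sum>j<n. norm (Q N (abs_l2 (I j)))) < \<delta> / 48) sequentially"
    using \<open>\<delta> > 0\<close> by (intro order_tendstoD(2)) auto
  then obtain N0 where N0: "\<And>N. N \<ge> N0 \<Longrightarrow> (\<Sum>j<n. norm (Q N (abs_l2 (I j)))) < \<delta> / 48"
    unfolding eventually_sequentially by blast
  define N where "N = max 1 N0"
  have "norm (Q N (abs_l2 (\<lambda>x. indicator {-R..<R} x * (nonlin m (h1_fun U x) - nonlin m (h1_fun V x)))))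
    \<le> \<delta> * (norm U + norm V) powr (2 * m) * norm (U - V)" for U V
  proof -
    define g where "g x = nonlin m (h1_fun U x) - nonlin m (h1_fun V x)" for x
    define B where "B = (norm U + norm V) powr (2 * m) * norm (U - V)"
    have B: "B \<ge> 0" by (simp add: B_def)
    have gsq: "sq_integrable g"
      unfolding g_def[abs_def] by (intro sq_integrable_minus nonlin_h1_sq_integrable m)
    have cut: "sq_integrable (\<lambda>x. indicator {-R..<R} x * g x)"
      by (rule sq_integrable_bound[OF gsq, where C = 1]) (use gsq in \<open>auto simp: sq_integrable_def indicator_def\<close>)
    have steps: "sq_integrable (\<lambda>x. \<Sum>j<n. g (p j) * I j x)"
      "(\<Sum>j<n. g (p j) *\<^sub>R abs_l2 (I j)) = abs_l2 (\<lambda>x. \<Sum>j<n. g (p j) * I j x)"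
      using abs_l2_sum[of "{..<n}" "\<lambda>j x. g (p j) * I j x"] sq_integrable_scale[OF Isq]
      by (auto simp: scaleR_l2_abs[OF Isq])
    define D where "D = abs_l2 (\<lambda>x. indicator {-R..<R} x * g x) - (\<Sum>j<n. g (p j) *\<^sub>R abs_l2 (I j))"
    have "norm D \<le> (\<delta>1 * B) * L"
      unfolding D_def L_def steps(2) minus_l2_abs[OF cut steps(1)]
    proof (intro norm_l2_abs_le sq_integrable_minus cut steps(1) sq_integrable_interval AE_I2)
      fix x
      show "\<bar>indicator {-R..<R} x * g x - (\<Sum>j<n. g (p j) * I j x)\<bar> \<le> (\<delta>1 * B) * \<bar>indicator {-R..<R} x\<bar>"
      proof (cases "x \<in> {-R..<R}")
        case True
        have "(\<Sum>j<n. g (p j) * I j x) = (\<Sum>j<n. if j = idx x then g (p j) else 0)"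
          using True by (intro sum.cong) (auto simp: I_def)
        also have "\<dots> = g (p (idx x))" using idx(1)[OF True] by simp
        finally show ?thesis
          using True mod[OF idx(2,3)[OF True], of U V] by (simp add: g_def B_def mult.assoc)
      next
        case False
        then show ?thesis by (simp add: I_def)
      qed
    qed (use B \<delta>1 in simp)
    also have "\<dots> \<le> \<delta> / 2 * B" using mult_right_mono[OF \<delta>1(2) B] by (simp add: mult_ac)
    finally have 1: "norm D \<le> \<delta> / 2 * B" .
    have gp: "\<bar>g x\<bar> \<le> 24 * B" for x
    proof -
      have "\<bar>g x\<bar> \<le> 12 * (norm U + norm V) powr (2 * m) * \<bar>h1_fun (U - V) x\<bar>"
        unfolding g_def by (rule nonlin_h1_diff_le[OF m])
      also have "\<dots> \<le> 12 * (norm U + norm V) powr (2 * m) * (2 * norm (U - V))"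
        by (intro mult_left_mono h1_fun_bound) auto
      finally show ?thesis by (simp add: B_def)
    qed
    have "norm (Q N (\<Sum>j<n. g (p j) *\<^sub>R abs_l2 (I j))) = norm (\<Sum>j<n. g (p j) *\<^sub>R Q N (abs_l2 (I j)))"
      by (simp add: bounded_linear.linear[OF bounded_linear_Q] linear_sum Q_scaleR)
    also have "\<dots> \<le> (\<Sum>j<n. (24 * B) * norm (Q N (abs_l2 (I j))))"
      by (rule order_trans[OF norm_sum]) (auto intro!: sum_mono mult_right_mono gp)
    also have "\<dots> = (24 * B) * (\<Sum>j<n. norm (Q N (abs_l2 (I j))))" by (simp add: sum_distrib_left)
    also have "\<dots> \<le> (24 * B) * (\<delta> / 48)"
      using N0[of N] B by (intro mult_left_mono) (auto simp: N_def)
    finally have 2: "norm (Q N (\<Sum>j<n. g (p j) *\<^sub>R abs_l2 (I j))) \<le> \<delta> / 2 * B"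
      by (simp add: mult.commute)
    have "abs_l2 (\<lambda>x. indicator {-R..<R} x * g x) = D + (\<Sum>j<n. g (p j) *\<^sub>R abs_l2 (I j))"
      by (simp add: D_def)
    then have "norm (Q N (abs_l2 (\<lambda>x. indicator {-R..<R} x * g x))) \<le>
        norm (Q N D) + norm (Q N (\<Sum>j<n. g (p j) *\<^sub>R abs_l2 (I j)))"
      by (simp only: Q_add norm_triangle_ineq)
    also have "\<dots> \<le> \<delta> * B" using 1 2 norm_Q_le[of N D] by simp
    finally show ?thesis by (simp add: g_def B_def mult.assoc)
  qed
  moreover have "N \<ge> 1" by (simp add: N_def)
  ultimately show ?thesis by blast
qed

end

section \<open>The weight\<close>

lemma phi_pos: "phi x \<ge> ln 2" "phi x > 0"
proof -
  show 1: "phi x \<ge> ln 2" by (simp add: phi_def add_nonneg_pos)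
  show "phi x > 0" using 1 ln_gt_zero[of "2::real"] by linarith
qed

lemma ln_2_ge_half: "ln 2 \<ge> (1 / 2 :: real)"
proof -
  have "exp (1 / 2 :: real)^2 \<le> 2^2"
    using exp_le by (simp flip: exp_double)
  then have "exp (1 / 2 :: real) \<le> 2" by (rule power2_le_imp_le) simp
  then show ?thesis by (subst ln_ge_iff) auto
qed

lemma phi_has_derivative: "(phi has_real_derivative 2 * x / (x\<^sup>2 + 2)) (at x)"
  unfolding phi_def[abs_def] by (auto intro!: derivative_eq_intros simp: add_nonneg_pos)

lemma phi_continuous: "continuous_on UNIV phi"
  using phi_has_derivative by (meson continuous_at_imp_continuous_on DERIV_isCont)

definition psi_x :: "real \<Rightarrow> real \<Rightarrow> real" where
  "psi_x x t = 2 * x / (x\<^sup>2 + 2) * (1 - exp (- t / phi x) * (1 + t / phi x))"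

lemma psi_has_derivative: "((\<lambda>x. psi x t) has_real_derivative psi_x x t) (at x)"
proof -
  have "phi x \<noteq> 0" using phi_pos(2)[of x] by simp
  then have "((\<lambda>x. phi x * (1 - exp (- t / phi x))) has_real_derivative
      D * (1 - exp (- t / phi x) * (1 + t / phi x))) (at x)" if "(phi has_real_derivative D) (at x)" for D
    by (auto intro!: derivative_eq_intros that simp: field_simps)
  from this[OF phi_has_derivative] show ?thesis unfolding psi_def psi_x_def .
qed

lemma psi_x_continuous: "continuous_on UNIV (\<lambda>x. psi_x x t)"
  unfolding psi_x_def using phi_pos(2)
  by (intro continuous_intros phi_continuous) (auto simp: less_imp_neq[THEN not_sym] add_nonneg_pos add_nonneg_eq_0_iff)

lemma exp_neg_lipschitz:
  assumes "0 \<le> a" "0 \<le> b"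
  shows "\<bar>exp (- a) - exp (- b)\<bar> \<le> \<bar>a - b :: real\<bar>"
proof -
  have "norm (exp (- a) - exp (- b)) \<le> 1 * norm (a - b)"
    by (rule field_differentiable_bound[of "{0..}" _ "\<lambda>z. - exp (- z)"])
       (use assms in \<open>auto intro!: derivative_eq_intros\<close>)
  then show ?thesis by simp
qed

lemma exp_neg_mult_lipschitz:
  assumes "0 \<le> a" "0 \<le> b"
  shows "\<bar>exp (- a) * (1 + a) - exp (- b) * (1 + b)\<bar> \<le> \<bar>a - b :: real\<bar>"
proof -
  have "norm (exp (- a) * (1 + a) - exp (- b) * (1 + b)) \<le> 1 * norm (a - b)"
  proof (rule field_differentiable_bound[of "{0..}" _ "\<lambda>z. - z * exp (- z)"])
    fix z :: real assume "z \<in> {0..}"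
    have "z \<le> exp z" using exp_ge_add_one_self[of z] by linarith
    then have "z * exp (- z) \<le> exp z * exp (- z)" by (intro mult_right_mono) auto
    then show "norm (- z * exp (- z)) \<le> 1" using \<open>z \<in> {0..}\<close> by (simp flip: exp_add)
  qed (use assms in \<open>auto intro!: derivative_eq_intros simp: algebra_simps\<close>)
  then show ?thesis by simp
qed

text \<open>The unbounded \<open>phi\<close> cancels: \<open>phi x\<close> times the change of
  \<open>t / phi x\<close> is the change of time. With s = 0 this bounds the weight and its
  x-derivative at each time; in general it gives continuity in time of multiplication by the weight.
  The 2 bounds \<open>1 / phi x\<close>.\<close>

lemma psi_time_lipschitz:
  assumes "s \<ge> 0" "t \<ge> 0"
  shows "\<bar>psi x t - psi x s\<bar> \<le> 2 * \<bar>t - s\<bar>" "\<bar>psi_x x t - psi_x x s\<bar> \<le> 2 * \<bar>t - s\<bar>"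
proof -
  have p: "phi x > 0" "1 / phi x \<le> 2" using phi_pos[of x] ln_2_ge_half by (auto simp: field_simps)
  have dist: "\<bar>t / phi x - s / phi x\<bar> = \<bar>t - s\<bar> / phi x"
    using p by (simp flip: diff_divide_distrib)
  have nn: "t / phi x \<ge> 0" "s / phi x \<ge> 0" using assms p by auto
  have "\<bar>psi x t - psi x s\<bar> = phi x * \<bar>exp (- (t / phi x)) - exp (- (s / phi x))\<bar>"
    using p(1) by (simp add: psi_def abs_mult abs_minus_commute flip: right_diff_distrib)
  also have "\<dots> \<le> phi x * (\<bar>t - s\<bar> / phi x)"
    using exp_neg_lipschitz[OF nn] p unfolding dist by (intro mult_left_mono) auto
  also have "\<dots> = \<bar>t - s\<bar>" using p by simp
  also have "\<dots> \<le> 2 * \<bar>t - s\<bar>" by simp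
  finally show "\<bar>psi x t - psi x s\<bar> \<le> 2 * \<bar>t - s\<bar>" .
  have "\<bar>2 * x / (x\<^sup>2 + 2)\<bar> \<le> 1"
  proof -
    have "0 \<le> (\<bar>x\<bar> - 1)\<^sup>2" by simp
    then have "2 * \<bar>x\<bar> \<le> x\<^sup>2 + 2" by (simp add: power2_diff)
    then show ?thesis by (simp add: abs_mult add_nonneg_pos)
  qed
  moreover have "\<bar>exp (- (t / phi x)) * (1 + t / phi x) - exp (- (s / phi x)) * (1 + s / phi x)\<bar> \<le> \<bar>t - s\<bar> * 2"
  proof -
    have "\<bar>t - s\<bar> * (1 / phi x) \<le> \<bar>t - s\<bar> * 2" by (intro mult_left_mono p) auto
    then show ?thesis using exp_neg_mult_lipschitz[OF nn] unfolding dist by simp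
  qed
  ultimately have "\<bar>2 * x / (x\<^sup>2 + 2)\<bar> * \<bar>exp (- (t / phi x)) * (1 + t / phi x) - exp (- (s / phi x)) * (1 + s / phi x)\<bar> \<le> 1 * (\<bar>t - s\<bar> * 2)"
    by (intro mult_mono) auto
  moreover have "psi_x x t - psi_x x s = - (2 * x / (x\<^sup>2 + 2) *
      (exp (- (t / phi x)) * (1 + t / phi x) - exp (- (s / phi x)) * (1 + s / phi x)))"
    by (simp add: psi_x_def algebra_simps)
  ultimately show "\<bar>psi_x x t - psi_x x s\<bar> \<le> 2 * \<bar>t - s\<bar>" by (simp add: abs_mult)
qed

lemma psi_at_0: "psi x 0 = 0" "psi_x x 0 = 0"
  by (simp_all add: psi_def psi_x_def)

lemma psi_bound: "t \<ge> 0 \<Longrightarrow> \<bar>psi x t\<bar> \<le> 2 * t" "t \<ge> 0 \<Longrightarrow> \<bar>psi_x x t\<bar> \<le> 2 * t"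
  using psi_time_lipschitz[of 0 t x] by (simp_all add: psi_at_0)

text \<open>Since exp(-a) \<le> 1 / (1 + a), the weight is at least t y / (t + y) with y =
  \<open>phi x\<close>. This is half the harmonic mean of t and y, hence at least K when both are at
  least 2 K.\<close>

lemma psi_ge:
  assumes "K > 0" "phi x \<ge> 2 * K" "t \<ge> 2 * K"
  shows "psi x t \<ge> K"
proof -
  define y where "y = phi x"
  have y: "y \<ge> 2 * K" "y > 0" "t > 0" using assms by (auto simp: y_def)
  have "exp (- t / y) \<le> 1 / (1 + t / y)"
  proof -
    have "1 + t / y \<le> exp (t / y)" by (rule exp_ge_add_one_self)
    then have "1 / exp (t / y) \<le> 1 / (1 + t / y)" using y by (intro divide_left_mono) (auto simp: add_pos_pos)
    then show ?thesis by (simp add: exp_minus inverse_eq_divide)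
  qed
  then have "y * (1 - 1 / (1 + t / y)) \<le> y * (1 - exp (- t / y))" using y by (intro mult_left_mono) auto
  moreover have "y * (1 - 1 / (1 + t / y)) = t * y / (t + y)"
    using y by (simp add: field_simps)
  moreover have "K \<le> t * y / (t + y)"
  proof -
    have "K * t \<le> t * y / 2" "K * y \<le> t * y / 2"
      using mult_right_mono[OF y(1), of t] mult_right_mono[OF assms(3), of y] y by (auto simp: mult.commute)
    then have "K * (t + y) \<le> t * y" by (simp add: distrib_left)
    then show ?thesis using y by (simp add: pos_le_divide_eq)
  qed
  ultimately show ?thesis by (simp add: psi_def y_def)
qed

lemma phi_ge:
  assumes "\<bar>x\<bar> \<ge> exp K"
  shows "phi x \<ge> 2 * K"
proof -
  have "exp (2 * K) = (exp K)\<^sup>2" by (simp add: exp_double)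
  also have "\<dots> \<le> \<bar>x\<bar>\<^sup>2" using assms by (intro power_mono) auto
  also have "\<dots> \<le> x\<^sup>2 + 2" by simp
  finally show ?thesis unfolding phi_def by (subst ln_ge_iff) (auto simp: add_nonneg_pos)
qed

section \<open>Multiplication by the weight on H^1\<close>

lemma psi_rep_sq_integrable:
  "t \<ge> 0 \<Longrightarrow> sq_integrable (\<lambda>x. psi x t * rep_l2 u x)"
proof (rule sq_integrable_bound[OF rep_l2_sq_integrable[of u]])
  assume "t \<ge> 0"
  then show "AE x in lborel. \<bar>psi x t * rep_l2 u x\<bar> \<le> 2 * t * \<bar>rep_l2 u x\<bar>"
    using psi_bound(1) by (auto simp: abs_mult intro!: mult_right_mono)
  have [measurable]: "phi \<in> borel_measurable borel"
    by (rule borel_measurable_continuous_onI[OF phi_continuous])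
  show "(\<lambda>x. psi x t * rep_l2 u x) \<in> borel_measurable borel"
    unfolding psi_def by measurable
qed

text \<open>For \<open>t \<ge> 0\<close> the weight and its derivative are bounded by
  \<open>2 * t\<close>, so the product lies in H^1 and \<open>h1_of\<close> returns it.\<close>

lemma h1_emb_weight_mult:
  assumes "t \<ge> 0"
  shows "h1_emb (weight_mult t U) = abs_l2 (\<lambda>x. psi x t * rep_l2 (h1_emb U) x)"
proof -
  obtain V where "h1_emb V = abs_l2 (\<lambda>x. psi x t * rep_l2 (h1_emb U) x)"
    using h1_mult_exists[of "\<lambda>x. psi x t" "\<lambda>x. psi_x x t" "2 * t" U] psi_bound[OF assms] psi_x_continuous
      psi_has_derivative unfolding has_real_derivative_iff_has_vector_derivative by blast
  then show ?thesis unfolding weight_mult_def by (simp add: h1_of_eqI)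
qed

lemma weight_mult_diff:
  assumes "t \<ge> 0"
  shows "norm (weight_mult t U - weight_mult t V) \<le> 6 * t * norm (U - V)"
proof -
  obtain Y where Y: "h1_emb Y = abs_l2 (\<lambda>x. psi x t * rep_l2 (h1_emb (U - V)) x)" "norm Y \<le> 3 * (2 * t) * norm (U - V)"
    using h1_mult_exists[of "\<lambda>x. psi x t" "\<lambda>x. psi_x x t" "2 * t" "U - V"] psi_bound[OF assms] psi_x_continuous
      psi_has_derivative unfolding has_real_derivative_iff_has_vector_derivative by blast
  note sq = psi_rep_sq_integrable[OF assms]
  have "h1_emb (weight_mult t U - weight_mult t V) = abs_l2 (\<lambda>x. psi x t * rep_l2 (h1_emb U) x - psi x t * rep_l2 (h1_emb V) x)"
    unfolding h1_emb_diff h1_emb_weight_mult[OF assms] by (rule minus_l2_abs[OF sq sq])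
  also have "\<dots> = h1_emb Y"
    unfolding Y(1)
  proof (rule abs_l2_cong[OF sq_integrable_minus[OF sq sq] sq])
    show "AE x in lborel. psi x t * rep_l2 (h1_emb U) x - psi x t * rep_l2 (h1_emb V) x = psi x t * rep_l2 (h1_emb (U - V)) x"
      using rep_l2_diff[of "h1_emb U" "h1_emb V"] unfolding h1_emb_diff
      by eventually_elim (simp add: right_diff_distrib)
  qed
  finally have "weight_mult t U - weight_mult t V = Y" by (simp add: h1_emb_inject)
  then show ?thesis using Y(2) by simp
qed

lemma weight_mult_time_diff:
  assumes "t \<ge> 0" "s \<ge> 0"
  shows "norm (weight_mult t U - weight_mult s U) \<le> 6 * \<bar>t - s\<bar> * norm U"
proof -
  have d: "((\<lambda>x. psi x t - psi x s) has_vector_derivative psi_x x t - psi_x x s) (at x)" for x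
    unfolding has_real_derivative_iff_has_vector_derivative[symmetric]
    by (intro derivative_intros psi_has_derivative)
  obtain Y where Y: "h1_emb Y = abs_l2 (\<lambda>x. (psi x t - psi x s) * rep_l2 (h1_emb U) x)" "norm Y \<le> 3 * (2 * \<bar>t - s\<bar>) * norm U"
    using h1_mult_exists[OF d continuous_on_diff[OF psi_x_continuous psi_x_continuous]
        psi_time_lipschitz(1)[OF assms(2,1)] psi_time_lipschitz(2)[OF assms(2,1)]] by blast
  note sq = psi_rep_sq_integrable[OF assms(1)] psi_rep_sq_integrable[OF assms(2)]
  have "h1_emb (weight_mult t U - weight_mult s U) = h1_emb Y"
    unfolding h1_emb_diff h1_emb_weight_mult[OF assms(1)] h1_emb_weight_mult[OF assms(2)] Y(1) left_diff_distrib
    by (rule minus_l2_abs[OF sq])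
  then have "weight_mult t U - weight_mult s U = Y" by (simp add: h1_emb_inject)
  then show ?thesis using Y(2) by simp
qed

text \<open>Makes the integrand in the exponent of claim (2) continuous, as the Gronwall argument
  requires.\<close>

lemma weight_mult_continuous_on:
  assumes u: "continuous_on {0..} u"
  shows "continuous_on {0..} (\<lambda>r. weight_mult r (u r))"
  unfolding continuous_on_sequentially
proof (intro allI ballI impI)
  fix X :: "nat \<Rightarrow> real" and t assume t: "t \<in> {0..}" and "(\<forall>n. X n \<in> {0..}) \<and> X \<longlonglongrightarrow> t"
  then have X: "\<And>n. X n \<ge> 0" "X \<longlonglongrightarrow> t" by auto
  have uX: "(\<lambda>n. u (X n)) \<longlonglongrightarrow> u t"
    using continuous_on_tendsto_compose[OF u X(2)] t X(1) by auto
  have "(\<lambda>n. 6 * X n * norm (u (X n) - u t) + 6 * \<bar>X n - t\<bar> * norm (u t)) \<longlonglongrightarrow> 6 * t * 0 + 6 * \<bar>t - t\<bar> * norm (u t)"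
    by (intro tendsto_intros X uX tendsto_norm_zero LIM_zero)
  then have lim: "(\<lambda>n. 6 * X n * norm (u (X n) - u t) + 6 * \<bar>X n - t\<bar> * norm (u t)) \<longlonglongrightarrow> 0" by simp
  have "norm (weight_mult (X n) (u (X n)) - weight_mult t (u t)) \<le> 6 * X n * norm (u (X n) - u t) + 6 * \<bar>X n - t\<bar> * norm (u t)" for n
  proof -
    have "weight_mult (X n) (u (X n)) - weight_mult t (u t) =
      (weight_mult (X n) (u (X n)) - weight_mult (X n) (u t)) + (weight_mult (X n) (u t) - weight_mult t (u t))" by simp
    then have "norm (weight_mult (X n) (u (X n)) - weight_mult t (u t)) \<le>
      norm (weight_mult (X n) (u (X n)) - weight_mult (X n) (u t)) + norm (weight_mult (X n) (u t) - weight_mult t (u t))"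
      by (metis norm_triangle_ineq)
    also have "\<dots> \<le> 6 * X n * norm (u (X n) - u t) + 6 * \<bar>X n - t\<bar> * norm (u t)"
      using X(1) t by (intro add_mono weight_mult_diff weight_mult_time_diff) auto
    finally show ?thesis .
  qed
  then have "(\<lambda>n. weight_mult (X n) (u (X n)) - weight_mult t (u t)) \<longlonglongrightarrow> 0"
    by (intro Lim_null_comparison[OF _ lim]) auto
  then show "((\<lambda>r. weight_mult r (u r)) \<circ> X) \<longlonglongrightarrow> weight_mult t (u t)"
    unfolding o_def by (rule LIM_zero_cancel)
qed

lemma h1_fun_weight_mult:
  assumes "t \<ge> 0"
  shows "h1_fun (weight_mult t U) x = psi x t * h1_fun U x"
proof -
  have "AE x in lborel. h1_fun (weight_mult t U) x = psi x t * h1_fun U x"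
    using h1_fun_AE[of "weight_mult t U"] h1_fun_AE[of U]
      rep_abs_l2[OF psi_rep_sq_integrable[OF assms, of "h1_emb U"]]
    unfolding h1_emb_weight_mult[OF assms] by eventually_elim simp
  moreover have "continuous_on UNIV (\<lambda>x. psi x t)"
    using psi_has_derivative by (meson continuous_at_imp_continuous_on DERIV_isCont)
  ultimately have "h1_fun (weight_mult t U) = (\<lambda>x. psi x t * h1_fun U x)"
    by (intro continuous_AE_eq_imp_eq continuous_intros h1_fun_continuous)
  then show ?thesis by simp
qed

text \<open>In this region the weight is at least \<open>K\<close>, so the sup bound for the
  weighted function gains a factor 1 / K.\<close>

lemma h1_fun_tail:
  assumes "K > 0" "\<bar>x\<bar> \<ge> exp K" "t \<ge> 2 * K"
  shows "\<bar>h1_fun U x\<bar> \<le> 2 * (norm (weight_mult t U) / K)"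
proof -
  have "t \<ge> 0" using assms by simp
  have "K * \<bar>h1_fun U x\<bar> \<le> psi x t * \<bar>h1_fun U x\<bar>"
    using psi_ge[OF assms(1) phi_ge[OF assms(2)] assms(3)] by (intro mult_right_mono) auto
  also have "\<dots> = \<bar>h1_fun (weight_mult t U) x\<bar>"
    using psi_ge[OF assms(1) phi_ge[OF assms(2)] assms(3)] assms(1)
    by (simp add: h1_fun_weight_mult[OF \<open>t \<ge> 0\<close>] abs_mult)
  also have "\<dots> \<le> 2 * norm (weight_mult t U)" by (rule h1_fun_bound)
  finally show ?thesis using assms(1) by (simp add: field_simps)
qed

section \<open>Foias--Prodi estimate of the damped nonlinearity\<close>

context l2_basis
begin

text \<open>There are two sources of smallness: on [-R, R) the choice of \<open>N\<close>, and
  outside it the weight, where \<open>Q N\<close> serves as a mere contraction.\<close>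

lemma Q_nemytskii_le:
  assumes m: "0 < m" "m < 1" and "\<epsilon> > 0"
  shows "\<exists>T>0. \<exists>N\<ge>1. \<forall>U V t. t \<ge> T \<longrightarrow>
    norm (Q N (nemytskii m U - nemytskii m V)) \<le>
      \<epsilon> * (1 + (norm U)\<^sup>2 + (norm V)\<^sup>2 + (norm (weight_mult t U))\<^sup>2 + (norm (weight_mult t V))\<^sup>2) * norm (U - V)"
proof -
  \<comment> \<open>The powers of \<open>A\<close> and \<open>B\<close> are bounded by 1 + A^2 and 1
    + B^2, whose sum is at most 4 times the bracket in the goal.\<close>
  define \<delta> where "\<delta> = \<epsilon> / 4"
  have \<delta>: "\<delta> > 0" using assms by (simp add: \<delta>_def)
  \<comment> \<open>Chosen so that the Lipschitz factor
    \<open>3 * (4 * (B / K) powr (2 * m))\<close> in the tail equals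
    \<open>\<delta> * B powr (2 * m)\<close>.\<close>
  define K where "K = (12 / \<delta>) powr (1 / (2 * m))"
  have K: "K > 0" "K powr (2 * m) = 12 / \<delta>"
    using \<delta> m by (auto simp: K_def powr_powr)
  define R where "R = exp K"
  have "R > 0" by (simp add: R_def)
  obtain N where N: "N \<ge> 1" "\<And>U V. norm (Q N (abs_l2 (\<lambda>x. indicator {-R..<R} x *
      (nonlin m (h1_fun U x) - nonlin m (h1_fun V x)))))
    \<le> \<delta> * (norm U + norm V) powr (2 * m) * norm (U - V)"
    using high_frequencies_small[OF m \<open>R > 0\<close> \<delta>] by blast
  have "norm (Q N (nemytskii m U - nemytskii m V)) \<le>
      \<epsilon> * (1 + (norm U)\<^sup>2 + (norm V)\<^sup>2 + (norm (weight_mult t U))\<^sup>2 + (norm (weight_mult t V))\<^sup>2) * norm (U - V)"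
    if t: "t \<ge> 2 * K" for U V t
  proof -
    define g where "g x = nonlin m (h1_fun U x) - nonlin m (h1_fun V x)" for x
    define A where "A = norm U + norm V"
    define B where "B = norm (weight_mult t U) + norm (weight_mult t V)"
    have nn: "A \<ge> 0" "B \<ge> 0" by (auto simp: A_def B_def)
    have gsq: "sq_integrable g"
      unfolding g_def[abs_def] by (intro sq_integrable_minus nonlin_h1_sq_integrable m)
    have gm [measurable]: "g \<in> borel_measurable borel" using gsq by (simp add: sq_integrable_def)
    have sq: "sq_integrable (\<lambda>x. indicator {-R..<R} x * g x)" "sq_integrable (\<lambda>x. indicator (- {-R..<R}) x * g x)"
      by (rule sq_integrable_bound[OF gsq, where C = 1]; auto simp: indicator_def)+
    have "nemytskii m U - nemytskii m V = abs_l2 g"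
      unfolding nemytskii_eq[OF m] g_def[abs_def] by (intro minus_l2_abs nonlin_h1_sq_integrable m)
    also have "g = (\<lambda>x. indicator {-R..<R} x * g x + indicator (- {-R..<R}) x * g x)"
      by (auto simp: indicator_def fun_eq_iff)
    also have "abs_l2 \<dots> = abs_l2 (\<lambda>x. indicator {-R..<R} x * g x) + abs_l2 (\<lambda>x. indicator (- {-R..<R}) x * g x)"
      by (rule plus_l2_abs[OF sq, symmetric])
    finally have split: "nemytskii m U - nemytskii m V =
      abs_l2 (\<lambda>x. indicator {-R..<R} x * g x) + abs_l2 (\<lambda>x. indicator (- {-R..<R}) x * g x)" .
    have 1: "norm (Q N (abs_l2 (\<lambda>x. indicator {-R..<R} x * g x))) \<le> \<delta> * A powr (2 * m) * norm (U - V)"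
      unfolding g_def A_def by (rule N(2))
    have "norm (abs_l2 (\<lambda>x. indicator (- {-R..<R}) x * g x)) \<le> (\<delta> * B powr (2 * m)) * norm (abs_l2 (h1_fun (U - V)))"
    proof (intro norm_l2_abs_le sq h1_fun_sq_integrable AE_I2)
      fix x
      show "\<bar>indicator (- {-R..<R}) x * g x\<bar> \<le> (\<delta> * B powr (2 * m)) * \<bar>h1_fun (U - V) x\<bar>"
      proof (cases "x \<in> {-R..<R}")
        case False
        then have x: "\<bar>x\<bar> \<ge> exp K" by (auto simp: R_def)
        have "\<bar>g x\<bar> \<le> 3 * (2 * (B / K)) powr (2 * m) * \<bar>h1_fun U x - h1_fun V x\<bar>"
          unfolding g_def
        proof (rule nonlin_diff_le[OF m])
          have "norm (weight_mult t U) / K \<le> B / K" "norm (weight_mult t V) / K \<le> B / K"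
            using K by (auto simp: B_def intro!: divide_right_mono)
          then show "\<bar>h1_fun U x\<bar> \<le> 2 * (B / K)" "\<bar>h1_fun V x\<bar> \<le> 2 * (B / K)"
            using h1_fun_tail[OF K(1) x t, of U] h1_fun_tail[OF K(1) x t, of V] by linarith+
        qed
        also have "\<dots> \<le> 3 * (4 * (B / K) powr (2 * m)) * \<bar>h1_fun U x - h1_fun V x\<bar>"
          using nn K by (intro mult_right_mono mult_left_mono two_powr_le m) auto
        also have "3 * (4 * (B / K) powr (2 * m)) = \<delta> * B powr (2 * m)"
          using nn K \<delta> by (simp add: powr_divide)
        finally show ?thesis using False by (simp add: h1_fun_diff)
      qed (use \<delta> in simp)
    qed (use \<delta> in simp)
    also have "\<dots> \<le> (\<delta> * B powr (2 * m)) * norm (U - V)"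
      unfolding abs_l2_h1_fun using \<delta> by (intro mult_left_mono norm_h1_emb_le) auto
    finally have 2: "norm (Q N (abs_l2 (\<lambda>x. indicator (- {-R..<R}) x * g x))) \<le> \<delta> * B powr (2 * m) * norm (U - V)"
      using norm_Q_le order_trans by blast
    have "norm (Q N (nemytskii m U - nemytskii m V)) \<le> (\<delta> * A powr (2 * m) + \<delta> * B powr (2 * m)) * norm (U - V)"
      unfolding split Q_add distrib_right using norm_triangle_mono[OF 1 2] .
    also have "\<dots> \<le> (\<delta> * (1 + A\<^sup>2) + \<delta> * (1 + B\<^sup>2)) * norm (U - V)"
      using \<delta> nn by (intro mult_right_mono add_mono mult_left_mono powr_le_one_add_sq m) auto
    also have "\<dots> \<le> (\<epsilon> * (1 + (norm U)\<^sup>2 + (norm V)\<^sup>2 + (norm (weight_mult t U))\<^sup>2 + (norm (weight_mult t V))\<^sup>2)) * norm (U - V)"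
    proof (rule mult_right_mono)
      have sum2: "(a + b)\<^sup>2 \<le> 2 * a\<^sup>2 + 2 * b\<^sup>2" for a b :: real
        using sum_squares_ge_zero[of "a - b" 0] by (simp add: power2_eq_square algebra_simps)
      have lin: "2 + x + y \<le> 4 * (1 + a + b + c + d)"
        if "x \<le> 2 * a + 2 * b" "y \<le> 2 * c + 2 * d" "0 \<le> a" "0 \<le> b" "0 \<le> c" "0 \<le> d" for a b c d x y :: real
        using that by (simp add: distrib_left)
      have "2 + A\<^sup>2 + B\<^sup>2 \<le> 4 * (1 + (norm U)\<^sup>2 + (norm V)\<^sup>2 + (norm (weight_mult t U))\<^sup>2 + (norm (weight_mult t V))\<^sup>2)"
        unfolding A_def B_def by (intro lin sum2 zero_le_power2)
      then have "\<delta> * (2 + A\<^sup>2 + B\<^sup>2) \<le> \<delta> * (4 * (1 + (norm U)\<^sup>2 + (norm V)\<^sup>2 + (norm (weight_mult t U))\<^sup>2 + (norm (weight_mult t V))\<^sup>2))"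
        using \<delta> by (intro mult_left_mono) auto
      then show "\<delta> * (1 + A\<^sup>2) + \<delta> * (1 + B\<^sup>2) \<le> \<epsilon> * (1 + (norm U)\<^sup>2 + (norm V)\<^sup>2 + (norm (weight_mult t U))\<^sup>2 + (norm (weight_mult t V))\<^sup>2)"
        by (simp add: \<delta>_def algebra_simps)
    qed simp
    finally show ?thesis .
  qed
  then show ?thesis using N(1) K(1) by (intro exI[of _ "2 * K"]) auto
qed

end

section \<open>Dissipativity of the wave operator in the energy norm\<close>

text \<open>Its target carries the product norm, so the energy norm becomes one that comes from an
  inner product. It is the \<open>J\<close> of the abstract decay and Gronwall lemmas.\<close>

definition energy_map :: "real \<Rightarrow> h1 \<times> l2 \<Rightarrow> h1 \<times> l2" where
  "energy_map \<alpha> y = (fst y, snd y + \<alpha> *\<^sub>R h1_emb (fst y))"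

lemma norm_energy_map: "norm (energy_map \<alpha> y) = energy_norm \<alpha> y"
  by (simp add: energy_map_def energy_norm_def norm_prod_def)

lemma bounded_linear_energy_map: "bounded_linear (energy_map \<alpha>)"
  unfolding energy_map_def
  by (intro bounded_linear_Pair bounded_linear_add bounded_linear_fst bounded_linear_snd
      bounded_linear_compose[OF bounded_linear_scaleR_right]
      bounded_linear_compose[OF bounded_linear_h1_emb])

text \<open>The weak form of A: integration by parts moves one derivative to \<open>b\<close> and
  produces the inner product of H^1.\<close>

lemma op_A_inner:
  assumes "op_A a w"
  shows "inner w (h1_emb b) = inner a b"
proof -
  obtain U where U: "h1_emb U = h1_deriv a" "w = - h1_deriv U + h1_emb a"
    using assms by (auto simp: op_A_def)
  have "inner w (h1_emb b) = inner (h1_emb U) (h1_deriv b) + inner (h1_emb a) (h1_emb b)"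
    by (simp add: U(2) inner_add_left inner_diff_left h1_integration_by_parts)
  then show ?thesis by (simp add: U(1) inner_h1)
qed

text \<open>The terms \<open>inner a (fst z)\<close> cancel and leave a cross term of size \<gamma>
  \<alpha> |a| |p|. Young's inequality spends \<alpha> / 4 of the |a|^2 term on it and costs
  \<alpha> \<gamma>^2 |p|^2; \<alpha> is the value for which \<gamma> - \<alpha> - \<alpha>
  \<gamma>^2 = \<alpha>.\<close>

lemma wave_op_dissipative:
  assumes "\<gamma> > 0" and L: "wave_op \<gamma> y z"
  defines "\<alpha> \<equiv> \<gamma> / (2 + \<gamma>\<^sup>2)"
  shows "inner (energy_map \<alpha> y) (energy_map \<alpha> z) \<le> - (3 * \<alpha> / 4) * (norm (energy_map \<alpha> y))\<^sup>2"
proof -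
  have den: "2 + \<gamma>\<^sup>2 > 0" by (simp add: add_pos_nonneg)
  have \<alpha>: "\<alpha> > 0" "\<alpha> * (2 + \<gamma>\<^sup>2) = \<gamma>" using \<open>\<gamma> > 0\<close> den by (auto simp: \<alpha>_def)
  define a q p where "a = fst y" and "q = snd y" and "p = snd y + \<alpha> *\<^sub>R h1_emb (fst y)"
  obtain w where z1: "h1_emb (fst z) = q" and w: "op_A a w" and z2: "snd z = - w - \<gamma> *\<^sub>R q"
    using L unfolding wave_op_def a_def q_def by blast
  \<comment> \<open>On the domain the velocity lies in H^1, so \<open>p\<close> does too and may be
    paired with A in weak form.\<close>
  have p: "p = h1_emb (fst z + \<alpha> *\<^sub>R a)"
    by (simp add: p_def z1 h1_emb_add h1_emb_scaleR a_def q_def)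
  have q: "q = p - \<alpha> *\<^sub>R h1_emb a" by (simp add: p_def q_def a_def)
  have "inner p (snd z + \<alpha> *\<^sub>R q) = - inner w p - (\<gamma> - \<alpha>) * inner q p"
    by (simp add: z2 inner_add_right inner_diff_right inner_commute algebra_simps)
  also have "inner w p = inner a (fst z) + \<alpha> * (norm a)\<^sup>2"
    unfolding p op_A_inner[OF w] by (simp add: inner_add_right power2_norm_eq_inner)
  also have "inner q p = (norm p)\<^sup>2 - \<alpha> * inner (h1_emb a) p"
    unfolding q by (simp add: inner_diff_left power2_norm_eq_inner)
  finally have "inner p (snd z + \<alpha> *\<^sub>R q) =
      - (inner a (fst z) + \<alpha> * (norm a)\<^sup>2) - (\<gamma> - \<alpha>) * ((norm p)\<^sup>2 - \<alpha> * inner (h1_emb a) p)" .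
  moreover have "inner (energy_map \<alpha> y) (energy_map \<alpha> z) = inner a (fst z) + inner p (snd z + \<alpha> *\<^sub>R q)"
    by (simp add: energy_map_def inner_prod_def z1 a_def p_def)
  ultimately have eq: "inner (energy_map \<alpha> y) (energy_map \<alpha> z) =
      - \<alpha> * (norm a)\<^sup>2 - (\<gamma> - \<alpha>) * (norm p)\<^sup>2 + (\<gamma> - \<alpha>) * \<alpha> * inner (h1_emb a) p"
    by (simp add: algebra_simps)
  have "\<alpha> * 1 \<le> \<alpha> * (2 + \<gamma>\<^sup>2)" using \<alpha>(1) by (intro mult_left_mono) auto
  then have \<gamma>\<alpha>: "0 \<le> \<gamma> - \<alpha>" "\<gamma> - \<alpha> \<le> \<gamma>" using \<alpha> by auto
  have "inner (h1_emb a) p \<le> norm a * norm p"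
    using norm_cauchy_schwarz[of "h1_emb a" p] mult_right_mono[OF norm_h1_emb_le[of a] norm_ge_zero[of p]]
    by linarith
  then have "(\<gamma> - \<alpha>) * \<alpha> * inner (h1_emb a) p \<le> (\<gamma> - \<alpha>) * \<alpha> * (norm a * norm p)"
    using \<alpha> \<gamma>\<alpha> by (intro mult_left_mono) auto
  also have "\<dots> \<le> \<gamma> * \<alpha> * (norm a * norm p)"
    using \<alpha> \<gamma>\<alpha> by (intro mult_right_mono) auto
  also have "\<dots> \<le> \<alpha> * ((norm a)\<^sup>2 / 4 + \<gamma>\<^sup>2 * (norm p)\<^sup>2)"
  proof -
    have "0 \<le> (norm a / 2 - \<gamma> * norm p)\<^sup>2" by simp
    then have "\<gamma> * (norm a * norm p) \<le> (norm a)\<^sup>2 / 4 + \<gamma>\<^sup>2 * (norm p)\<^sup>2"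
      by (simp add: power2_diff power_mult_distrib power_divide algebra_simps)
    from mult_left_mono[OF this less_imp_le[OF \<alpha>(1)]] show ?thesis by (simp add: mult_ac)
  qed
  finally have "inner (energy_map \<alpha> y) (energy_map \<alpha> z) \<le>
      - (3 * \<alpha> / 4) * (norm a)\<^sup>2 - (\<gamma> - \<alpha> - \<alpha> * \<gamma>\<^sup>2) * (norm p)\<^sup>2"
    unfolding eq by (simp add: algebra_simps)
  also have "(\<gamma> - \<alpha> - \<alpha> * \<gamma>\<^sup>2) = \<alpha>" using \<alpha>(2) by (simp add: algebra_simps)
  also have "- (3 * \<alpha> / 4) * (norm a)\<^sup>2 - \<alpha> * (norm p)\<^sup>2 \<le> - (3 * \<alpha> / 4) * ((norm a)\<^sup>2 + (norm p)\<^sup>2)"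
  proof -
    have "(3 * \<alpha> / 4) * (norm p)\<^sup>2 \<le> \<alpha> * (norm p)\<^sup>2" using \<alpha>(1) by (intro mult_right_mono) auto
    then show ?thesis by (simp add: algebra_simps)
  qed
  also have "(norm a)\<^sup>2 + (norm p)\<^sup>2 = (norm (energy_map \<alpha> y))\<^sup>2"
    by (simp add: energy_map_def norm_prod_def a_def p_def)
  finally show ?thesis .
qed

section \<open>The difference of two mild solutions\<close>

text \<open>Separability is not assumed, so measurability of the norm of \<open>Y - Z\<close> is
  avoided: its square is bounded pointwise by the measurable \<open>g n\<close> for every n, and
  Fatou's lemma makes their lower limit 0 almost everywhere.\<close>

lemma L2_tendsto_unique:
  assumes "L2_tendsto M X Y" "L2_tendsto M X Z"
  shows "AE \<omega> in M. Y \<omega> = Z \<omega>"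
proof -
  define g where "g n \<omega> = 2 * ennreal ((norm (X n \<omega> - Y \<omega>))\<^sup>2) + 2 * ennreal ((norm (X n \<omega> - Z \<omega>))\<^sup>2)" for n \<omega>
  have [measurable]: "(\<lambda>\<omega>. norm (X n \<omega> - Y \<omega>)) \<in> borel_measurable M" "(\<lambda>\<omega>. norm (X n \<omega> - Z \<omega>)) \<in> borel_measurable M" for n
    using assms by (auto simp: L2_tendsto_def)
  have gm [measurable]: "g n \<in> borel_measurable M" for n unfolding g_def by measurable
  have "(\<lambda>n. 2 * (\<integral>\<^sup>+ \<omega>. ennreal ((norm (X n \<omega> - Y \<omega>))\<^sup>2) \<partial>M) + 2 * (\<integral>\<^sup>+ \<omega>. ennreal ((norm (X n \<omega> - Z \<omega>))\<^sup>2) \<partial>M))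
      \<longlonglongrightarrow> 2 * 0 + 2 * 0"
    using assms unfolding L2_tendsto_def by (intro tendsto_add ennreal_tendsto_cmult) auto
  moreover have "(\<integral>\<^sup>+ \<omega>. g n \<omega> \<partial>M) = 2 * (\<integral>\<^sup>+ \<omega>. ennreal ((norm (X n \<omega> - Y \<omega>))\<^sup>2) \<partial>M) + 2 * (\<integral>\<^sup>+ \<omega>. ennreal ((norm (X n \<omega> - Z \<omega>))\<^sup>2) \<partial>M)" for n
    unfolding g_def by (simp add: nn_integral_add nn_integral_cmult)
  ultimately have lim: "(\<lambda>n. \<integral>\<^sup>+ \<omega>. g n \<omega> \<partial>M) \<longlonglongrightarrow> 0" by simp
  have "(\<integral>\<^sup>+ \<omega>. liminf (\<lambda>n. g n \<omega>) \<partial>M) \<le> liminf (\<lambda>n. \<integral>\<^sup>+ \<omega>. g n \<omega> \<partial>M)"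
    by (rule nn_integral_liminf) measurable
  also have "\<dots> = 0" by (rule lim_imp_Liminf[OF sequentially_bot lim])
  finally have "AE \<omega> in M. liminf (\<lambda>n. g n \<omega>) = 0"
    by (subst (asm) le_zero_eq, subst (asm) nn_integral_0_iff_AE) auto
  then show ?thesis
  proof eventually_elim
    case (elim \<omega>)
    have "ennreal ((norm (Y \<omega> - Z \<omega>))\<^sup>2) \<le> g n \<omega>" for n
    proof -
      have "norm (Y \<omega> - Z \<omega>) \<le> norm (X n \<omega> - Y \<omega>) + norm (X n \<omega> - Z \<omega>)"
        using norm_triangle_ineq4[of "X n \<omega> - Z \<omega>" "X n \<omega> - Y \<omega>"] by (simp add: add.commute)
      then have "(norm (Y \<omega> - Z \<omega>))\<^sup>2 \<le> (norm (X n \<omega> - Y \<omega>) + norm (X n \<omega> - Z \<omega>))\<^sup>2"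
        by (intro power_mono) auto
      also have "\<dots> \<le> 2 * (norm (X n \<omega> - Y \<omega>))\<^sup>2 + 2 * (norm (X n \<omega> - Z \<omega>))\<^sup>2"
        using sum_squares_ge_zero[of "norm (X n \<omega> - Y \<omega>) - norm (X n \<omega> - Z \<omega>)" 0]
        by (simp add: power2_eq_square algebra_simps)
      finally have "ennreal ((norm (Y \<omega> - Z \<omega>))\<^sup>2) \<le> ennreal (2 * (norm (X n \<omega> - Y \<omega>))\<^sup>2 + 2 * (norm (X n \<omega> - Z \<omega>))\<^sup>2)"
        by (rule ennreal_leI)
      also have "\<dots> = g n \<omega>" by (simp add: g_def ennreal_plus ennreal_mult)
      finally show ?thesis .
    qed
    then have "ennreal ((norm (Y \<omega> - Z \<omega>))\<^sup>2) \<le> liminf (\<lambda>n. g n \<omega>)"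
      by (intro Liminf_bounded) auto
    then show ?case using elim by simp
  qed
qed

text \<open>Both stochastic convolutions are limits of the same sums, hence equal almost surely, and
  \<open>h\<close> cancels. Discarding the null sets of all rational times leaves one set of
  \<open>\<omega>\<close> on which the difference is a \<open>mild_path\<close>.\<close>

lemma mild_solution_diff:
  assumes S: "c0_semigroup S"
    and y: "mild_solution M S h W G y" and y': "mild_solution M S h W G' y'"
    and cont: "\<And>\<omega>. continuous_on {0..} (y \<omega>) \<Longrightarrow> continuous_on {0..} (y' \<omega>) \<Longrightarrow>
      continuous_on {0..} (\<lambda>r. G \<omega> r - G' \<omega> r)"
  shows "AE \<omega> in M. continuous_on {0..} (y \<omega>) \<and> continuous_on {0..} (y' \<omega>) \<and>
    mild_path S (\<lambda>t. y \<omega> t - y' \<omega> t) (\<lambda>r. (0, - (G \<omega> r - G' \<omega> r)))"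
proof -
  have mild: "AE \<omega> in M. ((\<lambda>r. S (t - r) (0, - (G \<omega> r - G' \<omega> r))) has_integral
      ((y \<omega> t - y' \<omega> t) - S t (y \<omega> 0 - y' \<omega> 0))) {0..t}" if t: "t \<ge> 0" for t
  proof -
    obtain Z where Z: "stoch_convolution M S W t Z"
      "AE \<omega> in M. ((\<lambda>r. S (t - r) (0, h - G \<omega> r)) has_integral (y \<omega> t - S t (y \<omega> 0) - Z \<omega>)) {0..t}"
      using y t unfolding mild_solution_def by blast
    obtain Z' where Z': "stoch_convolution M S W t Z'"
      "AE \<omega> in M. ((\<lambda>r. S (t - r) (0, h - G' \<omega> r)) has_integral (y' \<omega> t - S t (y' \<omega> 0) - Z' \<omega>)) {0..t}"
      using y' t unfolding mild_solution_def by blast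
    have "AE \<omega> in M. Z \<omega> = Z' \<omega>"
      using Z(1) Z'(1) unfolding stoch_convolution_def by (rule L2_tendsto_unique)
    with Z(2) Z'(2) show ?thesis
    proof eventually_elim
      case (elim \<omega>)
      have "((\<lambda>r. S (t - r) (0, h - G \<omega> r) - S (t - r) (0, h - G' \<omega> r)) has_integral
          ((y \<omega> t - S t (y \<omega> 0) - Z \<omega>) - (y' \<omega> t - S t (y' \<omega> 0) - Z' \<omega>))) {0..t}"
        by (intro has_integral_diff elim)
      moreover have "(y \<omega> t - S t (y \<omega> 0) - Z \<omega>) - (y' \<omega> t - S t (y' \<omega> 0) - Z' \<omega>) =
          (y \<omega> t - y' \<omega> t) - S t (y \<omega> 0 - y' \<omega> 0)"
        using elim(3) by (simp add: linear_simps(2)[OF c0_bl[OF S t]])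
      ultimately show ?case
      proof (rule_tac has_integral_eq[rotated], simp)
        fix r assume "r \<in> {0..t}"
        then have "bounded_linear (S (t - r))" by (intro c0_bl[OF S]) auto
        from linear_simps(2)[OF this, of "(0, h - G \<omega> r)" "(0, h - G' \<omega> r)"]
        show "S (t - r) (0, h - G \<omega> r) - S (t - r) (0, h - G' \<omega> r) = S (t - r) (0, - (G \<omega> r - G' \<omega> r))"
          by simp
      qed
    qed
  qed
  have "countable (\<rat> \<inter> {0::real..})" using countable_rat by (rule countable_Int1)
  then have "AE \<omega> in M. \<forall>t\<in>\<rat> \<inter> {0..}. ((\<lambda>r. S (t - r) (0, - (G \<omega> r - G' \<omega> r))) has_integral
      ((y \<omega> t - y' \<omega> t) - S t (y \<omega> 0 - y' \<omega> 0))) {0..t}"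
    using mild by (subst AE_ball_countable) auto
  moreover have "AE \<omega> in M. continuous_on {0..} (y \<omega>)" "AE \<omega> in M. continuous_on {0..} (y' \<omega>)"
    using y y' by (auto simp: mild_solution_def)
  ultimately show ?thesis
  proof eventually_elim
    case (elim \<omega>)
    have "continuous_on {0..} (\<lambda>r. (0, - (G \<omega> r - G' \<omega> r)) :: h1 \<times> l2)"
      by (intro continuous_intros cont elim)
    then have "mild_path S (\<lambda>t. y \<omega> t - y' \<omega> t) (\<lambda>r. (0, - (G \<omega> r - G' \<omega> r)))"
      using elim by unfold_locales (auto intro!: S continuous_intros)
    then show ?case using elim by blast
  qed
qed

context l2_basis
begin

text \<open>Common to both claims, which differ in \<open>\<rho>\<close> and \<open>T\<close>. For
  the squared norm the decay 3 \<alpha> / 4 doubles to 3 \<alpha> / 2 and the constant part \<alpha>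
  / 4 of the Lipschitz bound doubles to \<alpha> / 2, so the rate \<alpha> remains; by the same
  doubling the growth is \<open>\<rho>\<close>, not half of it.\<close>

lemma energy_estimate:
  assumes m: "0 < m" "m < 1" and \<gamma>: "\<gamma> > 0" and gen: "c0_generated_by S (wave_op \<gamma>)"
    and u: "solves_u m M S h W yu" and v: "solves_v m e N M S h W yu yv"
    and \<rho>_cont: "\<And>U V. continuous_on {0..} U \<Longrightarrow> continuous_on {0..} V \<Longrightarrow> continuous_on {0..} (\<lambda>r. \<rho> r (U r) (V r))"
    and \<rho>: "\<And>r U V. r \<ge> T \<Longrightarrow>
      norm (Q N (nemytskii m U - nemytskii m V)) \<le> (\<alpha> / 4 + \<rho> r U V / 2) * norm (U - V)"
    and \<rho>_nonneg: "\<And>r U V. \<rho> r U V \<ge> 0"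
    and "T \<ge> 0" and \<alpha>: "\<alpha> = \<gamma> / (2 + \<gamma>\<^sup>2)"
  shows "AE \<omega> in M. \<forall>s t. T \<le> s \<longrightarrow> s \<le> t \<longrightarrow>
    (energy_norm \<alpha> (yu \<omega> t - yv \<omega> t))\<^sup>2 \<le> (energy_norm \<alpha> (yu \<omega> s - yv \<omega> s))\<^sup>2 *
      exp (- \<alpha> * (t - s) + integral {s..t} (\<lambda>r. \<rho> r (fst (yu \<omega> r)) (fst (yv \<omega> r))))"
proof -
  have S: "c0_semigroup S" using gen by (simp add: c0_generated_by_def)
  have \<alpha>_pos: "\<alpha> > 0" using \<gamma> by (simp add: \<alpha> add_pos_nonneg)
  have decay: "norm (energy_map \<alpha> (S t y)) \<le> exp (- (3 * \<alpha> / 4) * t) * norm (energy_map \<alpha> y)" if "t \<ge> 0" for t y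
    using wave_op_dissipative[OF \<gamma>] that unfolding \<alpha>
    by (intro c0_dissipative_decay[OF gen bounded_linear_energy_map]) auto
  \<comment> \<open>The feedback through \<open>proj_N\<close> turns the difference of the two
    nonlinear terms into \<open>Q N\<close> of f(u) - f(v).\<close>
  define G where "G \<omega> r = Q N (nemytskii m (fst (yu \<omega> r)) - nemytskii m (fst (yv \<omega> r)))" for \<omega> r
  have GG: "nemytskii m (fst (yu \<omega> r)) - (nemytskii m (fst (yv \<omega> r)) +
      proj_N e N (nemytskii m (fst (yu \<omega> r)) - nemytskii m (fst (yv \<omega> r)))) = G \<omega> r" for \<omega> r
    by (simp add: G_def Q_def)
  have "AE \<omega> in M. continuous_on {0..} (yu \<omega>) \<and> continuous_on {0..} (yv \<omega>) \<and>
    mild_path S (\<lambda>t. yu \<omega> t - yv \<omega> t) (\<lambda>r. (0, - G \<omega> r))"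
    unfolding GG[symmetric]
  proof (rule mild_solution_diff[OF S u[unfolded solves_u_def] v[unfolded solves_v_def]])
    fix \<omega> assume "continuous_on {0..} (yu \<omega>)" "continuous_on {0..} (yv \<omega>)"
    then show "continuous_on {0..} (\<lambda>r. nemytskii m (fst (yu \<omega> r)) - (nemytskii m (fst (yv \<omega> r)) +
        proj_N e N (nemytskii m (fst (yu \<omega> r)) - nemytskii m (fst (yv \<omega> r)))))"
      unfolding GG G_def
      by (intro bounded_linear.continuous_on[OF bounded_linear_Q] continuous_intros
          continuous_on_compose2[OF nemytskii_continuous[OF m]]) auto
  qed
  then show ?thesis
  proof eventually_elim
    case (elim \<omega>)
    then interpret mild_path S "\<lambda>t. yu \<omega> t - yv \<omega> t" "\<lambda>r. (0, - G \<omega> r)" by blast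
    define q where "q r = \<rho> r (fst (yu \<omega> r)) (fst (yv \<omega> r))" for r
    have q: "continuous_on {0..} q"
      unfolding q_def using elim by (intro \<rho>_cont continuous_intros) auto
    show ?case
    proof (intro allI impI)
      fix s t assume st: "T \<le> s" "s \<le> t"
      have qst: "continuous_on {s..t} q" by (rule continuous_on_subset[OF q]) (use st \<open>T \<ge> 0\<close> in auto)
      have "(norm (energy_map \<alpha> (yu \<omega> t - yv \<omega> t)))\<^sup>2 \<le> (norm (energy_map \<alpha> (yu \<omega> s - yv \<omega> s)))\<^sup>2 *
          exp (integral {s..t} (\<lambda>r. - \<alpha> + q r))"
      proof (rule mild_gronwall[OF bounded_linear_energy_map decay])
        show "0 \<le> s" "s \<le> t" using st \<open>T \<ge> 0\<close> by auto
        show "continuous_on {s..t} (\<lambda>r. - \<alpha> + q r)" by (intro continuous_intros qst)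
        fix r assume r: "r \<in> {s..t}"
        define x where "x = energy_map \<alpha> (yu \<omega> r - yv \<omega> r)"
        have "energy_map \<alpha> (0, - G \<omega> r) = (0, - G \<omega> r)"
          using linear_simps(3)[OF bounded_linear_h1_emb] by (simp add: energy_map_def)
        then have "2 * inner x (energy_map \<alpha> (0, - G \<omega> r)) \<le> 2 * (norm x * norm (G \<omega> r))"
          using norm_cauchy_schwarz[of x "(0, - G \<omega> r)"] by simp
        also have "\<dots> \<le> 2 * (norm x * ((\<alpha> / 4 + q r / 2) * norm x))"
        proof -
          have nx: "norm (fst (yu \<omega> r) - fst (yv \<omega> r)) \<le> norm x"
            by (simp add: x_def energy_map_def norm_prod_def real_le_rsqrt)
          have G: "norm (G \<omega> r) \<le> (\<alpha> / 4 + q r / 2) * norm (fst (yu \<omega> r) - fst (yv \<omega> r))"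
            unfolding G_def q_def using r st by (intro \<rho>) auto
          also have "\<dots> \<le> (\<alpha> / 4 + q r / 2) * norm x"
            using nx \<alpha>_pos \<rho>_nonneg by (intro mult_left_mono) (auto simp: q_def add_nonneg_nonneg)
          finally show ?thesis by (intro mult_left_mono) auto
        qed
        also have "\<dots> = (- \<alpha> + q r + 2 * (3 * \<alpha> / 4)) * (norm x)\<^sup>2"
          by (simp add: power2_eq_square algebra_simps)
        finally show "2 * inner (energy_map \<alpha> (yu \<omega> r - yv \<omega> r)) (energy_map \<alpha> (0, - G \<omega> r)) \<le>
          (- \<alpha> + q r + 2 * (3 * \<alpha> / 4)) * (norm (energy_map \<alpha> (yu \<omega> r - yv \<omega> r)))\<^sup>2"
          by (simp add: x_def)
      qed
      also have "integral {s..t} (\<lambda>r. - \<alpha> + q r) = - \<alpha> * (t - s) + integral {s..t} q"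
        using st by (subst Henstock_Kurzweil_Integration.integral_add[OF integrable_const_ivl integrable_continuous_real[OF qst]])
          (simp add: mult.commute)
      finally show "(energy_norm \<alpha> (yu \<omega> t - yv \<omega> t))\<^sup>2 \<le> (energy_norm \<alpha> (yu \<omega> s - yv \<omega> s))\<^sup>2 *
          exp (- \<alpha> * (t - s) + integral {s..t} (\<lambda>r. \<rho> r (fst (yu \<omega> r)) (fst (yv \<omega> r))))"
        unfolding norm_energy_map q_def .
    qed
  qed
qed

end

theorem theorem2p2:
  fixes M :: "'w measure" and m \<gamma> :: real and h :: l2
    and e :: "nat \<Rightarrow> l2" and b :: "nat \<Rightarrow> real" and \<beta> :: "nat \<Rightarrow> real \<Rightarrow> 'w \<Rightarrow> real"
    and W :: "real \<Rightarrow> 'w \<Rightarrow> l2" and S :: "real \<Rightarrow> h1 \<times> l2 \<Rightarrow> h1 \<times> l2"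
  assumes "prob_space M"
    and "0 < m" "m < 1" "0 < \<gamma>"
    and "orthonormal_basis e"
    and "noise_process M b \<beta> e W"
    and "c0_generated_by S (wave_op \<gamma>)"
  shows "(\<exists>\<alpha>>0. \<exists>C>0. \<forall>N\<ge>1. \<forall>yu yv.
            solves_u m M S h W yu \<longrightarrow> solves_v m e N M S h W yu yv \<longrightarrow>
            (AE \<omega> in M. \<forall>s t. 0 \<le> s \<longrightarrow> s \<le> t \<longrightarrow>
               (energy_norm \<alpha> (yu \<omega> t - yv \<omega> t))\<^sup>2
               \<le> (energy_norm \<alpha> (yu \<omega> s - yv \<omega> s))\<^sup>2 *
                 exp (- \<alpha> * (t - s) +
                      C * integral {s..t} (\<lambda>r. (norm (fst (yu \<omega> r)))\<^sup>2 + (norm (fst (yv \<omega> r)))\<^sup>2))))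
       \<and> (\<exists>\<alpha>>0. \<exists>Cs>0. \<forall>\<epsilon>>0. \<exists>T0>0. \<exists>N\<ge>1. \<forall>yu yv.
            solves_u m M S h W yu \<longrightarrow> solves_v m e N M S h W yu yv \<longrightarrow>
            (AE \<omega> in M. \<forall>s t. 0 \<le> s \<longrightarrow> s \<le> t \<longrightarrow>
               (energy_norm \<alpha> (yu \<omega> (t + T0) - yv \<omega> (t + T0)))\<^sup>2
               \<le> (energy_norm \<alpha> (yu \<omega> (s + T0) - yv \<omega> (s + T0)))\<^sup>2 *
                 exp (- \<alpha> * (t - s) +
                      Cs * \<epsilon> * integral {s + T0..t + T0}
                        (\<lambda>r. (norm (fst (yu \<omega> r)))\<^sup>2 + (norm (fst (yv \<omega> r)))\<^sup>2 +
                             (norm (weight_mult r (fst (yu \<omega> r))))\<^sup>2 +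
                             (norm (weight_mult r (fst (yv \<omega> r))))\<^sup>2))))"
proof -
  interpret l2_basis e by unfold_locales (rule assms(5))
  note m = assms(2,3)
  define \<alpha> where "\<alpha> = \<gamma> / (2 + \<gamma>\<^sup>2)"
  have \<alpha>: "\<alpha> > 0" using assms(4) by (simp add: \<alpha>_def add_pos_nonneg)
  note estimate = energy_estimate[OF m assms(4,7) _ _ _ _ _ _ \<alpha>_def]
  \<comment> \<open>12 times \<alpha> / 48 is the admissible \<alpha> / 4. The 48 in
    \<open>48 * C0\<close> is 12, doubled by (a + b)^2 \<le> 2 a^2 + 2 b^2 and doubled again because
    \<open>\<rho>\<close> is halved in \<open>energy_estimate\<close>.\<close>
  obtain C0 where C0: "C0 > 0" "\<And>a. a \<ge> 0 \<Longrightarrow> a powr (2 * m) \<le> \<alpha> / 48 + C0 * a\<^sup>2"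
    using powr_absorb[OF m, of "\<alpha> / 48"] \<alpha> by auto
  have Q1: "norm (Q N (nemytskii m U - nemytskii m V)) \<le> (\<alpha> / 4 + 48 * C0 * ((norm U)\<^sup>2 + (norm V)\<^sup>2) / 2) * norm (U - V)"
    for N U V
  proof -
    have "norm (Q N (nemytskii m U - nemytskii m V)) \<le> 12 * (norm U + norm V) powr (2 * m) * norm (U - V)"
      by (rule order_trans[OF norm_Q_le norm_nemytskii_diff_le[OF m]])
    also have "\<dots> \<le> (\<alpha> / 4 + 48 * C0 * ((norm U)\<^sup>2 + (norm V)\<^sup>2) / 2) * norm (U - V)"
    proof (rule mult_right_mono)
      have "(norm U + norm V) powr (2 * m) \<le> \<alpha> / 48 + C0 * (norm U + norm V)\<^sup>2" by (rule C0) simp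
      also have "\<dots> \<le> \<alpha> / 48 + C0 * (2 * ((norm U)\<^sup>2 + (norm V)\<^sup>2))"
        using C0(1) sum_squares_ge_zero[of "norm U - norm V" 0]
        by (intro add_left_mono mult_left_mono) (auto simp: power2_eq_square algebra_simps)
      finally have "12 * (norm U + norm V) powr (2 * m) \<le> 12 * (\<alpha> / 48 + C0 * (2 * ((norm U)\<^sup>2 + (norm V)\<^sup>2)))"
        by simp
      also have "\<dots> = \<alpha> / 4 + 48 * C0 * ((norm U)\<^sup>2 + (norm V)\<^sup>2) / 2" by (simp add: field_simps)
      finally show "12 * (norm U + norm V) powr (2 * m) \<le> \<alpha> / 4 + 48 * C0 * ((norm U)\<^sup>2 + (norm V)\<^sup>2) / 2" .
    qed simp
    finally show ?thesis .
  qed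
  have part1: "AE \<omega> in M. \<forall>s t. 0 \<le> s \<longrightarrow> s \<le> t \<longrightarrow>
      (energy_norm \<alpha> (yu \<omega> t - yv \<omega> t))\<^sup>2 \<le> (energy_norm \<alpha> (yu \<omega> s - yv \<omega> s))\<^sup>2 *
        exp (- \<alpha> * (t - s) + 48 * C0 * integral {s..t} (\<lambda>r. (norm (fst (yu \<omega> r)))\<^sup>2 + (norm (fst (yv \<omega> r)))\<^sup>2))"
    if "solves_u m M S h W yu" "solves_v m e N M S h W yu yv" for N yu yv
    \<comment> \<open>Moves the constant under the integral, so that the integrand is
      \<open>\<rho>\<close> itself.\<close>
    unfolding integral_mult_right[symmetric]
    by (rule estimate[OF that, where \<rho> = "\<lambda>r U V. 48 * C0 * ((norm U)\<^sup>2 + (norm V)\<^sup>2)"])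
       (use Q1 C0(1) in \<open>auto intro!: continuous_intros\<close>)
  have part2: "\<exists>T0>0. \<exists>N\<ge>1. \<forall>yu yv. solves_u m M S h W yu \<longrightarrow> solves_v m e N M S h W yu yv \<longrightarrow>
      (AE \<omega> in M. \<forall>s t. 0 \<le> s \<longrightarrow> s \<le> t \<longrightarrow>
        (energy_norm \<alpha> (yu \<omega> (t + T0) - yv \<omega> (t + T0)))\<^sup>2
          \<le> (energy_norm \<alpha> (yu \<omega> (s + T0) - yv \<omega> (s + T0)))\<^sup>2 *
            exp (- \<alpha> * (t - s) + 2 * \<epsilon> * integral {s + T0..t + T0}
              (\<lambda>r. (norm (fst (yu \<omega> r)))\<^sup>2 + (norm (fst (yv \<omega> r)))\<^sup>2 +
                   (norm (weight_mult r (fst (yu \<omega> r))))\<^sup>2 + (norm (weight_mult r (fst (yv \<omega> r))))\<^sup>2)))"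
    if "\<epsilon> > 0" for \<epsilon>
  proof -
    \<comment> \<open>In \<open>Q_nemytskii_le\<close> the small factor also multiplies 1; capping
      it by \<alpha> / 4 lets the decay absorb this constant term for large \<epsilon> as
      well.\<close>
    define \<epsilon>1 where "\<epsilon>1 = min (\<alpha> / 4) \<epsilon>"
    have \<epsilon>1: "\<epsilon>1 > 0" "\<epsilon>1 \<le> \<alpha> / 4" "\<epsilon>1 \<le> \<epsilon>" using \<alpha> that by (auto simp: \<epsilon>1_def)
    define \<sigma> where "\<sigma> r U V = (norm U)\<^sup>2 + (norm V)\<^sup>2 + (norm (weight_mult r U))\<^sup>2 + (norm (weight_mult r V))\<^sup>2"
      for r U V
    have \<sigma>: "\<sigma> r U V \<ge> 0" for r U V by (simp add: \<sigma>_def)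
    obtain T N where T: "T > 0" and N: "N \<ge> 1" and Q2: "\<And>U V r. r \<ge> T \<Longrightarrow>
        norm (Q N (nemytskii m U - nemytskii m V)) \<le> \<epsilon>1 * (1 + (norm U)\<^sup>2 + (norm V)\<^sup>2
          + (norm (weight_mult r U))\<^sup>2 + (norm (weight_mult r V))\<^sup>2) * norm (U - V)"
      using Q_nemytskii_le[OF m \<epsilon>1(1)] by blast
    have bound: "norm (Q N (nemytskii m U - nemytskii m V)) \<le> (\<alpha> / 4 + 2 * \<epsilon> * \<sigma> r U V / 2) * norm (U - V)"
      if "r \<ge> T" for r U V
    proof -
      have "norm (Q N (nemytskii m U - nemytskii m V)) \<le> (\<epsilon>1 * 1 + \<epsilon>1 * \<sigma> r U V) * norm (U - V)"
        using Q2[OF that, of U V] by (simp add: \<sigma>_def distrib_left add.assoc)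
      also have "\<dots> \<le> (\<alpha> / 4 + \<epsilon> * \<sigma> r U V) * norm (U - V)"
        using \<epsilon>1 \<sigma> by (intro mult_right_mono add_mono) auto
      finally show ?thesis by simp
    qed
    have from_T: "AE \<omega> in M. \<forall>s t. T \<le> s \<longrightarrow> s \<le> t \<longrightarrow>
        (energy_norm \<alpha> (yu \<omega> t - yv \<omega> t))\<^sup>2 \<le> (energy_norm \<alpha> (yu \<omega> s - yv \<omega> s))\<^sup>2 *
          exp (- \<alpha> * (t - s) + 2 * \<epsilon> * integral {s..t} (\<lambda>r. \<sigma> r (fst (yu \<omega> r)) (fst (yv \<omega> r))))"
      if "solves_u m M S h W yu" "solves_v m e N M S h W yu yv" for yu yv
      unfolding integral_mult_right[symmetric]
    proof (rule estimate[OF that, where \<rho> = "\<lambda>r U V. 2 * \<epsilon> * \<sigma> r U V"])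
      show "continuous_on {0..} (\<lambda>r. 2 * \<epsilon> * \<sigma> r (U r) (V r))"
        if "continuous_on {0..} U" "continuous_on {0..} V" for U V
        unfolding \<sigma>_def by (intro continuous_intros weight_mult_continuous_on that)
    qed (use bound \<sigma> T \<open>\<epsilon> > 0\<close> in auto)
    have "AE \<omega> in M. \<forall>s t. 0 \<le> s \<longrightarrow> s \<le> t \<longrightarrow>
        (energy_norm \<alpha> (yu \<omega> (t + T) - yv \<omega> (t + T)))\<^sup>2 \<le> (energy_norm \<alpha> (yu \<omega> (s + T) - yv \<omega> (s + T)))\<^sup>2 *
          exp (- \<alpha> * (t - s) + 2 * \<epsilon> * integral {s + T..t + T} (\<lambda>r. \<sigma> r (fst (yu \<omega> r)) (fst (yv \<omega> r))))"
      if "solves_u m M S h W yu" "solves_v m e N M S h W yu yv" for yu yv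
      using from_T[OF that]
    proof eventually_elim
      case (elim \<omega>)
      show ?case
      proof (intro allI impI)
        fix s t :: real assume "0 \<le> s" "s \<le> t"
        then show "(energy_norm \<alpha> (yu \<omega> (t + T) - yv \<omega> (t + T)))\<^sup>2 \<le> (energy_norm \<alpha> (yu \<omega> (s + T) - yv \<omega> (s + T)))\<^sup>2 *
            exp (- \<alpha> * (t - s) + 2 * \<epsilon> * integral {s + T..t + T} (\<lambda>r. \<sigma> r (fst (yu \<omega> r)) (fst (yv \<omega> r))))"
          using elim[rule_format, of "s + T" "t + T"] by simp
      qed
    qed
    then show ?thesis using T N unfolding \<sigma>_def by blast
  qed
  have "48 * C0 > 0" using C0(1) by simp
  show ?thesis
    apply (rule conjI)
     apply (rule exI[of _ \<alpha>], rule conjI, rule \<alpha>, rule exI[of _ "48 * C0"], rule conjI, fact)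
     apply (intro allI impI, rule part1; assumption)
    \<comment> \<open>The constant 2 only undoes the halving of \<open>\<rho>\<close> in
      \<open>energy_estimate\<close>.\<close>
    apply (rule exI[of _ \<alpha>], rule conjI, rule \<alpha>, rule exI[of _ "2::real"], rule conjI, simp)
    apply (intro allI impI, rule part2, assumption)
    done
qed

end
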